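(* Let $\mathbf{E}$ be an Elasticity tensor on $\mathbb{R}^3$ and write it, in an orthonormal frame, as $$E_{ijkl}=\lambda\delta_{ij}\delta_{kl}+\mu(\delta_{ik}\delta_{jl}+\delta_{il}\delta_{jk})+\delta_{ij}a_{kl}+\delta_{kl}a_{ij}+\delta_{ik}b_{jl}+\delta_{jl}b_{ik}+\delta_{il}b_{jk}+\delta_{jk}b_{il}+H_{ijkl},$$ where $\lambda,\mu$ are scalars, $\mathbf{a},\mathbf{b}$ are symmetric traceless second-order tensors and $\mathbf{H}\in\mathbb{H}^4$. Then: (1) $\mathbf{E}$ is isotropic iff $\mathbf{a}=\mathbf{b}=\mathbf{d}_2=0$. (2) $\mathbf{E}$ is cubic iff $\mathbf{a}=\mathbf{b}=\mathbf{d}_2'=0$ and $\mathbf{d}_2\neq 0$. (3) $\mathbf{E}$ is transversely isotropic iff the triple $(\mathbf{d}_2,\mathbf{a},\mathbf{b})$ is transversely isotropic and $\mathbf{H}\times\mathbf{d}_2=\mathbf{H}\times\mathbf{a}=\mathbf{H}\times\mathbf{b}=0$. (4) $\mathbf{E}$ is tetragonal iff $(\mathbf{d}_2,\mathbf{a},\mathbf{b})$ is transversely isotropic, $\operatorname{tr}(\mathbf{H}\times\mathbf{d}_2)=\operatorname{tr}(\mathbf{H}\times\mathbf{a})=\operatorname{tr}(\mathbf{H}\times\mathbf{b})=0$, and at least one of $\mathbf{H}\times\mathbf{d}_2$, $\mathbf{H}\times\mathbf{a}$, $\mathbf{H}\times\mathbf{b}$ is nonzero. (5) $\mathbf{E}$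 is trigonal iff $(\mathbf{d}_2,\mathbf{a},\mathbf{b})$ is transversely isotropic, $\mathbf{d}_2\times(\mathbf{H}:\mathbf{d}_2)=\mathbf{a}\times(\mathbf{H}:\mathbf{a})=\mathbf{b}\times(\mathbf{H}:\mathbf{b})=0$, and at least one of $\operatorname{tr}(\mathbf{H}\times\mathbf{d}_2)$, $\operatorname{tr}(\mathbf{H}\times\mathbf{a})$, $\operatorname{tr}(\mathbf{H}\times\mathbf{b})$ is nonzero. (6) $\mathbf{E}$ is orthotropic iff the family $\mathcal{F}_o=\{\mathbf{d}_2,\mathbf{a},\mathbf{b},\mathbf{c}_3,\mathbf{c}_4,\mathbf{H}:\mathbf{a},\mathbf{H}:\mathbf{b},\mathbf{H}:\mathbf{a}^2,\mathbf{H}:\mathbf{b}^2\}$ is orthotropic. (7) $\mathbf{E}$ is monoclinic iff the family $\mathcal{F}_m=\mathcal{F}_o\cup\{\mathbf{H}:(\mathbf{a}\mathbf{b})^s,\mathbf{H}:(\mathbf{a}\mathbf{d}_2)^s,\mathbf{H}:(\mathbf{b}\mathbf{d}_2)^s\}$ is monoclinic. (8) $\mathbf{E}$ is triclinic iff none of the conditions in (1)–(7) holds.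
   Context: An Elasticity tensor is a fourth-order tensor $\mathbf{E}$ on $\mathbb{R}^3$ with $E_{ijkl}=E_{jikl}=E_{klij}$. $\mathbb{H}^4$ is the space of totally symmetric, traceless fourth-order tensors on $\mathbb{R}^3$. $SO(3)$ acts on $n$-th order tensors by $(g\star\mathbf{T})(x_1,\dots,x_n)=\mathbf{T}(g^{-1}x_1,\dots,g^{-1}x_n)$. The symmetry group of a tensor is $\{g\in SO(3): g\star\mathbf{T}=\mathbf{T}\}$; the symmetry group of a family of tensors is the intersection of the symmetry groups of its members; the symmetry class is the conjugacy class of the symmetry group in $SO(3)$. Names: isotropic $=[SO(3)]$, transversely isotropic $=[O(2)]$, cubic $=[\mathbb{O}]$ (orientation-preserving symmetry group of a cube, order 24), tetragonal $=[\mathbb{D}_4]$, trigonal $=[\mathbb{D}_3]$, orthotropic $=[\mathbb{D}_2]$, monoclinic $=[\mathbb{Z}_2]$, triclinic $=[\{1\}]$, where $O(2)$ is generated by the rotations about the $z$-axis and the rotation by $\pi$ about the $x$-axis, $\mathbb{Z}_n$ is the group of rotations by multiples of $2\pi/n$ about the $z$-axis, and $\mathbb{D}_n$ is generated by $\mathbb{Z}_n$ and the rotation by $\pi$ about the $x$-axis. Notation: for fourth-order tensors $(\mathbf{A}:\mathbf{B})_{ijkl}=A_{ijmn}B_{mnkl}$, $\mathbf{H}^2=\mathbf{H}:\mathbf{H}$, $\mathbf{H}^n=\mathbf{H}:\mathbf{H}^{n-1}$; for a second-order tensor $\mathbf{a}$, $(\mathbf{H}:\mathbf{a})_{ij}=H_{ijkl}a_{kl}$;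 $(\operatorname{tr}_{13}\mathbf{A})_{ij}=A_{kikj}$; $\mathbf{d}_2=\operatorname{tr}_{13}(\mathbf{H}^2)$, $\mathbf{c}_3=\mathbf{H}:\mathbf{d}_2$, $\mathbf{c}_4=\mathbf{H}:\mathbf{c}_3$. Products $\mathbf{a}\mathbf{b}$ of second-order tensors are matrix products, $(\mathbf{a}\mathbf{b})^s=\frac12(\mathbf{a}\mathbf{b}+\mathbf{b}\mathbf{a})$, $\mathbf{a}^2=\mathbf{a}\mathbf{a}$, $\mathbf{a}'=\mathbf{a}-\frac13\operatorname{tr}(\mathbf{a})\mathbf{q}$ with $\mathbf{q}$ the identity (metric) tensor. For totally symmetric tensors $\mathbf{S}^1$ of order $p$ and $\mathbf{S}^2$ of order $q$, the generalized cross product $\mathbf{S}^1\times\mathbf{S}^2$ is the totally symmetric tensor of order $p+q-1$ given by the total symmetrization of $\varepsilon_{i_1jk}S^1_{ji_2\cdots i_p}S^2_{ki_{p+1}\cdots i_{p+q-1}}$ ($\varepsilon$ the Levi-Civita tensor); $\operatorname{tr}$ of a totally symmetric tensor is the contraction of any two indices. *)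

theory Defs
  imports "HOL-Analysis.Analysis" "HOL-Analysis.Cross3" "HOL-Combinatorics.Permutations"
begin

text \<open>Tensors on R^3 in a fixed orthonormal frame. Indices range over the type 3.
  A tensor of order n is a function from index lists to reals; only lists of length n
  are meaningful (values at other lists are ignored by every notion below).\<close>

type_synonym tensor = "3 list \<Rightarrow> real"

definition kd :: "3 \<Rightarrow> 3 \<Rightarrow> real" where
  "kd i j = (if i = j then 1 else 0)"

definition eps :: "3 \<Rightarrow> 3 \<Rightarrow> 3 \<Rightarrow> real" where
  "eps i j k = cross3 (axis i 1) (axis j 1) \<bullet> axis k 1"

definition SO3 :: "(real^3^3) set" where
  "SO3 = {g. rotation_matrix g}"

text \<open>Action: (g*T)(x1..xn) = T(g^-1 x1,..,g^-1 xn), in components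
  (g*T)_{i1..in} = sum_j g_{i1 j1} ... g_{in jn} T_{j1..jn}.\<close>
definition tact :: "real^3^3 \<Rightarrow> nat \<Rightarrow> tensor \<Rightarrow> tensor" where
  "tact g n T = (\<lambda>xs. \<Sum>js\<in>{js::3 list. length js = n}.
       (\<Prod>k<n. g $ (xs ! k) $ (js ! k)) * T js)"

definition teq :: "nat \<Rightarrow> tensor \<Rightarrow> tensor \<Rightarrow> bool" where
  "teq n S T \<longleftrightarrow> (\<forall>xs. length xs = n \<longrightarrow> S xs = T xs)"

definition tzero :: "nat \<Rightarrow> tensor \<Rightarrow> bool" where
  "tzero n T \<longleftrightarrow> teq n T (\<lambda>_. 0)"

definition symgroup :: "nat \<Rightarrow> tensor \<Rightarrow> (real^3^3) set" where
  "symgroup n T = {g \<in> SO3. teq n (tact g n T) T}"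

definition fam_symgroup :: "(nat \<times> tensor) list \<Rightarrow> (real^3^3) set" where
  "fam_symgroup F = {g \<in> SO3. \<forall>(n, T) \<in> set F. g \<in> symgroup n T}"

definition in_class :: "(real^3^3) set \<Rightarrow> (real^3^3) set \<Rightarrow> bool" where
  "in_class G K \<longleftrightarrow> (\<exists>g \<in> SO3. G = (\<lambda>k. g ** k ** transpose g) ` K)"

definition rotz :: "real \<Rightarrow> real^3^3" where
  "rotz t = vector [vector [cos t, - sin t, 0], vector [sin t, cos t, 0], vector [0, 0, 1]]"

definition rxpi :: "real^3^3" where
  "rxpi = vector [vector [1, 0, 0], vector [0, -1, 0], vector [0, 0, -1]]"

definition ZZ :: "nat \<Rightarrow> (real^3^3) set" where
  "ZZ n = {rotz (2 * pi * real k / real n) | k. k < n}"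

text \<open>D_n = group generated by Z_n and rxpi = Z_n \<union> Z_n rxpi.\<close>
definition DD :: "nat \<Rightarrow> (real^3^3) set" where
  "DD n = ZZ n \<union> {r ** rxpi | r. r \<in> ZZ n}"

definition O2 :: "(real^3^3) set" where
  "O2 = {rotz t | t. True} \<union> {rotz t ** rxpi | t. True}"

text \<open>Orientation-preserving symmetry group of the cube [-1,1]^3: signed permutation
  matrices of determinant 1 (order 24).\<close>
definition Oct :: "(real^3^3) set" where
  "Oct = {g \<in> SO3. \<forall>i j. g $ i $ j \<in> {-1, 0, 1}}"

definition trivgrp :: "(real^3^3) set" where
  "trivgrp = {mat 1}"

definition ddot44 :: "tensor \<Rightarrow> tensor \<Rightarrow> tensor" where
  "ddot44 A B = (\<lambda>xs. \<Sum>m\<in>UNIV. \<Sum>n\<in>UNIV. A [xs!0, xs!1, m, n] * B [m, n, xs!2, xs!3])"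

definition ddot42 :: "tensor \<Rightarrow> tensor \<Rightarrow> tensor" where
  "ddot42 H a = (\<lambda>xs. \<Sum>k\<in>UNIV. \<Sum>l\<in>UNIV. H [xs!0, xs!1, k, l] * a [k, l])"

definition tr13 :: "tensor \<Rightarrow> tensor" where
  "tr13 A = (\<lambda>xs. \<Sum>k\<in>UNIV. A [k, xs!0, k, xs!1])"

definition d2 :: "tensor \<Rightarrow> tensor" where
  "d2 H = tr13 (ddot44 H H)"

definition c3 :: "tensor \<Rightarrow> tensor" where
  "c3 H = ddot42 H (d2 H)"

definition c4 :: "tensor \<Rightarrow> tensor" where
  "c4 H = ddot42 H (c3 H)"

definition mprod :: "tensor \<Rightarrow> tensor \<Rightarrow> tensor" where
  "mprod a b = (\<lambda>xs. \<Sum>k\<in>UNIV. a [xs!0, k] * b [k, xs!1])"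

definition symprod :: "tensor \<Rightarrow> tensor \<Rightarrow> tensor" where
  "symprod a b = (\<lambda>xs. (mprod a b xs + mprod b a xs) / 2)"

definition trace2 :: "tensor \<Rightarrow> real" where
  "trace2 a = (\<Sum>k\<in>UNIV. a [k, k])"

definition dev :: "tensor \<Rightarrow> tensor" where
  "dev a = (\<lambda>xs. a xs - trace2 a / 3 * kd (xs!0) (xs!1))"

text \<open>Trace of a totally symmetric tensor (contraction of the first two indices).\<close>
definition ttr :: "tensor \<Rightarrow> tensor" where
  "ttr T = (\<lambda>xs. \<Sum>k\<in>UNIV. T (k # k # xs))"

definition permute_list :: "(nat \<Rightarrow> nat) \<Rightarrow> 3 list \<Rightarrow> 3 list" where
  "permute_list \<sigma> xs = map (\<lambda>i. xs ! \<sigma> i) [0..<length xs]"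

definition tsymmetrize :: "nat \<Rightarrow> tensor \<Rightarrow> tensor" where
  "tsymmetrize r T = (\<lambda>xs. (\<Sum>\<sigma>\<in>{\<sigma>. \<sigma> permutes {0..<r}}. T (permute_list \<sigma> xs)) / fact r)"

text \<open>Generalized cross product of totally symmetric S1 (order p) and S2 (order q):
  total symmetrization of eps_{i1 j k} S1_{j i2..ip} S2_{k i(p+1)..i(p+q-1)}, order p+q-1.\<close>
definition gcross :: "nat \<Rightarrow> tensor \<Rightarrow> nat \<Rightarrow> tensor \<Rightarrow> tensor" where
  "gcross p S1 q S2 = tsymmetrize (p + q - 1)
     (\<lambda>xs. \<Sum>j\<in>UNIV. \<Sum>k\<in>UNIV. eps (xs!0) j k * S1 (j # take (p - 1) (drop 1 xs))
                                           * S2 (k # drop p xs))"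

definition elasticity :: "tensor \<Rightarrow> bool" where
  "elasticity E \<longleftrightarrow> (\<forall>i j k l. E [i,j,k,l] = E [j,i,k,l] \<and> E [i,j,k,l] = E [k,l,i,j])"

definition sym_traceless2 :: "tensor \<Rightarrow> bool" where
  "sym_traceless2 a \<longleftrightarrow> (\<forall>i j. a [i,j] = a [j,i]) \<and> trace2 a = 0"

definition totsym :: "nat \<Rightarrow> tensor \<Rightarrow> bool" where
  "totsym n T \<longleftrightarrow> (\<forall>\<sigma> xs. \<sigma> permutes {0..<n} \<longrightarrow> length xs = n \<longrightarrow> T (permute_list \<sigma> xs) = T xs)"

definition harm4 :: "tensor \<Rightarrow> bool" where
  "harm4 H \<longleftrightarrow> totsym 4 H \<and> tzero 2 (ttr H)"

end

theory Submission
  imports Defs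
begin

text \<open>
  The symmetry group of \<open>E\<close> is the common stabilizer of \<open>a\<close>, \<open>b\<close> and \<open>H\<close>, because \<open>3a + 4b\<close> and \<open>2a + 5b\<close> are, up to
  isotropic terms, contractions of \<open>E\<close>. Since \<open>d\<^sub>2\<close> is the Gram matrix of the slices of \<open>H\<close>, it vanishes only for \<open>H = 0\<close>;
  if it is isotropic and nonzero, the frame at a maximum of \<open>|H(x,x,x,x)|\<close> on the sphere shows that \<open>H\<close> is cubic.

  If the family \<open>\<F>\<^sub>o\<close> is not transversely isotropic, every rotation fixing it is the identity or a half-turn, and the
  axis of the half-turn is a common eigenvector of the family. The decisive point is that such a half-turn already fixes
  \<open>H\<close>: the odd part of \<open>H\<close> must kill \<open>d\<^sub>2\<close>, \<open>c\<^sub>3\<close>, \<open>a\<close>, \<open>b\<close>, \<open>a\<^sup>2\<close>, \<open>b\<^sup>2\<close>, which is impossible unless it vanishes. Hence \<open>E\<close>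
  has the symmetry group of \<open>\<F>\<^sub>o\<close> in this case.

  If \<open>\<F>\<^sub>o\<close> is transversely isotropic with axis \<open>n\<close>, decompose \<open>H\<close> by weights under rotations about \<open>n\<close>: only the weights
  0, 3, 4 occur, and \<open>d\<^sub>2 n \<parallel> n\<close> forbids weights 3 and 4 simultaneously. This gives the classes of \<open>O(2)\<close>, \<open>D\<^sub>3\<close>, \<open>D\<^sub>4\<close>,
  which the cross products tell apart, since \<open>H \<times> (n \<otimes> n)\<close> is the polynomial \<open>(n \<sqdot> x)\<close> times the angular derivative of \<open>H\<close>.
\<close>

section \<open>Conjugation by rotations\<close>

text \<open>The obstacle is that the map from \<open>H\<close> to \<open>d2\<close> is quadratic. A
  half-turn fixing the family gives linear equations for the odd part of \<open>H\<close>, but their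
  coefficients contain \<open>d2\<close>, which itself depends on that odd part. Passing from index
  tensors to multilinear forms makes a rotation a substitution, and nine coordinates describe a
  harmonic form, so in a well-chosen frame the self-consistency of these equations is polynomial
  algebra. In the generic frame it ends in \<open>1 = 0\<close>.

  For isotropic \<open>d2\<close> the quadratic system alone is hard to solve; a maximum of the
  quartic adds two linear equations and two inequalities, which make it easy.

  The trace conditions work because a symmetric tensor is determined by its polynomial, total
  symmetrization leaves the polynomial unchanged, and the trace becomes the Laplacian. The angular
  derivative \<open>theta\<close> of a harmonic quartic is again harmonic, so the Laplacian of
  \<open>(n . x) theta\<close> is twice the derivative of \<open>theta\<close> along
  \<open>n\<close>. It kills the weight 4 part, which does not involve \<open>n . x\<close>, and
  keeps the weight 3 part; this is what tells D_4 from D_3.\<close>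

definition cj :: "real^3^3 \<Rightarrow> real^3^3 \<Rightarrow> real^3^3" where
  "cj g M = g ** M ** transpose g"

definition msym :: "(real^3^3) set \<Rightarrow> (real^3^3) set" where
  "msym F = {g \<in> SO3. \<forall>M\<in>F. cj g M = M}"

lemma SO3_orth:
  assumes "g \<in> SO3"
  shows "transpose g ** g = mat 1" "g ** transpose g = mat 1" "det g = 1"
  using assms by (auto simp: SO3_def rotation_matrix_def orthogonal_matrix_def)

lemma SO3_I: "transpose g ** g = mat 1 \<Longrightarrow> det g = 1 \<Longrightarrow> g \<in> SO3"
  by (simp add: SO3_def rotation_matrix_def orthogonal_matrix)

lemma SO3_one [simp]: "mat 1 \<in> SO3"
  by (rule SO3_I) auto

lemma SO3_mult: "g \<in> SO3 \<Longrightarrow> h \<in> SO3 \<Longrightarrow> g ** h \<in> SO3"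
  by (auto simp: SO3_def rotation_matrix_def orthogonal_matrix_mul det_mul)

lemma SO3_transpose: "g \<in> SO3 \<Longrightarrow> transpose g \<in> SO3"
  by (auto simp: SO3_def rotation_matrix_def)

lemma cj_cj: "cj g (cj h M) = cj (g ** h) M"
  by (simp add: cj_def matrix_transpose_mul matrix_mul_assoc)

lemma cj_one [simp]: "cj (mat 1) M = M"
  by (simp add: cj_def)

lemma cj_inv: "g \<in> SO3 \<Longrightarrow> cj (transpose g) (cj g M) = M" "g \<in> SO3 \<Longrightarrow> cj g (cj (transpose g) M) = M"
  by (simp_all add: cj_cj SO3_orth)

lemma cj_add: "cj g (M + N) = cj g M + cj g N"
  by (simp add: cj_def vec_eq_iff matrix_matrix_mult_def sum_3 algebra_simps)

lemma cj_scaleR: "cj g (c *\<^sub>R M) = c *\<^sub>R cj g M"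
  by (simp add: cj_def vec_eq_iff matrix_matrix_mult_def sum_3 algebra_simps)

lemma cj_mat: "g \<in> SO3 \<Longrightarrow> cj g (mat c) = mat c"
proof -
  assume g: "g \<in> SO3"
  have "mat c = c *\<^sub>R (mat 1 :: real^3^3)"
    by (simp add: vec_eq_iff mat_def)
  then show ?thesis
    using SO3_orth[OF g] by (simp add: cj_scaleR) (simp add: cj_def)
qed

lemma cj_mult: "g \<in> SO3 \<Longrightarrow> cj g (M ** N) = cj g M ** cj g N"
proof -
  assume g: "g \<in> SO3"
  have "cj g M ** cj g N = g ** M ** (transpose g ** g) ** N ** transpose g"
    by (simp only: cj_def matrix_mul_assoc)
  then show ?thesis using g by (simp add: SO3_orth cj_def matrix_mul_assoc)
qed

lemma cj_transpose: "transpose (cj g M) = cj g (transpose M)"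
  by (simp add: cj_def matrix_transpose_mul matrix_mul_assoc)

lemma cj_SO3: "g \<in> SO3 \<Longrightarrow> h \<in> SO3 \<Longrightarrow> cj g h \<in> SO3"
  by (simp add: cj_def SO3_mult SO3_transpose)

lemma cj_inject: "g \<in> SO3 \<Longrightarrow> cj g M = cj g N \<longleftrightarrow> M = N"
  by (metis cj_inv(1))

lemma cj_trace: "g \<in> SO3 \<Longrightarrow> trace (cj g M) = trace M"
  by (metis SO3_orth(1) cj_def matrix_mul_assoc matrix_mul_lid trace_mul_sym)

lemma in_class_cj_def: "in_class G K \<longleftrightarrow> (\<exists>g\<in>SO3. G = cj g ` K)"
  by (simp add: in_class_def cj_def)

lemma in_class_cj_image:
  assumes "g \<in> SO3"
  shows "in_class (cj g ` G) K \<longleftrightarrow> in_class G K"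
proof -
  have *: "in_class (cj g ` G) K" if g: "g \<in> SO3" and G: "in_class G K" for g G
  proof -
    obtain h where h: "h \<in> SO3" "G = cj h ` K" using G by (auto simp: in_class_cj_def)
    then have "cj g ` G = cj (g ** h) ` K" by (simp add: image_image cj_cj)
    then show ?thesis using h g SO3_mult in_class_cj_def by blast
  qed
  have "G = cj (transpose g) ` (cj g ` G)"
    using assms by (simp add: image_image cj_inv)
  then show ?thesis using * assms SO3_transpose by metis
qed

lemma msym_cj_commute:
  assumes "g \<in> SO3"
  shows "cj g M = M \<longleftrightarrow> g ** M = M ** g"
proof -
  have "cj g M ** g = g ** M ** (transpose g ** g)"
    by (simp only: cj_def matrix_mul_assoc)
  then have "cj g M = M \<Longrightarrow> g ** M = M ** g"
    using assms by (simp add: SO3_orth)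
  moreover have "g ** M = M ** g \<Longrightarrow> cj g M = M"
    using assms by (simp add: cj_def matrix_mul_assoc[symmetric] SO3_orth)
  ultimately show ?thesis by blast
qed

lemma cj_fix_cj:
  assumes "g \<in> SO3"
  shows "cj (cj g h) (cj g M) = cj g M \<longleftrightarrow> cj h M = M"
proof -
  have "cj (cj g h) (cj g M) = cj (g ** h ** (transpose g ** g)) M"
    by (simp add: cj_cj cj_def[of g h] matrix_mul_assoc)
  also have "\<dots> = cj g (cj h M)" using assms by (simp add: SO3_orth cj_cj)
  finally show ?thesis using assms by (simp add: cj_inject)
qed

lemma msym_image:
  assumes g: "g \<in> SO3"
  shows "msym (cj g ` F) = cj g ` msym F"
proof
  show "cj g ` msym F \<subseteq> msym (cj g ` F)"
    using g by (auto simp: msym_def cj_SO3 cj_fix_cj)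
  show "msym (cj g ` F) \<subseteq> cj g ` msym F"
  proof
    fix h assume h: "h \<in> msym (cj g ` F)"
    define k where "k = cj (transpose g) h"
    have hk: "h = cj g k" using g by (simp add: k_def cj_inv)
    have "h \<in> SO3" using h by (simp add: msym_def)
    then have "k \<in> SO3" using g by (simp add: k_def cj_SO3 SO3_transpose)
    moreover have "cj k M = M" if "M \<in> F" for M
    proof -
      have "cj h (cj g M) = cj g M" using h that by (simp add: msym_def)
      then show ?thesis using g by (simp add: hk cj_fix_cj)
    qed
    ultimately have "k \<in> msym F" by (simp add: msym_def)
    then show "h \<in> cj g ` msym F" using hk by auto
  qed
qed

lemma msym_mono: "F \<subseteq> G \<Longrightarrow> msym G \<subseteq> msym F"
  by (auto simp: msym_def)

lemma msym_one: "mat 1 \<in> msym F"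
  by (simp add: msym_def)

lemma msym_mult: "g \<in> msym F \<Longrightarrow> h \<in> msym F \<Longrightarrow> g ** h \<in> msym F"
  by (auto simp: msym_def SO3_mult simp flip: cj_cj)

section \<open>Entrywise computation with 3 x 3 matrices, and the groups of half-turns\<close>

lemma mat3_eq_iff:
  fixes M N :: "real^3^3"
  shows "M = N \<longleftrightarrow> M$1$1 = N$1$1 \<and> M$1$2 = N$1$2 \<and> M$1$3 = N$1$3 \<and> M$2$1 = N$2$1 \<and> M$2$2 = N$2$2
    \<and> M$2$3 = N$2$3 \<and> M$3$1 = N$3$1 \<and> M$3$2 = N$3$2 \<and> M$3$3 = N$3$3"
  by (simp add: vec_eq_iff forall_3)

lemma mm3: "(M ** N) $ i $ j = M$i$1 * N$1$j + M$i$2 * N$2$j + M$i$3 * (N$3$j :: real)" for M :: "real^3^3"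
  by (simp add: matrix_matrix_mult_def sum_3)

lemma mat3_entry: "(mat c :: real^3^3) $ i $ j = (if i = j then c else 0)"
  by (simp add: mat_def)

lemma rotz_entry:
  "rotz t $ 1 $ 1 = cos t" "rotz t $ 1 $ 2 = - sin t" "rotz t $ 1 $ 3 = 0"
  "rotz t $ 2 $ 1 = sin t" "rotz t $ 2 $ 2 = cos t" "rotz t $ 2 $ 3 = 0"
  "rotz t $ 3 $ 1 = 0" "rotz t $ 3 $ 2 = 0" "rotz t $ 3 $ 3 = 1"
  by (simp_all add: rotz_def)

lemma rxpi_entry:
  "rxpi $ 1 $ 1 = 1" "rxpi $ 1 $ 2 = 0" "rxpi $ 1 $ 3 = 0"
  "rxpi $ 2 $ 1 = 0" "rxpi $ 2 $ 2 = -1" "rxpi $ 2 $ 3 = 0"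
  "rxpi $ 3 $ 1 = 0" "rxpi $ 3 $ 2 = 0" "rxpi $ 3 $ 3 = -1"
  by (simp_all add: rxpi_def)

lemma transpose_entry: "transpose M $ i $ j = M $ j $ i"
  by (simp add: transpose_def)

lemmas m3 = mat3_eq_iff mm3 mat3_entry rotz_entry rxpi_entry transpose_entry

lemma sc1: "sin t * sin t + cos t * cos t = (1::real)" "cos t * cos t + sin t * sin t = (1::real)"
  using sin_cos_squared_add[of t] by (simp_all add: power2_eq_square)

lemma rotz_SO3: "rotz t \<in> SO3"
  by (rule SO3_I) (simp_all add: m3 det_3 sc1)

lemma rxpi_SO3: "rxpi \<in> SO3"
  by (rule SO3_I) (simp_all add: m3 det_3)

lemma rotz_add: "rotz s ** rotz t = rotz (s + t)"
  by (simp add: m3 sin_add cos_add)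

lemma rotz_0: "rotz 0 = mat 1" "rotz (2*pi) = mat 1"
  by (simp_all add: m3)

lemma transpose_rotz: "transpose (rotz t) = rotz (- t)"
  by (simp add: m3)

lemma ZZ2: "ZZ 2 = {mat 1, rotz pi}"
proof -
  have "{k::nat. k < 2} = {0, 1}" by auto
  moreover have "ZZ 2 = (\<lambda>k. rotz (2 * pi * real k / real 2)) ` {k. k < 2}"
    by (simp add: ZZ_def setcompr_eq_image)
  ultimately show ?thesis by (simp add: rotz_0)
qed

lemma DD2: "DD 2 = {mat 1, rotz pi, rxpi, rotz pi ** rxpi}"
proof -
  have "{r ** rxpi |r. r \<in> ZZ 2} = (\<lambda>r. r ** rxpi) ` ZZ 2" by blast
  then show ?thesis by (auto simp: DD_def ZZ2)
qed

lemma cj_entry: "cj g M $ i $ j = (\<Sum>k\<in>UNIV. \<Sum>l\<in>UNIV. g$i$k * g$j$l * M$k$l)"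
  unfolding cj_def
  by (simp add: matrix_matrix_mult_def transpose_def sum_3 algebra_simps)

text \<open>The simp rule would turn \<open>transpose g *v x\<close> into \<open>x v* g\<close>,
  whereas the action on forms is phrased with the inverse rotation
  \<open>transpose g\<close>.\<close>

declare transpose_matrix_vector [simp del]

section \<open>Harmonic quadrilinear forms\<close>

type_synonym form4 = "real^3 \<Rightarrow> real^3 \<Rightarrow> real^3 \<Rightarrow> real^3 \<Rightarrow> real"

abbreviation ax :: "3 \<Rightarrow> real^3" where "ax i \<equiv> axis i 1"

definition rot4 :: "real^3^3 \<Rightarrow> form4 \<Rightarrow> form4" where
  "rot4 g F = (\<lambda>x y z w. F (transpose g *v x) (transpose g *v y) (transpose g *v z) (transpose g *v w))"

definition dten :: "form4 \<Rightarrow> real^3^3" where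
  "dten F = (\<chi> i j. \<Sum>p\<in>UNIV. \<Sum>q\<in>UNIV. \<Sum>r\<in>UNIV. F (ax i) (ax p) (ax q) (ax r) * F (ax j) (ax p) (ax q) (ax r))"

definition lmap :: "form4 \<Rightarrow> real^3^3 \<Rightarrow> real^3^3" where
  "lmap F A = (\<chi> i j. \<Sum>k\<in>UNIV. F (ax i) (ax j) (ax k) (A $ k))"

text \<open>Coordinates on the space of harmonic forms; the remaining components follow from tracelessness.
  The components with an odd number of indices 3 are \<open>hA\<close>, \<open>hB\<close>, \<open>hC\<close>, \<open>hD\<close>: they are the part
  that is odd under the half-turn about the third axis.\<close>

definition hP :: "form4 \<Rightarrow> real" where "hP F = F (ax 1) (ax 1) (ax 2) (ax 2)"
definition hQ :: "form4 \<Rightarrow> real" where "hQ F = F (ax 1) (ax 1) (ax 3) (ax 3)"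
definition hW :: "form4 \<Rightarrow> real" where "hW F = F (ax 2) (ax 2) (ax 3) (ax 3)"
definition hU :: "form4 \<Rightarrow> real" where "hU F = F (ax 1) (ax 1) (ax 1) (ax 2)"
definition hV :: "form4 \<Rightarrow> real" where "hV F = F (ax 1) (ax 2) (ax 2) (ax 2)"
definition hA :: "form4 \<Rightarrow> real" where "hA F = F (ax 1) (ax 1) (ax 1) (ax 3)"
definition hB :: "form4 \<Rightarrow> real" where "hB F = F (ax 1) (ax 2) (ax 2) (ax 3)"
definition hC :: "form4 \<Rightarrow> real" where "hC F = F (ax 1) (ax 1) (ax 2) (ax 3)"
definition hD :: "form4 \<Rightarrow> real" where "hD F = F (ax 2) (ax 2) (ax 2) (ax 3)"

lemma linear_ax_expand:
  fixes f :: "real^3 \<Rightarrow> real"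
  assumes "linear f"
  shows "f x = (\<Sum>i\<in>UNIV. x $ i * f (ax i))"
proof -
  have "f x = f (\<Sum>i\<in>UNIV. x $ i *\<^sub>R ax i)"
    using basis_expansion[of x] by (simp add: scalar_mult_eq_scaleR)
  also have "\<dots> = (\<Sum>i\<in>UNIV. x $ i * f (ax i))"
    using assms by (simp add: linear_sum linear_cmul)
  finally show ?thesis .
qed

text \<open>Consequently the components of a rotated form are the values of the form on the rows of
  the rotation.\<close>

lemma transpose_ax: "transpose M *v ax i = M $ i"
  by (simp add: vec_eq_iff matrix_vector_mult_def transpose_def axis_def if_distrib if_distribR sum.delta cong:
      if_cong)

lemma SO3_columns:
  assumes "g \<in> SO3"
  shows "(\<Sum>k\<in>UNIV. g $ k $ a * g $ k $ b) = (if a = b then 1 else 0)"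
proof -
  have "(transpose g ** g) $ a $ b = (mat 1 :: real^3^3) $ a $ b" using SO3_orth[OF assms] by simp
  then show ?thesis by (simp add: matrix_matrix_mult_def transpose_def mat_def)
qed

text \<open>The rows of a rotation form an orthonormal basis, and a contraction does not depend on
  the orthonormal basis. This is the source of the equivariance of traces, \<open>dten\<close> and
  \<open>lmap\<close>.\<close>

lemma orthonormal_contraction:
  fixes f :: "real^3 \<Rightarrow> real^3 \<Rightarrow> real"
  assumes g: "g \<in> SO3" and l: "\<And>x. linear (f x)" "\<And>y. linear (\<lambda>x. f x y)"
  shows "(\<Sum>k\<in>UNIV. f (g $ k) (g $ k)) = (\<Sum>k\<in>UNIV. f (ax k) (ax k))"
proof -
  have "f x y = (\<Sum>a\<in>UNIV. \<Sum>b\<in>UNIV. x $ a * y $ b * f (ax a) (ax b))" for x y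
    by (subst linear_ax_expand[OF l(2)], subst linear_ax_expand[OF l(1)])
       (simp add: sum_distrib_left mult_ac)
  then have "(\<Sum>k\<in>UNIV. f (g $ k) (g $ k))
     = (\<Sum>k\<in>UNIV. \<Sum>a\<in>UNIV. \<Sum>b\<in>UNIV. g $ k $ a * g $ k $ b * f (ax a) (ax b))"
    by (intro sum.cong refl)
  also have "\<dots> = (\<Sum>a\<in>UNIV. \<Sum>b\<in>UNIV. (\<Sum>k\<in>UNIV. g $ k $ a * g $ k $ b) * f (ax a) (ax b))"
    unfolding sum_distrib_right by (subst sum.swap, rule sum.cong, simp, subst sum.swap, simp)
  also have "\<dots> = (\<Sum>a\<in>UNIV. f (ax a) (ax a))"
    by (simp add: SO3_columns[OF g] if_distrib if_distribR sum.delta cong: if_cong)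
  finally show ?thesis .
qed

locale harmonic =
  fixes F :: form4
  assumes lin1: "linear (\<lambda>x. F x y z w)"
    and sym12: "F x y z w = F y x z w"
    and sym23: "F x y z w = F x z y w"
    and sym34: "F x y z w = F x y w z"
    and tr12: "(\<Sum>k\<in>UNIV. F (ax k) (ax k) z w) = 0"
begin

lemma lin2: "linear (\<lambda>x. F y x z w)"
  using lin1[of y z w] by (simp add: sym12)

lemma lin3: "linear (\<lambda>x. F y z x w)"
  using lin2[of y z w] by (simp add: sym23)

lemma lin4: "linear (\<lambda>x. F y z w x)"
  using lin3[of y z w] by (simp add: sym34)

lemma lin4': "linear (F y z w)"
  using lin4 by simp

lemma add:
  "F (x + x') y z w = F x y z w + F x' y z w"
  "F x (y + y') z w = F x y z w + F x y' z w"
  "F x y (z + z') w = F x y z w + F x y z' w"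
  "F x y z (w + w') = F x y z w + F x y z w'"
  using linear_add[OF lin1] linear_add[OF lin2] linear_add[OF lin3] linear_add[OF lin4] by simp_all

lemma scl:
  "F (c *\<^sub>R x) y z w = c * F x y z w"
  "F x (c *\<^sub>R y) z w = c * F x y z w"
  "F x y (c *\<^sub>R z) w = c * F x y z w"
  "F x y z (c *\<^sub>R w) = c * F x y z w"
  using linear_cmul[OF lin1] linear_cmul[OF lin2] linear_cmul[OF lin3] linear_cmul[OF lin4] by simp_all

lemmas ml = add scl

lemma tr34: "F x y (ax 1) (ax 1) + F x y (ax 2) (ax 2) + F x y (ax 3) (ax 3) = 0"
proof -
  have "F x y u u = F u u x y" for u
    by (metis sym12 sym23 sym34)
  then show ?thesis using tr12[of x y] by (simp add: sum_3)
qed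

lemma comps_trace:
  "F (ax 1) (ax 1) (ax 1) (ax 1) = - hP F - hQ F" "F (ax 2) (ax 2) (ax 2) (ax 2) = - hP F - hW F"
  "F (ax 3) (ax 3) (ax 3) (ax 3) = - hQ F - hW F" "F (ax 1) (ax 2) (ax 3) (ax 3) = - hU F - hV F"
  "F (ax 1) (ax 3) (ax 3) (ax 3) = - hA F - hB F" "F (ax 2) (ax 3) (ax 3) (ax 3) = - hC F - hD F"
  using tr34[of "ax 1" "ax 1"] tr34[of "ax 2" "ax 2"] tr34[of "ax 3" "ax 3"]
    tr34[of "ax 1" "ax 2"] tr34[of "ax 1" "ax 3"] tr34[of "ax 2" "ax 3"]
  unfolding hP_def hQ_def hW_def hU_def hV_def hA_def hB_def hC_def hD_def
  by (simp_all only: sym12 sym23 sym34)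

text \<open>The table of all 81 components, in lexicographic order, over the nine coordinates. With
  it every identity between covariants becomes an identity of polynomials.\<close>

lemma comps:
    "F (ax 1) (ax 1) (ax 1) (ax 1) = - hP F - hQ F" "F (ax 1) (ax 1) (ax 1) (ax 2) = hU F"
    "F (ax 1) (ax 1) (ax 1) (ax 3) = hA F" "F (ax 1) (ax 1) (ax 2) (ax 1) = hU F"
    "F (ax 1) (ax 1) (ax 2) (ax 2) = hP F" "F (ax 1) (ax 1) (ax 2) (ax 3) = hC F"
    "F (ax 1) (ax 1) (ax 3) (ax 1) = hA F" "F (ax 1) (ax 1) (ax 3) (ax 2) = hC F"
    "F (ax 1) (ax 1) (ax 3) (ax 3) = hQ F" "F (ax 1) (ax 2) (ax 1) (ax 1) = hU F"
    "F (ax 1) (ax 2) (ax 1) (ax 2) = hP F" "F (ax 1) (ax 2) (ax 1) (ax 3) = hC F"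
    "F (ax 1) (ax 2) (ax 2) (ax 1) = hP F" "F (ax 1) (ax 2) (ax 2) (ax 2) = hV F"
    "F (ax 1) (ax 2) (ax 2) (ax 3) = hB F" "F (ax 1) (ax 2) (ax 3) (ax 1) = hC F"
    "F (ax 1) (ax 2) (ax 3) (ax 2) = hB F" "F (ax 1) (ax 2) (ax 3) (ax 3) = - hU F - hV F"
    "F (ax 1) (ax 3) (ax 1) (ax 1) = hA F" "F (ax 1) (ax 3) (ax 1) (ax 2) = hC F"
    "F (ax 1) (ax 3) (ax 1) (ax 3) = hQ F" "F (ax 1) (ax 3) (ax 2) (ax 1) = hC F"
    "F (ax 1) (ax 3) (ax 2) (ax 2) = hB F" "F (ax 1) (ax 3) (ax 2) (ax 3) = - hU F - hV F"
    "F (ax 1) (ax 3) (ax 3) (ax 1) = hQ F" "F (ax 1) (ax 3) (ax 3) (ax 2) = - hU F - hV F"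
    "F (ax 1) (ax 3) (ax 3) (ax 3) = - hA F - hB F" "F (ax 2) (ax 1) (ax 1) (ax 1) = hU F"
    "F (ax 2) (ax 1) (ax 1) (ax 2) = hP F" "F (ax 2) (ax 1) (ax 1) (ax 3) = hC F"
    "F (ax 2) (ax 1) (ax 2) (ax 1) = hP F" "F (ax 2) (ax 1) (ax 2) (ax 2) = hV F"
    "F (ax 2) (ax 1) (ax 2) (ax 3) = hB F" "F (ax 2) (ax 1) (ax 3) (ax 1) = hC F"
    "F (ax 2) (ax 1) (ax 3) (ax 2) = hB F" "F (ax 2) (ax 1) (ax 3) (ax 3) = - hU F - hV F"
    "F (ax 2) (ax 2) (ax 1) (ax 1) = hP F" "F (ax 2) (ax 2) (ax 1) (ax 2) = hV F"
    "F (ax 2) (ax 2) (ax 1) (ax 3) = hB F" "F (ax 2) (ax 2) (ax 2) (ax 1) = hV F"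
    "F (ax 2) (ax 2) (ax 2) (ax 2) = - hP F - hW F" "F (ax 2) (ax 2) (ax 2) (ax 3) = hD F"
    "F (ax 2) (ax 2) (ax 3) (ax 1) = hB F" "F (ax 2) (ax 2) (ax 3) (ax 2) = hD F"
    "F (ax 2) (ax 2) (ax 3) (ax 3) = hW F" "F (ax 2) (ax 3) (ax 1) (ax 1) = hC F"
    "F (ax 2) (ax 3) (ax 1) (ax 2) = hB F" "F (ax 2) (ax 3) (ax 1) (ax 3) = - hU F - hV F"
    "F (ax 2) (ax 3) (ax 2) (ax 1) = hB F" "F (ax 2) (ax 3) (ax 2) (ax 2) = hD F"
    "F (ax 2) (ax 3) (ax 2) (ax 3) = hW F" "F (ax 2) (ax 3) (ax 3) (ax 1) = - hU F - hV F"
    "F (ax 2) (ax 3) (ax 3) (ax 2) = hW F" "F (ax 2) (ax 3) (ax 3) (ax 3) = - hC F - hD F"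
    "F (ax 3) (ax 1) (ax 1) (ax 1) = hA F" "F (ax 3) (ax 1) (ax 1) (ax 2) = hC F"
    "F (ax 3) (ax 1) (ax 1) (ax 3) = hQ F" "F (ax 3) (ax 1) (ax 2) (ax 1) = hC F"
    "F (ax 3) (ax 1) (ax 2) (ax 2) = hB F" "F (ax 3) (ax 1) (ax 2) (ax 3) = - hU F - hV F"
    "F (ax 3) (ax 1) (ax 3) (ax 1) = hQ F" "F (ax 3) (ax 1) (ax 3) (ax 2) = - hU F - hV F"
    "F (ax 3) (ax 1) (ax 3) (ax 3) = - hA F - hB F" "F (ax 3) (ax 2) (ax 1) (ax 1) = hC F"
    "F (ax 3) (ax 2) (ax 1) (ax 2) = hB F" "F (ax 3) (ax 2) (ax 1) (ax 3) = - hU F - hV F"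
    "F (ax 3) (ax 2) (ax 2) (ax 1) = hB F" "F (ax 3) (ax 2) (ax 2) (ax 2) = hD F"
    "F (ax 3) (ax 2) (ax 2) (ax 3) = hW F" "F (ax 3) (ax 2) (ax 3) (ax 1) = - hU F - hV F"
    "F (ax 3) (ax 2) (ax 3) (ax 2) = hW F" "F (ax 3) (ax 2) (ax 3) (ax 3) = - hC F - hD F"
    "F (ax 3) (ax 3) (ax 1) (ax 1) = hQ F" "F (ax 3) (ax 3) (ax 1) (ax 2) = - hU F - hV F"
    "F (ax 3) (ax 3) (ax 1) (ax 3) = - hA F - hB F" "F (ax 3) (ax 3) (ax 2) (ax 1) = - hU F - hV F"
    "F (ax 3) (ax 3) (ax 2) (ax 2) = hW F" "F (ax 3) (ax 3) (ax 2) (ax 3) = - hC F - hD F"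
    "F (ax 3) (ax 3) (ax 3) (ax 1) = - hA F - hB F" "F (ax 3) (ax 3) (ax 3) (ax 2) = - hC F - hD F"
    "F (ax 3) (ax 3) (ax 3) (ax 3) = - hQ F - hW F"
  using comps_trace unfolding hP_def hQ_def hW_def hU_def hV_def hA_def hB_def hC_def hD_def
  by (simp_all only: sym12 sym23 sym34)

lemma expand: "F x y z w = (\<Sum>i\<in>UNIV. \<Sum>j\<in>UNIV. \<Sum>k\<in>UNIV. \<Sum>l\<in>UNIV.
    x $ i * y $ j * z $ k * w $ l * F (ax i) (ax j) (ax k) (ax l))"
  by (subst linear_ax_expand[OF lin1], subst linear_ax_expand[OF lin2],
      subst linear_ax_expand[OF lin3], subst linear_ax_expand[OF lin4])
     (simp add: sum_distrib_left mult_ac)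

end

lemma harmonic_eqI:
  assumes "harmonic F" "harmonic G"
    "hP F = hP G" "hQ F = hQ G" "hW F = hW G" "hU F = hU G" "hV F = hV G" "hA F = hA G" "hB F = hB G"
    "hC F = hC G" "hD F = hD G"
  shows "F = G"
proof -
  interpret F: harmonic F by fact
  interpret G: harmonic G by fact
  have "F (ax i) (ax j) (ax k) (ax l) = G (ax i) (ax j) (ax k) (ax l)" for i j k l
    using exhaust_3[of i] exhaust_3[of j] exhaust_3[of k] exhaust_3[of l]
    by (elim disjE) (simp_all only: F.comps G.comps assms)
  then show ?thesis by (intro ext) (subst F.expand, subst G.expand, simp)
qed

lemma harmonic_rot4:
  assumes "harmonic F" "g \<in> SO3"
  shows "harmonic (rot4 g F)"
proof -
  interpret harmonic F by fact
  have l: "linear (\<lambda>x. transpose g *v x)" by simp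
  show ?thesis
  proof (rule harmonic.intro)
    fix x y z w
    show "linear (\<lambda>x'. rot4 g F x' y z w)"
      using linear_compose[OF l lin1] by (simp add: rot4_def o_def)
    show "rot4 g F x y z w = rot4 g F y x z w" "rot4 g F x y z w = rot4 g F x z y w"
      "rot4 g F x y z w = rot4 g F x y w z"
      by (simp_all only: rot4_def sym12 sym23 sym34)
    show "(\<Sum>k\<in>UNIV. rot4 g F (ax k) (ax k) z w) = 0"
      unfolding rot4_def transpose_ax
      by (subst orthonormal_contraction[OF assms(2)]) (auto intro: lin1 lin2 tr12)
  qed
qed

lemma rot4_rot4: "rot4 g (rot4 h F) = rot4 (g ** h) F"
  by (simp add: rot4_def matrix_transpose_mul matrix_vector_mul_assoc)

lemma rot4_one [simp]: "rot4 (mat 1) F = F"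
  by (simp add: rot4_def)

text \<open>Each of the three summed indices is moved to the innermost position and contracted by
  \<open>orthonormal_contraction\<close>; the two free indices are then expanded linearly.\<close>

lemma dten_rot4:
  assumes "harmonic F" and g: "g \<in> SO3"
  shows "dten (rot4 g F) = cj g (dten F)"
proof -
  interpret harmonic F by fact
  have c: "linear (\<lambda>x. c * f x)" "linear (\<lambda>x. f x * c)" if "linear f" for c and f :: "real^3 \<Rightarrow> real"
    using linear_compose_scale_right[OF that, of c] by (simp_all add: mult.commute)
  have "dten (rot4 g F) $ i $ j = cj g (dten F) $ i $ j" for i j
  proof -
    have "dten (rot4 g F) $ i $ j = (\<Sum>p\<in>UNIV. \<Sum>q\<in>UNIV. \<Sum>r\<in>UNIV.
        F (g$i) (g$p) (g$q) (g$r) * F (g$j) (g$p) (g$q) (g$r))"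
      by (simp add: dten_def rot4_def transpose_ax)
    also have "\<dots> = (\<Sum>p\<in>UNIV. \<Sum>q\<in>UNIV. \<Sum>r\<in>UNIV.
        F (g$i) (g$p) (g$q) (ax r) * F (g$j) (g$p) (g$q) (ax r))"
      by (subst orthonormal_contraction[OF g, where f = "\<lambda>x y. F (g$i) (g$_) (g$_) x * F (g$j) (g$_) (g$_) y"])
         (auto intro!: c lin4')
    also have "\<dots> = (\<Sum>r\<in>UNIV. \<Sum>p\<in>UNIV. \<Sum>q\<in>UNIV.
        F (g$i) (g$p) (g$q) (ax r) * F (g$j) (g$p) (g$q) (ax r))"
      by (subst (2) sum.swap, subst sum.swap) simp
    also have "\<dots> = (\<Sum>r\<in>UNIV. \<Sum>p\<in>UNIV. \<Sum>q\<in>UNIV.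
        F (g$i) (g$p) (ax q) (ax r) * F (g$j) (g$p) (ax q) (ax r))"
      by (subst orthonormal_contraction[OF g, where f = "\<lambda>x y. F (g$i) (g$_) x (ax _) * F (g$j) (g$_) y (ax _)"])
         (auto intro!: c lin3)
    also have "\<dots> = (\<Sum>r\<in>UNIV. \<Sum>q\<in>UNIV. \<Sum>p\<in>UNIV.
        F (g$i) (g$p) (ax q) (ax r) * F (g$j) (g$p) (ax q) (ax r))"
      by (subst (2) sum.swap) simp
    also have "\<dots> = (\<Sum>r\<in>UNIV. \<Sum>q\<in>UNIV. \<Sum>p\<in>UNIV.
        F (g$i) (ax p) (ax q) (ax r) * F (g$j) (ax p) (ax q) (ax r))"
      by (subst orthonormal_contraction[OF g, where f = "\<lambda>x y. F (g$i) x (ax _) (ax _) * F (g$j) y (ax _) (ax _)"])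
         (auto intro!: c lin2)
    also have "\<dots> = (\<Sum>r\<in>UNIV. \<Sum>q\<in>UNIV. \<Sum>p\<in>UNIV.
        (\<Sum>k\<in>UNIV. g$i$k * F (ax k) (ax p) (ax q) (ax r)) * (\<Sum>l\<in>UNIV. g$j$l * F (ax l) (ax p) (ax q) (ax r)))"
      by (subst linear_ax_expand[OF lin1, of "g$i"], subst linear_ax_expand[OF lin1, of "g$j"]) simp
    also have "\<dots> = cj g (dten F) $ i $ j"
      by (simp add: cj_entry dten_def sum_3 algebra_simps)
    finally show ?thesis .
  qed
  then show ?thesis by (simp add: vec_eq_iff)
qed

lemma lmap_rot4:
  assumes "harmonic F" and g: "g \<in> SO3"
  shows "lmap (rot4 g F) (cj g A) = cj g (lmap F A)"
proof -
  interpret harmonic F by fact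
  have r: "transpose g *v (cj g A $ k) = transpose A *v (g $ k)" for k
  proof -
    have "transpose g *v (cj g A $ k) = transpose g *v (transpose (cj g A) *v ax k)"
      by (simp add: transpose_ax)
    also have "\<dots> = ((transpose g ** g) ** transpose A ** transpose g) *v ax k"
      by (simp add: cj_transpose) (simp add: cj_def matrix_vector_mul_assoc matrix_mul_assoc)
    finally show ?thesis by (simp add: SO3_orth[OF g] transpose_ax flip: matrix_vector_mul_assoc)
  qed
  have "lmap (rot4 g F) (cj g A) $ i $ j = cj g (lmap F A) $ i $ j" for i j
  proof -
    have l: "linear (\<lambda>x. transpose A *v x)" by simp
    have "lmap (rot4 g F) (cj g A) $ i $ j = (\<Sum>k\<in>UNIV. F (g$i) (g$j) (g$k) (transpose A *v (g$k)))"
      by (simp add: lmap_def rot4_def transpose_ax r)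
    also have "\<dots> = (\<Sum>k\<in>UNIV. F (g$i) (g$j) (ax k) (transpose A *v ax k))"
      using linear_compose[OF l lin4]
      by (subst orthonormal_contraction[OF g, where f = "\<lambda>x y. F (g$i) (g$j) x (transpose A *v y)"])
         (auto intro!: lin3 simp: o_def)
    also have "\<dots> = (\<Sum>k\<in>UNIV. \<Sum>a\<in>UNIV. \<Sum>b\<in>UNIV. g$i$a * g$j$b * F (ax a) (ax b) (ax k) (A $ k))"
      by (subst linear_ax_expand[OF lin1], subst linear_ax_expand[OF lin2])
         (simp add: transpose_ax sum_distrib_left mult_ac)
    also have "\<dots> = cj g (lmap F A) $ i $ j"
      by (simp add: cj_entry lmap_def sum_3 algebra_simps)
    finally show ?thesis .
  qed
  then show ?thesis by (simp add: vec_eq_iff)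
qed

lemma (in harmonic) dten_entry:
  "dten F $ 1 $ 1 = 4 * hP F * hP F + 2 * hP F * hQ F + 4 * hQ F * hQ F + 6 * hU F * hU F + 6 * hU F * hV F + 4
      * hV F * hV F + 4 * hA F * hA F + 2 * hA F * hB F + 4 * hB F * hB F + 6 * hC F * hC F"
  "dten F $ 1 $ 2 = 2 * hP F * hU F + 2 * hP F * hV F - 4 * hQ F * hU F - 3 * hQ F * hV F - 3 * hW F * hU F - 4
      * hW F * hV F + 4 * hA F * hC F + hA F * hD F + 7 * hB F * hC F + 4 * hB F * hD F"
  "dten F $ 1 $ 3 = -hP F * hA F + 3 * hP F * hB F - 2 * hQ F * hB F + hW F * hA F + 4 * hW F * hB F + 3 * hU F
      * hD F - 3 * hV F * hC F + 4 * hV F * hD F"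
  "dten F $ 2 $ 1 = 2 * hP F * hU F + 2 * hP F * hV F - 4 * hQ F * hU F - 3 * hQ F * hV F - 3 * hW F * hU F - 4
      * hW F * hV F + 4 * hA F * hC F + hA F * hD F + 7 * hB F * hC F + 4 * hB F * hD F"
  "dten F $ 2 $ 2 = 4 * hP F * hP F + 2 * hP F * hW F + 4 * hW F * hW F + 4 * hU F * hU F + 6 * hU F * hV F + 6
      * hV F * hV F + 6 * hB F * hB F + 4 * hC F * hC F + 2 * hC F * hD F + 4 * hD F * hD F"
  "dten F $ 2 $ 3 = 3 * hP F * hC F - hP F * hD F + 4 * hQ F * hC F + hQ F * hD F - 2 * hW F * hC F + 4 * hU F *
      hA F - 3 * hU F * hB F + 3 * hV F * hA F"
  "dten F $ 3 $ 1 = -hP F * hA F + 3 * hP F * hB F - 2 * hQ F * hB F + hW F * hA F + 4 * hW F * hB F + 3 * hU F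
      * hD F - 3 * hV F * hC F + 4 * hV F * hD F"
  "dten F $ 3 $ 2 = 3 * hP F * hC F - hP F * hD F + 4 * hQ F * hC F + hQ F * hD F - 2 * hW F * hC F + 4 * hU F *
      hA F - 3 * hU F * hB F + 3 * hV F * hA F"
  "dten F $ 3 $ 3 = 4 * hQ F * hQ F + 2 * hQ F * hW F + 4 * hW F * hW F + 6 * hU F * hU F + 12 * hU F * hV F + 6
      * hV F * hV F + 4 * hA F * hA F + 6 * hA F * hB F + 6 * hB F * hB F + 6 * hC F * hC F + 6 * hC F * hD F +
      4 * hD F * hD F"
  unfolding dten_def by (simp_all add: sum_3 comps algebra_simps)

lemma lmap_entry_sum:
  assumes "harmonic F"
  shows "lmap F A $ i $ j = (\<Sum>k\<in>UNIV. \<Sum>l\<in>UNIV. F (ax i) (ax j) (ax k) (ax l) * A $ k $ l)"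
proof -
  interpret harmonic F by fact
  show ?thesis unfolding lmap_def
    by simp (subst linear_ax_expand[OF lin4], simp add: mult.commute)
qed

lemma (in harmonic) lmap_entry:
  "lmap F A $ 1 $ 1 = (- hP F - hQ F) * A $ 1 $ 1 + hU F * A $ 1 $ 2 + hA F * A $ 1 $ 3 + hU F * A $ 2 $ 1 + hP
      F * A $ 2 $ 2 + hC F * A $ 2 $ 3 + hA F * A $ 3 $ 1 + hC F * A $ 3 $ 2 + hQ F * A $ 3 $ 3"
  "lmap F A $ 1 $ 2 = hU F * A $ 1 $ 1 + hP F * A $ 1 $ 2 + hC F * A $ 1 $ 3 + hP F * A $ 2 $ 1 + hV F * A $ 2 $
      2 + hB F * A $ 2 $ 3 + hC F * A $ 3 $ 1 + hB F * A $ 3 $ 2 + (- hU F - hV F) * A $ 3 $ 3"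
  "lmap F A $ 1 $ 3 = hA F * A $ 1 $ 1 + hC F * A $ 1 $ 2 + hQ F * A $ 1 $ 3 + hC F * A $ 2 $ 1 + hB F * A $ 2 $
      2 + (- hU F - hV F) * A $ 2 $ 3 + hQ F * A $ 3 $ 1 + (- hU F - hV F) * A $ 3 $ 2 + (- hA F - hB F) * A $ 3 $ 3"
  "lmap F A $ 2 $ 1 = hU F * A $ 1 $ 1 + hP F * A $ 1 $ 2 + hC F * A $ 1 $ 3 + hP F * A $ 2 $ 1 + hV F * A $ 2 $
      2 + hB F * A $ 2 $ 3 + hC F * A $ 3 $ 1 + hB F * A $ 3 $ 2 + (- hU F - hV F) * A $ 3 $ 3"
  "lmap F A $ 2 $ 2 = hP F * A $ 1 $ 1 + hV F * A $ 1 $ 2 + hB F * A $ 1 $ 3 + hV F * A $ 2 $ 1 + (- hP F - hW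
      F) * A $ 2 $ 2 + hD F * A $ 2 $ 3 + hB F * A $ 3 $ 1 + hD F * A $ 3 $ 2 + hW F * A $ 3 $ 3"
  "lmap F A $ 2 $ 3 = hC F * A $ 1 $ 1 + hB F * A $ 1 $ 2 + (- hU F - hV F) * A $ 1 $ 3 + hB F * A $ 2 $ 1 + hD
      F * A $ 2 $ 2 + hW F * A $ 2 $ 3 + (- hU F - hV F) * A $ 3 $ 1 + hW F * A $ 3 $ 2 + (- hC F - hD F) * A $ 3 $ 3"
  "lmap F A $ 3 $ 1 = hA F * A $ 1 $ 1 + hC F * A $ 1 $ 2 + hQ F * A $ 1 $ 3 + hC F * A $ 2 $ 1 + hB F * A $ 2 $
      2 + (- hU F - hV F) * A $ 2 $ 3 + hQ F * A $ 3 $ 1 + (- hU F - hV F) * A $ 3 $ 2 + (- hA F - hB F) * A $ 3 $ 3"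
  "lmap F A $ 3 $ 2 = hC F * A $ 1 $ 1 + hB F * A $ 1 $ 2 + (- hU F - hV F) * A $ 1 $ 3 + hB F * A $ 2 $ 1 + hD
      F * A $ 2 $ 2 + hW F * A $ 2 $ 3 + (- hU F - hV F) * A $ 3 $ 1 + hW F * A $ 3 $ 2 + (- hC F - hD F) * A $ 3 $ 3"
  "lmap F A $ 3 $ 3 = hQ F * A $ 1 $ 1 + (- hU F - hV F) * A $ 1 $ 2 + (- hA F - hB F) * A $ 1 $ 3 + (- hU F -
      hV F) * A $ 2 $ 1 + hW F * A $ 2 $ 2 + (- hC F - hD F) * A $ 2 $ 3 + (- hA F - hB F) * A $ 3 $ 1 + (- hC F
      - hD F) * A $ 3 $ 2 + (- hQ F - hW F) * A $ 3 $ 3"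
  by (simp_all only: lmap_entry_sum[OF harmonic_axioms] sum_3 comps add.assoc)

section \<open>Real algebra behind the rigidity lemmas\<close>

text \<open>If \<open>p \<noteq> q\<close>, the equation \<open>D23\<close> is solved by \<open>b = t e\<close>, \<open>d = 3 t u\<close> with \<open>e = q - p\<close>; eliminating the other
  unknowns expresses \<open>36 t\<^sup>2 e E > 0\<close> as a negative quantity.\<close>

lemma axis1_rigid:
  fixes p q w u r b d :: real
  assumes b: "b \<noteq> 0"
    and D13: "3*p*b - 2*q*b + 4*w*b + 3*u*d + 4*r*d = 0"
    and D23: "q*d - p*d - 3*u*b = 0"
    and D12: "2*p*u + 2*p*r - 4*q*u - 3*q*r - 3*w*u - 4*w*r + 4*b*d = 0"
    and d12: "(q-w)*(2*p+4*q+4*w) + 2*(u^2-r^2) - 2*b^2 - 4*d^2 = 0"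
    and d23: "(p-q)*(4*p+4*q+2*w) - 2*u^2 - 6*u*r = 0"
  shows "p = q \<and> u = 0"
proof (cases "p = q")
  case True
  then show ?thesis using D23 b by simp
next
  case False
  define e where "e = q - p"
  define t where "t = b / e"
  have e0: "e \<noteq> 0" using False by (simp add: e_def)
  have bt: "b = t * e" using e0 by (simp add: t_def)
  have t0: "t \<noteq> 0" using b bt by auto
  have "e * d = e * (3*t*u)" using D23 bt by (simp add: e_def algebra_simps)
  then have dt: "d = 3*t*u" using e0 by simp
  have "t * (e*(3*p+4*w-2*q) + 3*u*(4*r+3*u)) = 0" using D13 bt dt by (simp add: algebra_simps)
  then have 1: "e*(3*p+4*w-2*q) + 3*u*(4*r+3*u) = 0" using t0 by simp
  have 2: "e*(4*p+4*q+2*w) + 2*u^2 + 6*u*r = 0" using d23 by (simp add: e_def algebra_simps)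
  \<comment> \<open>Eliminating first \<open>u*r\<close> and then \<open>u^2\<close> between
    equations 1 and 2 shows that \<open>u^2\<close> and \<open>3*u*r\<close> are multiples of
    \<open>e\<close>; \<open>E\<close> and \<open>- f\<close> are the cofactors.\<close>
  define E where "E = p + 2*q"
  define f where "f = 3*p+4*q+w"
  have u2: "u^2 = e * E" using 1 2 unfolding E_def by (simp add: e_def algebra_simps power2_eq_square)
  have uv: "3*u*r = - e * f" using 2 u2 unfolding E_def f_def by (simp add: e_def algebra_simps power2_eq_square)
  have 3: "u*(2*p-4*q-3*w) + r*(2*p-3*q-4*w) + 12*t^2*e*u = 0"
    using D12 bt dt by (simp add: algebra_simps power2_eq_square)
  have 4: "(q-w)*(2*p+4*q+4*w) + 2*u^2 - 2*r^2 - 2*t^2*e^2 - 36*t^2*u^2 = 0"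
    using d12 bt dt by (simp add: algebra_simps power2_eq_square)
  have q: "q = (E+e)/3" "p = (E-2*e)/3" "w = f - (7*E-2*e)/3" by (simp_all add: E_def e_def f_def field_simps)
  show ?thesis
  proof (cases "u = 0")
    case True
    then have "E = 0" "f = 0" using u2 uv e0 by auto
    then have "4*e^2/9 * 2 + 2*r^2 + 2*t^2*e^2 = 0" using 4 True by (simp add: q field_simps power2_eq_square)
    moreover have "4*e^2/9 * 2 > 0" using e0 by simp
    moreover have "2*r^2 + 2*t^2*e^2 \<ge> 0" by simp
    ultimately show ?thesis by linarith
  next
    case False
    then have eE: "e * E > 0" using u2 by (metis zero_less_power2)
    \<comment> \<open>The factor \<open>3*u\<close> makes \<open>u\<close> and \<open>r\<close>
      occur only through \<open>u^2\<close> and \<open>3*u*r\<close>, which are known; the factor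
      \<open>9*u^2\<close> below has the same purpose.\<close>
    have "3*u*(u*(2*p-4*q-3*w) + r*(2*p-3*q-4*w) + 12*t^2*e*u) = 0" using 3 by simp
    then have "3*u^2*(2*p-4*q-3*w) + (3*u*r)*(2*p-3*q-4*w) + 36*t^2*e*u^2 = 0"
      by (simp add: algebra_simps power2_eq_square)
    then have "e * (3*E*(2*p-4*q-3*w) - f*(2*p-3*q-4*w) + 36*t^2*(e*E)) = 0"
      unfolding u2 uv by (simp add: algebra_simps)
    then have "3*E*(2*p-4*q-3*w) - f*(2*p-3*q-4*w) + 36*t^2*(e*E) = 0" using e0 by simp
    then have Q: "36*t^2*(e*E) = -4*f^2+18*E*f-5*e*f-19*E^2+14*e*E"
      by (simp add: q field_simps power2_eq_square)
    have "9*u^2*((q-w)*(2*p+4*q+4*w) + 2*u^2 - 2*t^2*e^2 - 36*t^2*u^2) - 2*(3*u*r)^2 = 0"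
      using 4 by (simp add: power_mult_distrib)
    then have "e * (9*E*((q-w)*(2*p+4*q+4*w) + 2*(e*E)) - (36*t^2*(e*E))*(e+18*E)/2 - 2*e*f^2) = 0"
      unfolding u2 uv by (simp add: field_simps power2_eq_square)
    then have "9*E*((q-w)*(2*p+4*q+4*w) + 2*(e*E)) - (36*t^2*(e*E))*(e+18*E)/2 - 2*e*f^2 = 0"
      using e0 by simp
    \<comment> \<open>After inserting \<open>Q\<close> the terms with \<open>f^2\<close> cancel, so
      \<open>f\<close> is determined linearly.\<close>
    then have "e^2*f = 2*E^3+5*E^2*e+6*E*e^2"
      unfolding Q by (simp add: q field_simps power2_eq_square power3_eq_cube)
    then have f: "f = E * (2*(E/e)^2+5*(E/e)+6)" using e0 by (simp add: field_simps power2_eq_square power3_eq_cube)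
    \<comment> \<open>The ratio is positive because \<open>e * E = u^2 > 0\<close>; hence
      \<open>h > 6\<close>, and every summand of the final expression is negative.\<close>
    define k where "k = E/e"
    have E: "E = k*e" using e0 by (simp add: k_def)
    have k: "k > 0" using eE unfolding E by (simp add: mult.commute zero_less_mult_iff)
         (metis mult_less_0_iff not_square_less_zero zero_less_mult_iff)
    define h where "h = 2*k^2+5*k+6"
    have h: "h > 6" using k by (simp add: h_def add_pos_pos)
    have fh: "f = k*e*h" using f unfolding h_def k_def[symmetric] E by simp
    have "36*t^2*(e*E) = e^2*k*(-k*h*(4*h-18) - (5*h-14) - 19*k)"
      using Q unfolding fh E by (simp add: algebra_simps power2_eq_square)
    moreover have "-k*h*(4*h-18) - (5*h-14) - 19*k < 0"
      using k h by (smt (verit) mult_pos_pos mult_minus_left)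
    then have "e^2*k*(-k*h*(4*h-18) - (5*h-14) - 19*k) < 0" using k e0
      by (simp add: mult_pos_neg)
    moreover have "36*t^2*(e*E) > 0" using t0 eE by simp
    ultimately show ?thesis by linarith
  qed
qed

text \<open>The equations say that \<open>dten\<close> is scalar in a frame with V = -U, B = -A, D =
  -C. From \<open>q \<noteq> w\<close> one gets \<open>u = 0\<close> and the value of
  \<open>p\<close>. A nonzero \<open>a\<close> forces \<open>w = -2*q\<close> and a nonzero
  \<open>c\<close> forces \<open>q = -2*w\<close>; the product \<open>(3*q+2*w)*(4*q+6*w)\<close> is
  then \<open>8*q^2\<close> or \<open>8*w^2\<close>, so the last equation equates a positive number
  with zero.\<close>

lemma axis3_rigid:
  fixes p q w u a c :: real
  assumes ne: "q \<noteq> w"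
    and D12: "u*(w-q) = 0"
    and D13: "a*(2*q-4*p-3*w) + 4*c*u = 0"
    and D23: "c*(4*p+3*q-2*w) + 4*a*u = 0"
    and d12: "(q-w)*(2*p+4*q+4*w) = 0"
    and d23: "(p-q)*(4*p+4*q+2*w) + 4*u^2 + 2*(a^2+c^2) = 0"
  shows "a = 0" "c = 0" "u = 0" "p = - 2*(q+w)" "(3*q+2*w)*(4*q+6*w) = 0"
proof -
  show u: "u = 0" using D12 ne by simp
  show p: "p = - 2*(q+w)" using d12 ne by simp
  have 1: "a*(2*q+w) = 0" using D13 unfolding u p by (simp add: algebra_simps)
  have 2: "c*(q+2*w) = 0" using D23 unfolding u p by (simp add: algebra_simps)
  have 3: "(3*q+2*w)*(4*q+6*w) + 2*(a^2+c^2) = 0" using d23 unfolding u p by (simp add: algebra_simps)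
  have X: "y = -2*x \<Longrightarrow> (3*x+2*y)*(4*x+6*y) \<ge> 0 \<and> (3*y+2*x)*(4*y+6*x) \<ge> 0" for x y :: real by (simp add: algebra_simps)
  have aux: "False" if "x \<ge> 0" "y > 0" "z \<ge> 0" "x + 2*(y+z) = 0 \<or> x + 2*(z+y) = 0" for x y z :: real
    using that by auto
  show a: "a = 0"
  proof (rule ccontr)
    assume "a \<noteq> 0"
    then have "w = -2*q" using 1 by auto
    then have "(3*q+2*w)*(4*q+6*w) \<ge> 0" using X by blast
    moreover have "a^2 > 0" "c^2 \<ge> 0" using \<open>a \<noteq> 0\<close> by auto
    ultimately show False using 3 aux by blast
  qed
  show c: "c = 0"
  proof (rule ccontr)
    assume "c \<noteq> 0"
    then have "q = -2*w" using 2 by auto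
    then have "(3*q+2*w)*(4*q+6*w) \<ge> 0" by (simp add: algebra_simps)
    moreover have "c^2 > 0" "a^2 \<ge> 0" using \<open>c \<noteq> 0\<close> by auto
    ultimately show False using 3 aux by blast
  qed
  show "(3*q+2*w)*(4*q+6*w) = 0" using 3 a c by simp
qed

text \<open>The subcase of \<open>ortho_rigid\<close> with a single nonzero \<open>m\<close>, whose
  square is \<open>T\<close>. Comparing \<open>K3\<close> with \<open>K1\<close> determines
  \<open>T\<close>, and for this value the right side of \<open>K3\<close> vanishes.\<close>

lemma ortho_rigid_one:
  fixes x y z be T :: real
  assumes z: "x + y + z = 0" and y: "y \<noteq> 0"
    and K3: "1 = 2*(x-y)*(4*be^2*y^2 + be^2*(x*y-2*z^2) - T) - 2*x*T"
    and K1: "1 = 2*(y-z)*(4*be^2*y^2 + be^2*(y*z-2*x^2) - T) + 2*z*T"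
  shows False
proof -
  have z': "y = - x - z" using z by simp
  have "y * (T - be^2*(2*x^2+5*x*z+2*z^2)) = 0" using K3 K1 unfolding z' by algebra
  then have "T = be^2*(2*x^2+5*x*z+2*z^2)" using y by simp
  then show False using K3 unfolding z' by (simp add: algebra_simps power2_eq_square)
qed

text \<open>Here \<open>x, y, z\<close> are the differences of the eigenvalues of \<open>d\<^sub>2\<close>. The equation \<open>M\<close> says that \<open>(w, q, p)\<close> is
  \<open>\<alpha>(1,1,1) + \<beta>(yz, xz, xy)\<close>. With \<open>c = 5\<alpha>/4\<close> the off-diagonal equations become
  \<open>m\<^sub>1(c - \<beta>x\<^sup>2) = - m\<^sub>2 m\<^sub>3 x\<close> and its cyclic variants, and these force the eigenvalues to coincide.\<close>

lemma ortho_rigid: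
  fixes p q w x y z m1 m2 m3 :: real
  assumes z: "x + y + z = 0" and nz: "x \<noteq> 0" "y \<noteq> 0" "z \<noteq> 0"
    and M: "p*z*(y-x) + q*y*(x-z) + w*x*(z-y) = 0"
    and D23: "m1*(-2*x*w + (3*x-z)*q + (3*x-y)*p) + 4*m2*m3*x^2 = 0"
    and D13: "m2*(-2*y*q + (3*y-x)*p + (3*y-z)*w) + 4*m1*m3*y^2 = 0"
    and D12: "m3*(-2*z*p + (3*z-y)*w + (3*z-x)*q) + 4*m1*m2*z^2 = 0"
    and N3: "(q-w)*(2*p+4*q+4*w) + 2*z*(y*(m1^2+m2^2+m3^2+m1^2) - x*(m1^2+m2^2+m3^2+m2^2)) = z"
    and N1: "(p-q)*(2*w+4*q+4*p) + 2*x*(z*(m1^2+m2^2+m3^2+m2^2) - y*(m1^2+m2^2+m3^2+m3^2)) = x"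
    and N2: "(w-p)*(2*q+4*w+4*p) + 2*y*(x*(m1^2+m2^2+m3^2+m3^2) - z*(m1^2+m2^2+m3^2+m1^2)) = y"
    and odd: "m1 \<noteq> 0 \<or> m2 \<noteq> 0"
  shows False
proof -
  have zz: "z = - x - y" using z by simp
  \<comment> \<open>\<open>M\<close> ties the differences \<open>q - w\<close> and
    \<open>p - q\<close> together. The factor \<open>be\<close> is read off from whichever of
    \<open>z*(x-y)\<close> and \<open>x*(y-z)\<close> is nonzero; if both vanished,
    \<open>x = y = z\<close> and all three would be zero.\<close>
  obtain be where be: "q - w = be*z*(x-y)" "p - q = be*x*(y-z)"
  proof (cases "x = y")
    case False
    then have 0: "z*(x-y) \<noteq> 0" using nz by simp
    define be where "be = (q-w)/(z*(x-y))"
    have 1: "q - w = be*z*(x-y)" using 0 by (simp add: be_def)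
    have "z*(x-y)*(p - q - be*x*(y-z)) = 0" using M 1 unfolding zz by algebra
    then show ?thesis using 0 1 that by auto
  next
    case True
    define be where "be = (p-q)/(x*(y-z))"
    have 0: "x*(y-z) \<noteq> 0" using nz True zz by auto
    have 1: "p - q = be*x*(y-z)" using 0 by (simp add: be_def)
    have "x*(y-z)*(q - w - be*z*(x-y)) = 0" using M 1 unfolding zz by algebra
    then show ?thesis using 0 1 that by auto
  qed
  define al where "al = w - be*y*z"
  have P: "w = al + be*y*z" "q = al + be*x*z" "p = al + be*x*y"
    using be by (simp_all add: al_def algebra_simps)
  define cc where "cc = 5*al/4"
  have al: "al = 4*cc/5" by (simp add: cc_def)
  define T where "T = m1^2+m2^2+m3^2"
  have "4*x*(m1*(cc-be*x^2) + m2*m3*x) = 0" using D23 unfolding P al zz by (simp add: field_simps) algebra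
  then have E1: "m1*(cc-be*x^2) = - m2*m3*x" using nz by simp
  have "4*y*(m2*(cc-be*y^2) + m1*m3*y) = 0" using D13 unfolding P al zz by (simp add: field_simps) algebra
  then have E2: "m2*(cc-be*y^2) = - m1*m3*y" using nz by simp
  have "4*z*(m3*(cc-be*z^2) + m1*m2*z) = 0" using D12 unfolding P al zz by (simp add: field_simps) algebra
  then have E3: "m3*(cc-be*z^2) = - m1*m2*z" using nz by simp
  have "z * (2*(x-y)*(4*cc*be+be^2*(x*y-2*z^2)-T) + 2*(y*m1^2-x*m2^2) - 1) = 0"
    using N3 unfolding T_def P al zz by (simp add: field_simps) algebra
  then have K3: "1 = 2*(x-y)*(4*cc*be+be^2*(x*y-2*z^2)-T) + 2*(y*m1^2-x*m2^2)" using nz by simp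
  have "x * (2*(y-z)*(4*cc*be+be^2*(y*z-2*x^2)-T) + 2*(z*m2^2-y*m3^2) - 1) = 0"
    using N1 unfolding T_def P al zz by (simp add: field_simps) algebra
  then have K1: "1 = 2*(y-z)*(4*cc*be+be^2*(y*z-2*x^2)-T) + 2*(z*m2^2-y*m3^2)" using nz by simp
  have "y * (2*(z-x)*(4*cc*be+be^2*(z*x-2*y^2)-T) + 2*(x*m3^2-z*m1^2) - 1) = 0"
    using N2 unfolding T_def P al zz by (simp add: field_simps) algebra
  then have K2: "1 = 2*(z-x)*(4*cc*be+be^2*(z*x-2*y^2)-T) + 2*(x*m3^2-z*m1^2)" using nz by simp
  \<comment> \<open>By \<open>E1\<close>, \<open>E2\<close>, \<open>E3\<close>, if one of the
    \<open>m\<close> vanishes then a second one does.\<close>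
  consider "m1 = 0" "m3 = 0" "m2 \<noteq> 0" | "m2 = 0" "m3 = 0" "m1 \<noteq> 0" | "m1 \<noteq> 0" "m2 \<noteq> 0" "m3 \<noteq> 0"
    using odd E1 E2 E3 nz by (metis mult_eq_0_iff neg_equal_0_iff_equal mult_zero_left)
  then show False
  proof cases
    case 1
    then have cc: "cc = be*y^2" using E2 by simp
    have T: "T = m2^2" using 1 by (simp add: T_def)
    show False
      by (rule ortho_rigid_one[of x y z be T]) (use z nz K3 K1 1 in \<open>simp_all add: cc T algebra_simps
          power2_eq_square\<close>)
  next
    case 2
    then have cc: "cc = be*x^2" using E1 by simp
    have T: "T = m1^2" using 2 by (simp add: T_def)
    show False
      by (rule ortho_rigid_one[of z x y be T]) (use z nz K3 K2 2 in \<open>simp_all add: cc T algebra_simps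
          power2_eq_square\<close>)
  next
    case 3
    \<comment> \<open>Multiplying the equations \<open>E1\<close>, \<open>E2\<close>,
      \<open>E3\<close> in pairs yields each square \<open>m1^2\<close>, \<open>m2^2\<close>,
      \<open>m3^2\<close>, hence \<open>T\<close> and \<open>y*m1^2 - x*m2^2\<close>; inserted in
      \<open>K3\<close> they give \<open>1 = 0\<close>.\<close>
    have "m2*m3*((cc-be*y^2)*(cc-be*z^2) - m1^2*y*z) = 0" using E2 E3 by algebra
    then have S1: "(cc-be*y^2)*(cc-be*z^2) = m1^2*y*z" using 3 by simp
    have "m1*m3*((cc-be*x^2)*(cc-be*z^2) - m2^2*x*z) = 0" using E1 E3 by algebra
    then have S2: "(cc-be*x^2)*(cc-be*z^2) = m2^2*x*z" using 3 by simp
    have "m1*m2*((cc-be*x^2)*(cc-be*y^2) - m3^2*x*y) = 0" using E1 E2 by algebra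
    then have S3: "(cc-be*x^2)*(cc-be*y^2) = m3^2*x*y" using 3 by simp
    have "x*y*z*T = x*(m1^2*y*z)+y*(m2^2*x*z)+z*(m3^2*x*y)" by (simp add: T_def algebra_simps)
    also have "\<dots> = x*y*z*(3*be*cc+be^2*(x*y-z^2))" using S1 S2 S3 unfolding zz by algebra
    finally have T: "T = 3*be*cc+be^2*(x*y-z^2)" using nz by simp
    have "z*(y*m1^2-x*m2^2) = z*(-(cc-be*z^2)*be*(x-y))" using S1 S2 unfolding zz by algebra
    then have "y*m1^2-x*m2^2 = -(cc-be*z^2)*be*(x-y)" using nz by simp
    then show False using K3 unfolding T by (simp add: algebra_simps power2_eq_square)
  qed
qed

section \<open>Rotations about the third axis\<close>

lemma rotz_rows:
  "rotz t $ 1 = cos t *\<^sub>R ax 1 + (- sin t) *\<^sub>R ax 2"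
  "rotz t $ 2 = sin t *\<^sub>R ax 1 + cos t *\<^sub>R ax 2"
  "rotz t $ 3 = ax 3"
  by (simp_all add: vec_eq_iff forall_3 rotz_entry axis_def)

lemma (in harmonic) rotz_params:
  "hP (rot4 (rotz t) F) = (cos t ^ 4 - 6 * cos t ^ 2 * sin t ^ 2 + sin t ^ 4) * hP F + (- (cos t ^ 2 * sin t ^
      2)) * hQ F + (- (cos t ^ 2 * sin t ^ 2)) * hW F + (2 * cos t ^ 3 * sin t - 2 * cos t * sin t ^ 3) * hU F +
      (- (2 * cos t ^ 3 * sin t) + 2 * cos t * sin t ^ 3) * hV F"
  "hQ (rot4 (rotz t) F) = (cos t ^ 2) * hQ F + (sin t ^ 2) * hW F + (2 * cos t * sin t) * hU F + (2 * cos t *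
      sin t) * hV F"
  "hW (rot4 (rotz t) F) = (sin t ^ 2) * hQ F + (cos t ^ 2) * hW F + (- (2 * cos t * sin t)) * hU F + (- (2 * cos
      t * sin t)) * hV F"
  "hU (rot4 (rotz t) F) = (- (4 * cos t ^ 3 * sin t) + 4 * cos t * sin t ^ 3) * hP F + (- (cos t ^ 3 * sin t)) *
      hQ F + (cos t * sin t ^ 3) * hW F + (cos t ^ 4 - 3 * cos t ^ 2 * sin t ^ 2) * hU F + (3 * cos t ^ 2 * sin
      t ^ 2 - sin t ^ 4) * hV F"
  "hV (rot4 (rotz t) F) = (4 * cos t ^ 3 * sin t - 4 * cos t * sin t ^ 3) * hP F + (- (cos t * sin t ^ 3)) * hQ
      F + (cos t ^ 3 * sin t) * hW F + (3 * cos t ^ 2 * sin t ^ 2 - sin t ^ 4) * hU F + (cos t ^ 4 - 3 * cos t ^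
      2 * sin t ^ 2) * hV F"
  "hA (rot4 (rotz t) F) = (cos t ^ 3) * hA F + (3 * cos t * sin t ^ 2) * hB F + (- (3 * cos t ^ 2 * sin t)) * hC
      F + (- (sin t ^ 3)) * hD F"
  "hB (rot4 (rotz t) F) = (cos t * sin t ^ 2) * hA F + (cos t ^ 3 - 2 * cos t * sin t ^ 2) * hB F + (2 * cos t ^
      2 * sin t - sin t ^ 3) * hC F + (- (cos t ^ 2 * sin t)) * hD F"
  "hC (rot4 (rotz t) F) = (cos t ^ 2 * sin t) * hA F + (- (2 * cos t ^ 2 * sin t) + sin t ^ 3) * hB F + (cos t ^
      3 - 2 * cos t * sin t ^ 2) * hC F + (cos t * sin t ^ 2) * hD F"
  "hD (rot4 (rotz t) F) = (sin t ^ 3) * hA F + (3 * cos t ^ 2 * sin t) * hB F + (3 * cos t * sin t ^ 2) * hC F +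
      (cos t ^ 3) * hD F"
  unfolding hP_def[of "rot4 _ _"] hQ_def[of "rot4 _ _"] hW_def[of "rot4 _ _"] hU_def[of "rot4 _ _"]
    hV_def[of "rot4 _ _"] hA_def[of "rot4 _ _"] hB_def[of "rot4 _ _"] hC_def[of "rot4 _ _"] hD_def[of "rot4 _ _"]
  unfolding rot4_def transpose_ax rotz_rows ml comps
  by (simp_all add: algebra_simps power2_eq_square power3_eq_cube power4_eq_xxxx)

lemma rot4_rotz_back: "rot4 (rotz (- t)) (rot4 (rotz t) F) = F"
  by (simp add: rot4_rot4 rotz_add rotz_0)

text \<open>The expression is \<open>cos (2*t) * x + sin (2*t) * (y/2)\<close>. It serves to rotate
  away an off-diagonal matrix entry or the coordinate \<open>hU + hV\<close>.\<close>

lemma exists_angle_double: "\<exists>t. ((cos t)\<^sup>2 - (sin t)\<^sup>2) * x + cos t * sin t * y = (0::real)"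
proof (cases "x = 0 \<and> y = 0")
  case False
  define r where "r = sqrt (x\<^sup>2 + (y/2)\<^sup>2)"
  have r: "r > 0" "r\<^sup>2 = x\<^sup>2 + (y/2)\<^sup>2" using False by (auto simp: r_def sum_power2_gt_zero_iff)
  have "((y/2)/r)\<^sup>2 + (-x/r)\<^sup>2 = (x\<^sup>2 + (y/2)\<^sup>2) / r\<^sup>2"
    unfolding power_divide add_divide_distrib by simp
  also have "\<dots> = 1" unfolding r(2)[symmetric] using r(1) by simp
  finally have "((y/2)/r)\<^sup>2 + (-x/r)\<^sup>2 = 1" .
  then obtain \<theta> where "(y/2)/r = cos \<theta>" "-x/r = sin \<theta>" using sincos_total_2pi by metis
  then have c: "y/2 = r * cos \<theta>" "x = - r * sin \<theta>" using r by (simp_all add: field_simps)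
  have "cos \<theta> = (cos (\<theta>/2))\<^sup>2 - (sin (\<theta>/2))\<^sup>2" "sin \<theta> = 2 * sin (\<theta>/2) * cos (\<theta>/2)"
    using cos_double[of "\<theta>/2"] sin_double[of "\<theta>/2"] by simp_all
  then have "((cos (\<theta>/2))\<^sup>2 - (sin (\<theta>/2))\<^sup>2) * x + cos (\<theta>/2) * sin (\<theta>/2) * y = cos \<theta> * x + sin \<theta> * (y/2)"
    by simp
  also have "\<dots> = 0" unfolding c by simp
  finally show ?thesis by blast
qed auto

text \<open>Equivalent to being fixed by the half-turn about the third axis.\<close>

definition block :: "real^3^3 \<Rightarrow> bool" where
  "block M \<longleftrightarrow> M$1$3 = 0 \<and> M$2$3 = 0 \<and> M$3$1 = 0 \<and> M$3$2 = 0"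

lemma cj_rotz_entry:
  "cj (rotz t) M $ 1 $ 1 = (cos t)\<^sup>2 * M$1$1 - cos t * sin t * (M$1$2 + M$2$1) + (sin t)\<^sup>2 * M$2$2"
  "cj (rotz t) M $ 1 $ 2 = cos t * sin t * (M$1$1 - M$2$2) + (cos t)\<^sup>2 * M$1$2 - (sin t)\<^sup>2 * M$2$1"
  "cj (rotz t) M $ 2 $ 1 = cos t * sin t * (M$1$1 - M$2$2) + (cos t)\<^sup>2 * M$2$1 - (sin t)\<^sup>2 * M$1$2"
  "cj (rotz t) M $ 2 $ 2 = (sin t)\<^sup>2 * M$1$1 + cos t * sin t * (M$1$2 + M$2$1) + (cos t)\<^sup>2 * M$2$2"
  "cj (rotz t) M $ 1 $ 3 = cos t * M$1$3 - sin t * M$2$3"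
  "cj (rotz t) M $ 2 $ 3 = sin t * M$1$3 + cos t * M$2$3"
  "cj (rotz t) M $ 3 $ 1 = cos t * M$3$1 - sin t * M$3$2"
  "cj (rotz t) M $ 3 $ 2 = sin t * M$3$1 + cos t * M$3$2"
  "cj (rotz t) M $ 3 $ 3 = M$3$3"
  by (simp_all add: cj_entry sum_3 rotz_entry algebra_simps power2_eq_square)

lemma block_cj_rotz: "block M \<Longrightarrow> block (cj (rotz t) M)"
  by (simp add: block_def cj_rotz_entry)

section \<open>Families of second-order tensors\<close>

definition outer :: "real^3 \<Rightarrow> real^3^3" where
  "outer n = (\<chi> i j. n $ i * n $ j)"

definition axial :: "real^3 \<Rightarrow> real^3^3 \<Rightarrow> bool" where
  "axial n M \<longleftrightarrow> (\<exists>\<alpha> \<beta>. M = mat \<alpha> + \<beta> *\<^sub>R outer n)"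

text \<open>Scalar matrices are axial for every \<open>n\<close>, so isotropic families count as
  coaxial too. The negation then leaves only half-turns and the identity as symmetries
  (\<open>msym_half_turns\<close>).\<close>

definition coaxial :: "(real^3^3) set \<Rightarrow> bool" where
  "coaxial \<F> \<longleftrightarrow> (\<exists>n. n \<noteq> 0 \<and> (\<forall>M\<in>\<F>. axial n M))"

definition famO :: "form4 \<Rightarrow> real^3^3 \<Rightarrow> real^3^3 \<Rightarrow> (real^3^3) set" where
  "famO F A B = {dten F, A, B, lmap F (dten F), lmap F (lmap F (dten F)), lmap F A, lmap F B,
     lmap F (A ** A), lmap F (B ** B)}"

lemma famO_rot4:
  assumes "harmonic F" "g \<in> SO3"
  shows "famO (rot4 g F) (cj g A) (cj g B) = cj g ` famO F A B"
  by (simp add: famO_def dten_rot4[OF assms] lmap_rot4[OF assms] cj_mult[OF assms(2), symmetric])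

lemma cj_outer: "cj g (outer n) = outer (g *v n)"
  by (simp add: vec_eq_iff cj_entry outer_def matrix_vector_mult_def sum_3 algebra_simps)

lemma axial_cj: "g \<in> SO3 \<Longrightarrow> axial n M \<Longrightarrow> axial (g *v n) (cj g M)"
  unfolding axial_def by (metis cj_add cj_mat cj_scaleR cj_outer)

lemma SO3_mult_vec_nz: "g \<in> SO3 \<Longrightarrow> n \<noteq> 0 \<Longrightarrow> g *v n \<noteq> 0"
  by (metis SO3_orth(1) matrix_vector_mul_assoc matrix_vector_mul_lid matrix_vector_mult_0_right)

lemma coaxial_cj_iff:
  assumes "g \<in> SO3"
  shows "coaxial (cj g ` \<F>) \<longleftrightarrow> coaxial \<F>"
proof -
  have *: "coaxial (cj g ` \<F>)" if "coaxial \<F>" "g \<in> SO3" for \<F> g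
    using that unfolding coaxial_def by (metis (no_types, lifting) SO3_mult_vec_nz axial_cj imageE)
  have "\<F> = cj (transpose g) ` (cj g ` \<F>)" using assms by (simp add: image_image cj_inv)
  then show ?thesis using *[OF _ assms] *[OF _ SO3_transpose[OF assms]] by metis
qed

definition sym_tl :: "real^3^3 \<Rightarrow> bool" where
  "sym_tl M \<longleftrightarrow> transpose M = M \<and> trace M = 0"

lemma sym_tl_cj: "g \<in> SO3 \<Longrightarrow> sym_tl M \<Longrightarrow> sym_tl (cj g M)"
  by (simp add: sym_tl_def cj_transpose cj_trace)

lemma sym_tl_entry:
  assumes "sym_tl M"
  shows "M$2$1 = M$1$2" "M$3$1 = M$1$3" "M$3$2 = M$2$3" "M$3$3 = - M$1$1 - M$2$2"
proof -
  have "transpose M $ 1 $ 2 = M$1$2" "transpose M $ 1 $ 3 = M$1$3" "transpose M $ 2 $ 3 = M$2$3"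
    using assms by (simp_all add: sym_tl_def)
  then show "M$2$1 = M$1$2" "M$3$1 = M$1$3" "M$3$2 = M$2$3" by (simp_all add: transpose_entry)
  have "trace M = M$1$1 + M$2$2 + M$3$3" by (simp add: trace_def sum_3)
  then show "M$3$3 = - M$1$1 - M$2$2" using assms by (simp add: sym_tl_def)
qed

definition diag3 :: "real^3^3 \<Rightarrow> bool" where
  "diag3 M \<longleftrightarrow> M$1$2 = 0 \<and> M$1$3 = 0 \<and> M$2$1 = 0 \<and> M$2$3 = 0 \<and> M$3$1 = 0 \<and> M$3$2 = 0"

lemma axial_ax:
  "diag3 M \<Longrightarrow> M$2$2 = M$3$3 \<Longrightarrow> axial (ax 1) M"
  "diag3 M \<Longrightarrow> M$1$1 = M$3$3 \<Longrightarrow> axial (ax 2) M"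
  "diag3 M \<Longrightarrow> M$1$1 = M$2$2 \<Longrightarrow> axial (ax 3) M"
proof -
  assume d: "diag3 M"
  show "M$2$2 = M$3$3 \<Longrightarrow> axial (ax 1) M" unfolding axial_def
    by (rule exI[of _ "M$2$2"], rule exI[of _ "M$1$1 - M$2$2"])
       (use d in \<open>simp add: mat3_eq_iff diag3_def outer_def mat3_entry axis_def\<close>)
  show "M$1$1 = M$3$3 \<Longrightarrow> axial (ax 2) M" unfolding axial_def
    by (rule exI[of _ "M$1$1"], rule exI[of _ "M$2$2 - M$1$1"])
       (use d in \<open>simp add: mat3_eq_iff diag3_def outer_def mat3_entry axis_def\<close>)
  show "M$1$1 = M$2$2 \<Longrightarrow> axial (ax 3) M" unfolding axial_def
    by (rule exI[of _ "M$1$1"], rule exI[of _ "M$3$3 - M$1$1"])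
       (use d in \<open>simp add: mat3_eq_iff diag3_def outer_def mat3_entry axis_def\<close>)
qed

text \<open>All members of the family arise from \<open>dten F\<close>, \<open>A\<close>,
  \<open>B\<close> by squaring and \<open>lmap F\<close>, so a property closed under these two
  operations passes to the whole family.\<close>

lemma coaxial_famO_I:
  assumes "n \<noteq> 0" "P (dten F)" "P A" "P B" "\<And>M. P M \<Longrightarrow> P (lmap F M)" "\<And>M. P M \<Longrightarrow> P (M ** M)"
    "\<And>M. P M \<Longrightarrow> axial n M"
  shows "coaxial (famO F A B)"
proof -
  have "P (lmap F (dten F))" "P (lmap F (lmap F (dten F)))" "P (lmap F A)" "P (lmap F B)"
    "P (lmap F (A ** A))" "P (lmap F (B ** B))"
    using assms(2-6) by simp_all
  then have "\<forall>M\<in>famO F A B. axial n M"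
    using assms(2-4) assms(7) by (simp add: famO_def)
  then show ?thesis unfolding coaxial_def using assms(1) by blast
qed

lemma ax_nz: "ax i \<noteq> 0" by simp

context harmonic
begin

text \<open>On diag(s,r,r) the map \<open>lmap F\<close> produces only multiples of
  \<open>s - r\<close>; the four conditions on \<open>F\<close> say that the result has the same
  axis. The next two lemmas are the analogues for the other axes.\<close>

lemma coaxial_ax1:
  assumes "hP F = hQ F" "hU F = 0" "hA F = 0" "hC F = 0"
    and "\<And>M. M \<in> {dten F, A, B} \<Longrightarrow> diag3 M \<and> M$2$2 = M$3$3"
  shows "coaxial (famO F A B)"
proof (rule coaxial_famO_I[where P = "\<lambda>M. diag3 M \<and> M$2$2 = M$3$3" and n = "ax 1"])
  show "diag3 (lmap F M) \<and> lmap F M$2$2 = lmap F M$3$3" if "diag3 M \<and> M$2$2 = M$3$3" for M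
    using that by (simp add: diag3_def lmap_entry assms(1-4) algebra_simps)
  show "diag3 (M ** M) \<and> (M ** M)$2$2 = (M ** M)$3$3" if "diag3 M \<and> M$2$2 = M$3$3" for M
    using that by (simp add: diag3_def mm3)
qed (use assms(5) axial_ax in auto)

lemma coaxial_ax2:
  assumes "hP F = hW F" "hV F = 0" "hB F = 0" "hD F = 0"
    and "\<And>M. M \<in> {dten F, A, B} \<Longrightarrow> diag3 M \<and> M$1$1 = M$3$3"
  shows "coaxial (famO F A B)"
proof (rule coaxial_famO_I[where P = "\<lambda>M. diag3 M \<and> M$1$1 = M$3$3" and n = "ax 2"])
  show "diag3 (lmap F M) \<and> lmap F M$1$1 = lmap F M$3$3" if "diag3 M \<and> M$1$1 = M$3$3" for M
    using that by (simp add: diag3_def lmap_entry assms(1-4) algebra_simps)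
  show "diag3 (M ** M) \<and> (M ** M)$1$1 = (M ** M)$3$3" if "diag3 M \<and> M$1$1 = M$3$3" for M
    using that by (simp add: diag3_def mm3)
qed (use assms(5) axial_ax in auto)

lemma coaxial_ax3:
  assumes "hQ F = hW F" "hU F + hV F = 0" "hA F + hB F = 0" "hC F + hD F = 0"
    and "\<And>M. M \<in> {dten F, A, B} \<Longrightarrow> diag3 M \<and> M$1$1 = M$2$2"
  shows "coaxial (famO F A B)"
proof (rule coaxial_famO_I[where P = "\<lambda>M. diag3 M \<and> M$1$1 = M$2$2" and n = "ax 3"])
  have e: "hU F = - hV F" "hA F = - hB F" "hC F = - hD F" using assms by simp_all
  show "diag3 (lmap F M) \<and> lmap F M$1$1 = lmap F M$2$2" if "diag3 M \<and> M$1$1 = M$2$2" for M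
    using that by (simp add: diag3_def lmap_entry assms(1) e algebra_simps)
  show "diag3 (M ** M) \<and> (M ** M)$1$1 = (M ** M)$2$2" if "diag3 M \<and> M$1$1 = M$2$2" for M
    using that by (simp add: diag3_def mm3)
qed (use assms(5) axial_ax in auto)

end

section \<open>A common eigenvector of the second-order covariants is a twofold axis\<close>

lemma dten_symmetric: "dten F $ i $ j = dten F $ j $ i"
  by (simp add: dten_def mult.commute)

lemma mat_scalar_iff: "(\<exists>c. M = mat c) \<longleftrightarrow> diag3 M \<and> M$1$1 = M$3$3 \<and> M$2$2 = M$3$3" for M :: "real^3^3"
proof
  assume "diag3 M \<and> M$1$1 = M$3$3 \<and> M$2$2 = M$3$3"
  then have "M = mat (M$3$3)" by (simp add: mat3_eq_iff mat3_entry diag3_def)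
  then show "\<exists>c. M = mat c" ..
qed (auto simp: diag3_def mat3_entry)

context harmonic
begin

lemma rotz_odd_zero:
  assumes "hA (rot4 (rotz t) F) = 0" "hB (rot4 (rotz t) F) = 0" "hC (rot4 (rotz t) F) = 0" "hD (rot4 (rotz t) F) = 0"
  shows "hA F = 0 \<and> hB F = 0 \<and> hC F = 0 \<and> hD F = 0"
proof -
  interpret G: harmonic "rot4 (rotz t) F" by (rule harmonic_rot4[OF harmonic_axioms rotz_SO3])
  show ?thesis using G.rotz_params(6-9)[of "-t"] unfolding rot4_rotz_back assms by simp
qed

text \<open>The odd part of \<open>F\<close> maps block matrices (modulo scalars, a space of dimension 3) linearly to \<open>\<real>\<^sup>2\<close>. If the third
  axis is an eigenvector of the whole family, then \<open>d\<^sub>2\<close>, \<open>c\<^sub>3\<close>, \<open>A\<close>, \<open>B\<close>, \<open>A\<^sup>2\<close>, \<open>B\<^sup>2\<close> lie in the kernel. Rank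
      one and
  rank two of this map are excluded separately.\<close>

lemma kernel_eqs:
  assumes "block M" "M$2$1 = M$1$2" "block (lmap F M)"
  shows "hA F * (M$1$1 - M$3$3) + hB F * (M$2$2 - M$3$3) + hC F * (2 * M$1$2) = 0"
    "hC F * (M$1$1 - M$3$3) + hD F * (M$2$2 - M$3$3) + hB F * (2 * M$1$2) = 0"
  using assms by (simp_all add: block_def lmap_entry algebra_simps)

text \<open>In this normal form the kernel condition is \<open>M$1$1 = M$3$3\<close>. Applied to
  \<open>A\<close>, \<open>B\<close> and their squares it makes \<open>A\<close> and
  \<open>B\<close> diagonal. Applied to \<open>d2\<close> and \<open>c3\<close>, together with the
  off-diagonal entries of \<open>d2\<close>, it gives \<open>hP F = hW F\<close> and then
  \<open>hV F = 0\<close>, so the second axis is common to the family.\<close>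

lemma rank_one_coaxial:
  assumes h: "hA F \<noteq> 0" "hB F = 0" "hC F = 0" "hD F = 0"
    and st: "sym_tl A" "sym_tl B" and bl: "\<And>M. M \<in> famO F A B \<Longrightarrow> block M"
  shows "coaxial (famO F A B)"
proof -
  let ?D = "dten F"
  have K: "M$1$1 = M$3$3" if "block M" "M$2$1 = M$1$2" "block (lmap F M)" for M
    using kernel_eqs[OF that] h by simp
  have blD: "block ?D" "block (lmap F ?D)" "block (lmap F (lmap F ?D))" and blA: "block A" "block (lmap F A)"
      "block (lmap F (A ** A))"
    and blB: "block B" "block (lmap F B)" "block (lmap F (B ** B))"
    by (auto intro!: bl simp: famO_def)
  have D: "?D$1$1 = ?D$3$3" using blD by (intro K) (simp_all add: dten_symmetric[of F 2 1])
  have c3: "lmap F ?D$1$1 = lmap F ?D$3$3" using blD by (intro K) (simp_all add: lmap_entry)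
  have S: "diag3 S \<and> S$1$1 = S$3$3" if "sym_tl S" "block S" "block (lmap F S)" "block (lmap F (S ** S))" for S
  proof -
    note e = sym_tl_entry[OF that(1)]
    have 1: "S$1$1 = S$3$3" using that e by (intro K) simp_all
    have "(S**S)$1$1 = (S**S)$3$3" using that e by (intro K) (simp_all add: block_def mm3)
    then have "S$1$2 * S$1$2 = 0" using that(2) e(1-3) 1 by (simp add: mm3 block_def)
    then show ?thesis using 1 that(2) e(1) by (simp add: diag3_def block_def)
  qed
  have pw: "hP F = hW F" using blD(1) h unfolding block_def dten_entry by (simp add: algebra_simps)
  have uv: "4 * hU F + 3 * hV F = 0"
  proof -
    have "hA F * (4 * hU F + 3 * hV F) = 0" using blD(1) h unfolding block_def dten_entry by (simp add: algebra_simps)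
    then show ?thesis using h by simp
  qed
  have D12: "?D$1$2 = 0"
  proof (cases "hU F = 0")
    case True
    then show ?thesis using uv h unfolding dten_entry by simp
  next
    case False
    have "hU F * ?D$1$2 = 0" using c3 uv pw D blD(1) dten_symmetric[of F 2 1] unfolding block_def lmap_entry by
        algebra
    then show ?thesis using False by simp
  qed
  have v: "hV F = 0"
  proof (rule ccontr)
    assume v: "hV F \<noteq> 0"
    have u: "hU F = - 3/4 * hV F" using uv by simp
    have "hP F * hV F = 0" using D12 unfolding dten_entry h pw[symmetric] u by (simp add: field_simps)
    then have "hP F = 0" using v by simp
    then have "(hV F)\<^sup>2 = 0" using D unfolding dten_entry h pw[symmetric] u by (simp add: field_simps
        power2_eq_square)
    then show False using v by simp
  qed
  show ?thesis
    by (rule coaxial_ax2) (use pw v h S[OF st(1) blA] S[OF st(2) blB] D D12 blD(1) dten_symmetric[of F 2 1]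
        in \<open>auto simp: diag3_def block_def\<close>)
qed

text \<open>The hypotheses are the vanishing 2 x 2 minors of the kernel system with rows (A,B,C) and
  (C,D,B). The rows are therefore proportional in a ratio x : y, and turning (x,y) onto the first
  axis kills the second row.\<close>

lemma rank_one_rotate:
  assumes k: "hB F * hB F = hC F * hD F" "hC F * hC F = hA F * hB F" "hA F * hD F = hB F * hC F"
    and odd: "\<not> (hA F = 0 \<and> hB F = 0 \<and> hC F = 0 \<and> hD F = 0)"
  shows "\<exists>t. hA (rot4 (rotz t) F) \<noteq> 0 \<and> hB (rot4 (rotz t) F) = 0 \<and> hC (rot4 (rotz t) F) = 0 \<and> hD (rot4 (rotz t)
      F) = 0"
proof -
  obtain x y where xy: "x * hC F = y * hA F" "x * hD F = y * hB F" "x * hB F = y * hC F" "x \<noteq> 0 \<or> y \<noteq> 0"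
  proof (cases "hA F = 0 \<and> hB F = 0 \<and> hC F = 0")
    case True
    then show ?thesis using that[of 0 1] by simp
  next
    case False
    then consider "hA F \<noteq> 0" | "hB F \<noteq> 0" | "hC F \<noteq> 0" by blast
    then show ?thesis
    proof cases
      case 1 show ?thesis by (rule that[of "hA F" "hC F"]) (use k 1 in \<open>auto simp: mult.commute\<close>)
    next
      case 2 show ?thesis by (rule that[of "hB F" "hD F"]) (use k 2 in \<open>auto simp: mult.commute\<close>)
    next
      case 3 show ?thesis by (rule that[of "hC F" "hB F"]) (use k 3 in \<open>auto simp: mult.commute\<close>)
    qed
  qed
  define r where "r = sqrt (x\<^sup>2 + y\<^sup>2)"
  have r: "r > 0" "r\<^sup>2 = x\<^sup>2 + y\<^sup>2" using xy(4) by (auto simp: r_def sum_power2_gt_zero_iff)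
  have "(x/r)\<^sup>2 + (-y/r)\<^sup>2 = (x\<^sup>2 + y\<^sup>2) / r\<^sup>2" unfolding power_divide add_divide_distrib by simp
  also have "\<dots> = 1" unfolding r(2)[symmetric] using r(1) by simp
  finally obtain t where t: "x/r = cos t" "-y/r = sin t" using sincos_total_2pi by metis
  have e: "cos t * hC F = - sin t * hA F" "cos t * hD F = - sin t * hB F" "cos t * hB F = - sin t * hC F"
    using xy(1-3) unfolding t[symmetric] by simp_all
  have "hB (rot4 (rotz t) F) = 0 \<and> hC (rot4 (rotz t) F) = 0 \<and> hD (rot4 (rotz t) F) = 0"
    unfolding rotz_params using e by algebra
  then show ?thesis using rotz_odd_zero[of t] odd by blast
qed

text \<open>The pair (Q - W, 2(U + V)) turns by the double angle under rotation about the third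
  axis. A suitable turn makes U + V vanish, and since the pair is nonzero, Q and W differ in the new
  frame, where \<open>axis3_rigid\<close> applies.\<close>

lemma axis3_odd_zero:
  assumes D: "dten F = mat d" and ab: "hA F + hB F = 0" "hC F + hD F = 0"
    and ns: "\<not> (hQ F = hW F \<and> hU F + hV F = 0)"
  shows "hA F = 0 \<and> hB F = 0 \<and> hC F = 0 \<and> hD F = 0"
proof -
  obtain t where t: "((cos t)\<^sup>2 - (sin t)\<^sup>2) * (hU F + hV F) + cos t * sin t * (hW F - hQ F) = 0"
    using exists_angle_double by blast
  interpret G: harmonic "rot4 (rotz t) F" by (rule harmonic_rot4[OF harmonic_axioms rotz_SO3])
  let ?G = "rot4 (rotz t) F"
  have cs: "(cos t)\<^sup>2 = 1 - (sin t)\<^sup>2" by (simp add: cos_squared_eq)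
  have G: "hV ?G = - hU ?G"
  proof -
    have "hU ?G + hV ?G = ((cos t)\<^sup>2 + (sin t)\<^sup>2) * (((cos t)\<^sup>2 - (sin t)\<^sup>2) * (hU F + hV F) + cos t * sin t *
        (hW F - hQ F))"
      unfolding rotz_params by algebra
    then show ?thesis using t by simp
  qed
  have AB: "hB ?G = - hA ?G" "hD ?G = - hC ?G"
  proof -
    have "hB F = - hA F" "hD F = - hC F" using ab by simp_all
    then show "hB ?G = - hA ?G" "hD ?G = - hC ?G" unfolding rotz_params using cs by algebra+
  qed
  have DG: "dten ?G = mat d" using D dten_rot4[OF harmonic_axioms rotz_SO3] cj_mat[OF rotz_SO3] by simp
  have ne: "hQ ?G \<noteq> hW ?G"
  proof
    assume "hQ ?G = hW ?G"
    then have "((cos t)\<^sup>2 - (sin t)\<^sup>2) * (hQ F - hW F) + 4 * cos t * sin t * (hU F + hV F) = 0"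
      unfolding rotz_params by (simp add: algebra_simps)
    then have "((cos t)\<^sup>2 + (sin t)\<^sup>2)^2 * (hU F + hV F) = 0" "((cos t)\<^sup>2 + (sin t)\<^sup>2)^2 * (hQ F - hW F) = 0"
      using t by algebra+
    then show False using ns by simp
  qed
  have e: "dten ?G$1$2 = 0" "dten ?G$1$3 = 0" "dten ?G$2$3 = 0" "dten ?G$1$1 = dten ?G$2$2" "dten ?G$2$2 = dten
      ?G$3$3"
    unfolding DG by (simp_all add: mat3_entry)
  note R = axis3_rigid(1,2)[of "hQ ?G" "hW ?G" "hU ?G" "hA ?G" "hP ?G" "hC ?G", OF ne]
  have c: "hU ?G * (hW ?G - hQ ?G) = 0"
    "hA ?G * (2*hQ ?G - 4*hP ?G - 3*hW ?G) + 4*hC ?G*hU ?G = 0"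
    "hC ?G * (4*hP ?G + 3*hQ ?G - 2*hW ?G) + 4*hA ?G*hU ?G = 0"
    "(hQ ?G - hW ?G) * (2*hP ?G + 4*hQ ?G + 4*hW ?G) = 0"
    "(hP ?G - hQ ?G) * (4*hP ?G + 4*hQ ?G + 2*hW ?G) + 4*(hU ?G)^2 + 2*((hA ?G)^2 + (hC ?G)^2) = 0"
    using e unfolding G.dten_entry G AB by (simp_all add: algebra_simps power2_eq_square)
  show ?thesis by (rule rotz_odd_zero[of t]) (use R[OF c] AB in simp_all)
qed

text \<open>The vector (k1,k2,k3) is the cross product of the two rows of the kernel system; if it
  is nonzero, the kernel is the line it spans.\<close>

lemma kernel_line:
  assumes k: "\<not> (k1 = 0 \<and> k2 = 0 \<and> k3 = (0::real))"
    and kd: "k1 = b*b - c*d" "k2 = c*c - a*b" "k3 = a*d - b*c"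
    and e: "a*x + b*y + c*z = 0" "c*x + d*y + b*z = 0"
  shows "\<exists>l. x = l*k1 \<and> y = l*k2 \<and> z = l*k3"
proof -
  have 0: "x*k2 = y*k1" "x*k3 = z*k1" "y*k3 = z*k2" using e unfolding kd by algebra+
  consider "k1 \<noteq> 0" | "k2 \<noteq> 0" | "k3 \<noteq> 0" using k by blast
  then show ?thesis
  proof cases
    case 1 then show ?thesis using 0 by (intro exI[of _ "x/k1"]) (simp add: field_simps)
  next
    case 2 then show ?thesis using 0 by (intro exI[of _ "y/k2"]) (simp add: field_simps)
  next
    case 3 then show ?thesis using 0 by (intro exI[of _ "z/k3"]) (simp add: field_simps)
  qed
qed

end

context harmonic
begin

lemma lmap_mat: "lmap F (mat c) = mat 0"
  by (simp add: mat3_eq_iff lmap_entry mat3_entry algebra_simps)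

lemma distinct_eigenvalues_odd_zero:
  assumes D0: "diag3 (dten F)" and bl: "block (lmap F (dten F))" "lmap F (dten F)$1$2 = 0"
    and nz: "dten F$1$1 \<noteq> dten F$3$3" "dten F$2$2 \<noteq> dten F$3$3" "dten F$1$1 \<noteq> dten F$2$2"
    and M: "(dten F$2$2 - dten F$3$3) * (lmap F (dten F)$1$1 - lmap F (dten F)$3$3)
       = (dten F$1$1 - dten F$3$3) * (lmap F (dten F)$2$2 - lmap F (dten F)$3$3)"
  shows "hA F = 0 \<and> hB F = 0 \<and> hC F = 0 \<and> hD F = 0"
proof (rule ccontr)
  assume odd: "\<not> (hA F = 0 \<and> hB F = 0 \<and> hC F = 0 \<and> hD F = 0)"
  let ?D = "dten F"
  define x y z where "x = ?D$2$2 - ?D$3$3" and "y = ?D$3$3 - ?D$1$1" and "z = ?D$1$1 - ?D$2$2"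
  note xyz = x_def y_def z_def
  have sum0: "x + y + z = 0" by (simp add: xyz)
  have n: "x \<noteq> 0" "y \<noteq> 0" "z \<noteq> 0" using nz by (simp_all add: xyz)
  \<comment> \<open>The off-diagonal entries of \<open>c3\<close> vanish, which makes each of the
    pairs (A,B), (C,D), (U,V) proportional to (x,y); the \<open>m\<close> are the factors.\<close>
  define m1 m2 m3 where "m1 = hC F / x" and "m2 = hA F / x" and "m3 = hU F / x"
  have "hA F * y = hB F * x" "hC F * y = hD F * x" "hU F * y = hV F * x"
    using bl D0 by (simp_all add: block_def diag3_def lmap_entry xyz algebra_simps)
  then have c: "hA F = m2*x" "hB F = m2*y" "hC F = m1*x" "hD F = m1*y" "hU F = m3*x" "hV F = m3*y"
    using n by (simp_all add: m1_def m2_def m3_def field_simps)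
  have odd': "m1 \<noteq> 0 \<or> m2 \<noteq> 0" using odd c by auto
  have zz: "z = - x - y" using sum0 by simp
  have D1: "?D$1$1 = ?D$3$3 - y" "?D$2$2 = ?D$3$3 + x" by (simp_all add: xyz)
  have L: "lmap F ?D$1$1 = hP F*(x+y) + hQ F*y" "lmap F ?D$2$2 = - hP F*(x+y) - hW F*x" "lmap F ?D$3$3 = hW F*x
      - hQ F*y"
    using D0 unfolding lmap_entry D1 by (simp_all add: diag3_def algebra_simps)
  have M': "hP F*z*(y-x) + hQ F*y*(x-z) + hW F*x*(z-y) = 0"
    using M unfolding D1 L zz by simp algebra
  have D23: "?D$2$3 = 0" and D13: "?D$1$3 = 0" and D12: "?D$1$2 = 0" using D0 by (simp_all add: diag3_def)
  have N: "?D$1$1 - ?D$2$2 = z" "?D$2$2 - ?D$3$3 = x" "?D$3$3 - ?D$1$1 = y" by (simp_all add: xyz)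
  have e1: "m1*(-2*x*hW F + (3*x-z)*hQ F + (3*x-y)*hP F) + 4*m2*m3*x^2 = 0"
    using D23 unfolding dten_entry c zz by algebra
  have e2: "m2*(-2*y*hQ F + (3*y-x)*hP F + (3*y-z)*hW F) + 4*m1*m3*y^2 = 0"
    using D13 unfolding dten_entry c zz by algebra
  have e3: "m3*(-2*z*hP F + (3*z-y)*hW F + (3*z-x)*hQ F) + 4*m1*m2*z^2 = 0"
    using D12 unfolding dten_entry c zz by algebra
  have n3: "(hQ F-hW F)*(2*hP F+4*hQ F+4*hW F) + 2*z*(y*(m1^2+m2^2+m3^2+m1^2) - x*(m1^2+m2^2+m3^2+m2^2)) = z"
    using N(1) unfolding dten_entry c zz by (simp add: algebra_simps power2_eq_square)
  have n1: "(hP F-hQ F)*(2*hW F+4*hQ F+4*hP F) + 2*x*(z*(m1^2+m2^2+m3^2+m2^2) - y*(m1^2+m2^2+m3^2+m3^2)) = x"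
    using N(2) unfolding dten_entry c zz by (simp add: algebra_simps power2_eq_square)
  have n2: "(hW F-hP F)*(2*hQ F+4*hW F+4*hP F) + 2*y*(x*(m1^2+m2^2+m3^2+m3^2) - z*(m1^2+m2^2+m3^2+m1^2)) = y"
    using N(3) unfolding dten_entry c zz by (simp add: algebra_simps power2_eq_square)
  show False by (rule ortho_rigid[OF sum0 n M' e1 e2 e3 n3 n1 n2 odd'])
qed

text \<open>The odd part must have rank two, so the kernel is a line; the nonscalar diagonal
  \<open>M0\<close> makes this line diagonal. The proof splits according to which entries of
  diag(k1,k2,0) coincide.\<close>

lemma adapted_frame_odd_zero:
  assumes st: "sym_tl A" "sym_tl B" and bl: "\<And>M. M \<in> famO F A B \<Longrightarrow> block M"
    and nc: "\<not> coaxial (famO F A B)"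
    and M0: "M0 \<in> {dten F, A, B}" "M0$1$2 = 0" "M0$1$1 \<noteq> M0$3$3 \<or> M0$2$2 \<noteq> M0$3$3"
  shows "hA F = 0 \<and> hB F = 0 \<and> hC F = 0 \<and> hD F = 0"
proof (rule ccontr)
  assume odd: "\<not> (hA F = 0 \<and> hB F = 0 \<and> hC F = 0 \<and> hD F = 0)"
  let ?D = "dten F"
  define k1 k2 k3 where "k1 = hB F * hB F - hC F * hD F" and "k2 = hC F * hC F - hA F * hB F"
    and "k3 = hA F * hD F - hB F * hC F"
  note kd = k1_def k2_def k3_def
  have k: "\<not> (k1 = 0 \<and> k2 = 0 \<and> k3 = 0)"
  \<comment> \<open>Vanishing minors mean rank one, which after a turn contradicts
    \<open>rank_one_coaxial\<close>.\<close>
  proof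
    assume "k1 = 0 \<and> k2 = 0 \<and> k3 = 0"
    then obtain t where t: "hA (rot4 (rotz t) F) \<noteq> 0" "hB (rot4 (rotz t) F) = 0"
       "hC (rot4 (rotz t) F) = 0" "hD (rot4 (rotz t) F) = 0"
      using rank_one_rotate odd by (auto simp: kd)
    interpret G: harmonic "rot4 (rotz t) F" by (rule harmonic_rot4[OF harmonic_axioms rotz_SO3])
    note im = famO_rot4[OF harmonic_axioms rotz_SO3]
    have "coaxial (famO (rot4 (rotz t) F) (cj (rotz t) A) (cj (rotz t) B))"
      by (rule G.rank_one_coaxial[OF t sym_tl_cj[OF rotz_SO3 st(1)] sym_tl_cj[OF rotz_SO3 st(2)]])
         (use bl in \<open>auto simp: im block_cj_rotz\<close>)
    then show False using nc by (simp add: im coaxial_cj_iff rotz_SO3)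
  qed
  have blD: "block ?D" "block (lmap F ?D)" "block (lmap F (lmap F ?D))" and blA: "block A" "block (lmap F A)"
      "block (lmap F (A ** A))"
    and blB: "block B" "block (lmap F B)" "block (lmap F (B ** B))"
    by (auto intro!: bl simp: famO_def)
  \<comment> \<open>The kernel condition for \<open>M\<close> requires that \<open>lmap F M\<close>
    be block. Thus \<open>c4\<close>, \<open>lmap F (A ** A)\<close> and
    \<open>lmap F (B ** B)\<close> let it be used for \<open>c3\<close> and for the squares of
    \<open>A\<close> and \<open>B\<close>.\<close>
  have line: "\<exists>l. M$1$1 - M$3$3 = l*k1 \<and> M$2$2 - M$3$3 = l*k2 \<and> 2*M$1$2 = l*k3"
    if "block M" "M$2$1 = M$1$2" "block (lmap F M)" for M
    by (rule kernel_line[OF k kd kernel_eqs[OF that]])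
  have lD: "\<exists>l. ?D$1$1 - ?D$3$3 = l*k1 \<and> ?D$2$2 - ?D$3$3 = l*k2 \<and> 2*?D$1$2 = l*k3"
    by (rule line) (use blD in \<open>simp_all add: dten_symmetric[of F 2 1]\<close>)
  have lS: "\<exists>l. S$1$1 - S$3$3 = l*k1 \<and> S$2$2 - S$3$3 = l*k2 \<and> 2*S$1$2 = l*k3"
    if "sym_tl S" "block S" "block (lmap F S)" for S
    by (rule line) (use that sym_tl_entry[OF that(1)] in simp_all)
  have k3: "k3 = 0"
  proof -
    have "\<exists>l. M0$1$1 - M0$3$3 = l*k1 \<and> M0$2$2 - M0$3$3 = l*k2 \<and> 2*M0$1$2 = l*k3"
      using M0(1) lD lS[OF st(1) blA(1,2)] lS[OF st(2) blB(1,2)] by auto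
    then show ?thesis using M0(2,3) by auto
  qed
  obtain l where l: "?D$1$1 - ?D$3$3 = l*k1" "?D$2$2 - ?D$3$3 = l*k2" "?D$1$2 = 0"
    using lD k3 by auto
  have dD: "diag3 ?D" using l(3) blD(1) dten_symmetric[of F 2 1] by (simp add: diag3_def block_def)
  have "\<exists>l. lmap F ?D$1$1 - lmap F ?D$3$3 = l*k1 \<and> lmap F ?D$2$2 - lmap F ?D$3$3 = l*k2 \<and> 2*lmap F ?D$1$2 = l*k3"
    by (rule line) (use blD in \<open>simp_all add: lmap_entry\<close>)
  then obtain l3 where l3: "lmap F ?D$1$1 - lmap F ?D$3$3 = l3*k1" "lmap F ?D$2$2 - lmap F ?D$3$3 = l3*k2" "lmap
      F ?D$1$2 = 0"
    using k3 by auto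
  \<comment> \<open>Modulo scalars both \<open>S\<close> and its square lie on the kernel line,
    which is impossible for three distinct eigenvalues.\<close>
  have S: "diag3 S \<and> (\<exists>l. S$1$1 - S$3$3 = l*k1 \<and> S$2$2 - S$3$3 = l*k2 \<and> (l = 0 \<or> k1 = 0 \<or> k2 = 0 \<or> k1 = k2))"
    if s: "sym_tl S" "block S" "block (lmap F S)" "block (lmap F (S ** S))" for S
  proof -
    note e = sym_tl_entry[OF s(1)]
    obtain l where l: "S$1$1 - S$3$3 = l*k1" "S$2$2 - S$3$3 = l*k2" "S$1$2 = 0"
      using lS[OF s(1-3)] k3 by auto
    have d: "diag3 S" using s(2) l(3) e by (simp add: diag3_def block_def)
    have "\<exists>l. (S**S)$1$1 - (S**S)$3$3 = l*k1 \<and> (S**S)$2$2 - (S**S)$3$3 = l*k2 \<and> 2*(S**S)$1$2 = l*k3"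
      by (rule line) (use s d e in \<open>simp_all add: block_def diag3_def mm3\<close>)
    then obtain l' where l': "S$1$1*S$1$1 - S$3$3*S$3$3 = l'*k1" "S$2$2*S$2$2 - S$3$3*S$3$3 = l'*k2"
      using d by (auto simp: mm3 diag3_def)
    have "l*k1*k2*(S$1$1 - S$2$2) = 0" using l l' by algebra
    moreover have "S$1$1 - S$2$2 = l*(k1-k2)" using l by (simp add: algebra_simps)
    ultimately have "l = 0 \<or> k1 = 0 \<or> k2 = 0 \<or> k1 = k2" by auto
    then show ?thesis using d l by blast
  qed
  note SA = S[OF st(1) blA] and SB = S[OF st(2) blB]
  have orth: "hA F * k1 + hB F * k2 = 0" "hC F * k1 + hD F * k2 = 0" using k3 unfolding kd by algebra+
  consider (gen) "k1 \<noteq> 0" "k2 \<noteq> 0" "k1 \<noteq> k2" | (ax3) "k1 = k2" "k1 \<noteq> 0" | (ax1) "k2 = 0" "k1 \<noteq> 0" | (ax2) "k1 =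
      0" "k2 \<noteq> 0"
    using k k3 by blast
  then show False
  proof cases
    case gen
    \<comment> \<open>A generic line forces \<open>A\<close> and \<open>B\<close> to be scalar, so
      the nonscalar matrix is \<open>d2\<close>, and its three eigenvalues are distinct.\<close>
    have "M0 = ?D" using M0 SA SB gen by auto
    then have l0: "l \<noteq> 0" using l M0 by auto
    have "?D$1$1 \<noteq> ?D$3$3" "?D$2$2 \<noteq> ?D$3$3" "?D$1$1 \<noteq> ?D$2$2"
      using l l0 gen by (auto simp: algebra_simps)
    moreover have "(?D$2$2 - ?D$3$3) * (lmap F ?D$1$1 - lmap F ?D$3$3) = (?D$1$1 - ?D$3$3) * (lmap F ?D$2$2 -
        lmap F ?D$3$3)"
      unfolding l l3 by simp
    ultimately show False using odd distinct_eigenvalues_odd_zero[OF dD blD(2) l3(3)] by blast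
  next
    case ax3
    \<comment> \<open>Now \<open>d2\<close>, \<open>A\<close>, \<open>B\<close> share an axis. Since
      the family is not coaxial, \<open>lmap F\<close> cannot preserve that axis; were
      \<open>d2\<close> nonscalar, the position of \<open>c3\<close> on the line would make
      \<open>lmap F\<close> preserve it. So \<open>d2\<close> is scalar and a rigidity lemma
      applies. The other two cases follow the same pattern.\<close>
    have ab: "hA F + hB F = 0" "hC F + hD F = 0" using orth ax3 by (simp_all flip: distrib_right)
    have d: "diag3 M \<and> M$1$1 = M$2$2" if "M \<in> {?D, A, B}" for M
      using that SA SB l dD ax3 by auto
    have "\<not> (hQ F = hW F \<and> hU F + hV F = 0)" using coaxial_ax3[OF _ _ ab d] nc by blast
    moreover have "hQ F = hW F \<and> hU F + hV F = 0" if "?D$1$1 \<noteq> ?D$3$3"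
    proof -
      have "(hQ F - hW F) * (?D$3$3 - ?D$1$1) = 0" "(hU F + hV F) * (?D$1$1 - ?D$3$3) = 0"
      proof -
        have "lmap F ?D$1$1 = lmap F ?D$2$2" using l3 ax3 by simp
        then show "(hQ F - hW F) * (?D$3$3 - ?D$1$1) = 0"
          using d[of ?D] unfolding lmap_entry diag3_def by (simp add: algebra_simps)
        show "(hU F + hV F) * (?D$1$1 - ?D$3$3) = 0"
          using l3(3) d[of ?D] unfolding lmap_entry diag3_def by (simp add: algebra_simps)
      qed
      then show ?thesis using that by simp
    qed
    moreover have "hA F = 0 \<and> hB F = 0 \<and> hC F = 0 \<and> hD F = 0" if q: "?D$1$1 = ?D$3$3" and q2: "\<not> (hQ F = hW F \<and>
        hU F + hV F = 0)"
    proof -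
      have "diag3 ?D" "?D$2$2 = ?D$3$3" using d[of ?D] q by simp_all
      then obtain c where "?D = mat c" using mat_scalar_iff[of ?D] q by blast
      then show ?thesis using axis3_odd_zero[OF _ ab q2] by blast
    qed
    ultimately show False using odd by blast
  next
    case ax1
    have ab: "hA F = 0" "hC F = 0" using orth ax1 by simp_all
    have d: "diag3 M \<and> M$2$2 = M$3$3" if "M \<in> {?D, A, B}" for M
      using that SA SB l dD ax1 by auto
    have "\<not> (hP F = hQ F \<and> hU F = 0)" using coaxial_ax1[OF _ _ ab d] nc by blast
    moreover have "hP F = hQ F \<and> hU F = 0" if "?D$1$1 \<noteq> ?D$2$2"
    proof -
      have "(hP F - hQ F) * (?D$1$1 - ?D$2$2) = 0" "hU F * (?D$1$1 - ?D$2$2) = 0"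
      proof -
        have "lmap F ?D$2$2 = lmap F ?D$3$3" using l3 ax1 by simp
        then show "(hP F - hQ F) * (?D$1$1 - ?D$2$2) = 0"
          using d[of ?D] unfolding lmap_entry diag3_def by (simp add: algebra_simps)
        show "hU F * (?D$1$1 - ?D$2$2) = 0"
          using l3(3) d[of ?D] unfolding lmap_entry diag3_def by (simp add: algebra_simps)
      qed
      then show ?thesis using that by simp
    qed
    moreover have "hP F = hQ F \<and> hU F = 0" if q: "?D$1$1 = ?D$2$2"
    proof (rule axis1_rigid[of "hB F" "hP F" "hQ F" "hW F" "hU F" "hD F" "hV F"])
      have e: "?D$1$2 = 0" "?D$1$3 = 0" "?D$2$3 = 0" "?D$1$1 = ?D$2$2" "?D$2$2 = ?D$3$3"
        using q d[of ?D] by (simp_all add: diag3_def)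
      note e' = e[unfolded dten_entry ab]
      show "hB F \<noteq> 0" using ax1 ab by (simp add: kd)
      show "3 * hP F * hB F - 2 * hQ F * hB F + 4 * hW F * hB F + 3 * hU F * hD F + 4 * hV F * hD F = 0"
        using e'(2) by simp
      show "hQ F * hD F - hP F * hD F - 3 * hU F * hB F = 0" using e'(3) by simp
      show "2 * hP F * hU F + 2 * hP F * hV F - 4 * hQ F * hU F - 3 * hQ F * hV F - 3 * hW F * hU F -
          4 * hW F * hV F + 4 * hB F * hD F = 0" using e'(1) by simp
      show "(hQ F - hW F) * (2 * hP F + 4 * hQ F + 4 * hW F) + 2 * ((hU F)\<^sup>2 - (hV F)\<^sup>2) - 2 * (hB F)\<^sup>2 - 4 *
          (hD F)\<^sup>2 = 0"
        using e'(4) by (simp add: algebra_simps power2_eq_square)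
      show "(hP F - hQ F) * (4 * hP F + 4 * hQ F + 2 * hW F) - 2 * (hU F)\<^sup>2 - 6 * hU F * hV F = 0"
        using e'(5) by (simp add: algebra_simps power2_eq_square)
    qed
    ultimately show False by blast
  next
    case ax2
    have ab: "hB F = 0" "hD F = 0" using orth ax2 by simp_all
    have d: "diag3 M \<and> M$1$1 = M$3$3" if "M \<in> {?D, A, B}" for M
      using that SA SB l dD ax2 by auto
    have "\<not> (hP F = hW F \<and> hV F = 0)" using coaxial_ax2[OF _ _ ab d] nc by blast
    moreover have "hP F = hW F \<and> hV F = 0" if "?D$1$1 \<noteq> ?D$2$2"
    proof -
      have "(hP F - hW F) * (?D$2$2 - ?D$1$1) = 0" "hV F * (?D$2$2 - ?D$1$1) = 0"
      proof -
        have "lmap F ?D$1$1 = lmap F ?D$3$3" using l3 ax2 by simp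
        then show "(hP F - hW F) * (?D$2$2 - ?D$1$1) = 0"
          using d[of ?D] unfolding lmap_entry diag3_def by (simp add: algebra_simps)
        show "hV F * (?D$2$2 - ?D$1$1) = 0"
          using l3(3) d[of ?D] unfolding lmap_entry diag3_def by (simp add: algebra_simps)
      qed
      then show ?thesis using that by simp
    qed
    moreover have "hP F = hW F \<and> hV F = 0" if q: "?D$1$1 = ?D$2$2"
    proof (rule axis1_rigid[of "hC F" "hP F" "hW F" "hQ F" "hV F" "hA F" "hU F"])
      have e: "?D$1$2 = 0" "?D$1$3 = 0" "?D$2$3 = 0" "?D$1$1 = ?D$2$2" "?D$1$1 = ?D$3$3"
        using q d[of ?D] by (simp_all add: diag3_def)
      note e' = e[unfolded dten_entry ab]
      show "hC F \<noteq> 0" using ax2 ab by (simp add: kd)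
      show "3 * hP F * hC F - 2 * hW F * hC F + 4 * hQ F * hC F + 3 * hV F * hA F + 4 * hU F * hA F = 0"
        using e'(3) by simp
      show "hW F * hA F - hP F * hA F - 3 * hV F * hC F = 0" using e'(2) by simp
      show "2 * hP F * hV F + 2 * hP F * hU F - 4 * hW F * hV F - 3 * hW F * hU F - 3 * hQ F * hV F -
          4 * hQ F * hU F + 4 * hC F * hA F = 0" using e'(1) by (simp add: algebra_simps)
      show "(hW F - hQ F) * (2 * hP F + 4 * hW F + 4 * hQ F) + 2 * ((hV F)\<^sup>2 - (hU F)\<^sup>2) - 2 * (hC F)\<^sup>2 - 4 *
          (hA F)\<^sup>2 = 0"
        using e'(4) by (simp add: algebra_simps power2_eq_square)
      show "(hP F - hW F) * (4 * hP F + 4 * hW F + 2 * hQ F) - 2 * (hV F)\<^sup>2 - 6 * hV F * hU F = 0"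
        using e'(5) by (simp add: algebra_simps power2_eq_square)
    qed
    ultimately show False by blast
  qed
qed

text \<open>If \<open>d2\<close>, \<open>A\<close>, \<open>B\<close> were all scalar the family
  would be coaxial. Otherwise a turn about the third axis diagonalizes a nonscalar one of them and
  gives the adapted frame.\<close>

lemma common_eigenvector_odd_zero:
  assumes st: "sym_tl A" "sym_tl B" and bl: "\<And>M. M \<in> famO F A B \<Longrightarrow> block M"
    and nc: "\<not> coaxial (famO F A B)"
  shows "hA F = 0 \<and> hB F = 0 \<and> hC F = 0 \<and> hD F = 0"
proof -
  have mm: "(mat c :: real^3^3) ** mat c = mat (c * c)" for c
    by (simp add: mat3_eq_iff mm3 mat3_entry)
  have "\<exists>M0\<in>{dten F, A, B}. \<nexists>c. M0 = mat c"
  proof (rule ccontr)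
    assume "\<not> ?thesis"
    then have sc: "\<exists>c. dten F = mat c" "\<exists>c. A = mat c" "\<exists>c. B = mat c" by blast+
    have "coaxial (famO F A B)"
    proof (rule coaxial_famO_I[where P = "\<lambda>M. \<exists>c. M = mat c", OF ax_nz sc])
      fix M :: "real^3^3" assume M: "\<exists>c. M = mat c"
      show "\<exists>c. lmap F M = mat c" using M lmap_mat by blast
      show "\<exists>c. M ** M = mat c" using M mm by blast
      show "axial (ax 1) M" using M mat_scalar_iff[of M] axial_ax(1)[of M] by blast
    qed
    then show False using nc by simp
  qed
  then obtain M0 where M0: "M0 \<in> {dten F, A, B}" "\<nexists>c. M0 = mat c" by blast
  have s: "M0$2$1 = M0$1$2" using M0(1) sym_tl_entry(1) st dten_symmetric[of F 2 1] by blast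
  have b: "block M0" using M0(1) by (auto intro!: bl simp: famO_def)
  obtain t where t: "((cos t)\<^sup>2 - (sin t)\<^sup>2) * M0$1$2 + cos t * sin t * (M0$1$1 - M0$2$2) = 0"
    using exists_angle_double by blast
  let ?g = "rotz t"
  interpret G: harmonic "rot4 ?g F" by (rule harmonic_rot4[OF harmonic_axioms rotz_SO3])
  note im = famO_rot4[OF harmonic_axioms rotz_SO3]
  have z: "cj ?g M0 $ 1 $ 2 = 0" using t s by (simp add: cj_rotz_entry algebra_simps)
  have ns: "cj ?g M0$1$1 \<noteq> cj ?g M0$3$3 \<or> cj ?g M0$2$2 \<noteq> cj ?g M0$3$3"
  proof (rule ccontr)
    assume "\<not> ?thesis"
    moreover have "cj ?g M0 $ 2 $ 1 = 0" using z s by (simp add: cj_rotz_entry)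
    ultimately have "\<exists>c. cj ?g M0 = mat c" using z block_cj_rotz[OF b, of t]
      by (subst mat_scalar_iff) (auto simp: diag3_def block_def)
    then show False using M0(2) by (metis cj_inv(1) cj_mat rotz_SO3 SO3_transpose)
  qed
  have "hA (rot4 ?g F) = 0 \<and> hB (rot4 ?g F) = 0 \<and> hC (rot4 ?g F) = 0 \<and> hD (rot4 ?g F) = 0"
  proof (rule G.adapted_frame_odd_zero[OF sym_tl_cj[OF rotz_SO3 st(1)] sym_tl_cj[OF rotz_SO3 st(2)] _ _ _ z ns])
    show "block M" if "M \<in> famO (rot4 ?g F) (cj ?g A) (cj ?g B)" for M
      using that bl by (auto simp: im block_cj_rotz)
    show "\<not> coaxial (famO (rot4 ?g F) (cj ?g A) (cj ?g B))"
      using nc by (simp add: im coaxial_cj_iff rotz_SO3)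
    show "cj ?g M0 \<in> {dten (rot4 ?g F), cj ?g A, cj ?g B}"
      using M0(1) by (auto simp: dten_rot4[OF harmonic_axioms rotz_SO3])
  qed
  then show ?thesis using rotz_odd_zero by blast
qed

end

section \<open>Isotropic quadratic covariant forces cubic symmetry\<close>

text \<open>The quartics that are multiples of 3|x|^4 - 5(x1^4 + x2^4 + x3^4), as
  \<open>cubic_form\<close> shows; the zero form is included.\<close>

definition cubic :: "form4 \<Rightarrow> bool" where
  "cubic F \<longleftrightarrow> hQ F = hP F \<and> hW F = hP F \<and> hU F = 0 \<and> hV F = 0 \<and> hA F = 0 \<and> hB F = 0 \<and> hC F = 0 \<and> hD F = 0"

text \<open>First and second order conditions for a maximum at \<open>s = 0\<close>: divide by
  \<open>s\<close> and let \<open>s\<close> tend to 0 from either side, then divide once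
  more.\<close>

lemma quartic_nonpos_coeffs:
  fixes \<alpha> \<beta> \<gamma> \<delta> :: real
  assumes "\<And>s. \<alpha>* s + \<beta>* s^2 + \<gamma>* s^3 + \<delta>* s^4 \<le> 0"
  shows "\<alpha> = 0 \<and> \<beta> \<le> 0"
proof -
  have pos: "\<alpha> \<le> 0" if h: "\<And>s. s > 0 \<Longrightarrow> \<alpha>* s + \<beta>* s^2 + \<gamma>* s^3 + \<delta>* s^4 \<le> 0" for \<alpha> \<beta> \<gamma> \<delta> :: real
  proof (rule tendsto_upperbound[of "\<lambda>s. \<alpha> + \<beta>* s + \<gamma>* s^2 + \<delta>* s^3" _ "at_right 0"])
    show "((\<lambda>s. \<alpha> + \<beta>* s + \<gamma>* s^2 + \<delta>* s^3) \<longlongrightarrow> \<alpha>) (at_right 0)"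
      by (auto intro!: tendsto_eq_intros)
    have "\<alpha> + \<beta>* s + \<gamma>* s^2 + \<delta>* s^3 \<le> 0" if "s > 0" for s
    proof -
      have "s * (\<alpha> + \<beta>* s + \<gamma>* s^2 + \<delta>* s^3) \<le> 0"
        using h[OF that] by (simp add: algebra_simps power2_eq_square power3_eq_cube power4_eq_xxxx)
      then show ?thesis using that by (simp add: mult_le_0_iff)
    qed
    then show "\<forall>\<^sub>F s in at_right 0. \<alpha> + \<beta>* s + \<gamma>* s^2 + \<delta>* s^3 \<le> 0"
      using eventually_at_right_less[of "0::real"] by (auto elim: eventually_mono)
  qed simp
  have 1: "\<alpha> \<le> 0" using pos assms by blast
  have "- \<alpha> \<le> 0"
    by (rule pos[of "-\<alpha>" \<beta> "-\<gamma>" \<delta>]) (use assms[of "- _"] in simp)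
  then have a: "\<alpha> = 0" using 1 by simp
  have "\<beta> \<le> 0"
  proof (rule pos[of \<beta> \<gamma> \<delta> 0])
    fix s :: real assume s: "s > 0"
    have "s * (\<beta>* s + \<gamma>* s^2 + \<delta>* s^3 + 0* s^4) \<le> 0"
      using assms[of s] a by (simp add: algebra_simps power2_eq_square power3_eq_cube power4_eq_xxxx)
    then show "\<beta>* s + \<gamma>* s^2 + \<delta>* s^3 + 0* s^4 \<le> 0" using s by (simp add: mult_le_0_iff)
  qed
  then show ?thesis using a by simp
qed

lemma cos_sin_multiples:
  fixes t :: real
  shows "cos (4*t) = cos t ^ 4 - 6 * cos t ^ 2 * sin t ^ 2 + sin t ^ 4"
    "sin (4*t) = 4 * cos t ^ 3 * sin t - 4 * cos t * sin t ^ 3"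
    "cos (3*t) = cos t ^ 3 - 3 * cos t * sin t ^ 2"
    "sin (3*t) = 3 * cos t ^ 2 * sin t - sin t ^ 3"
proof -
  have e: "cos (4*t) = cos (2*(2*t))" "sin (4*t) = sin (2*(2*t))" "cos (3*t) = cos (2*t + t)" "sin (3*t) = sin
      (2*t + t)"
    by simp_all
  show "cos (4*t) = cos t ^ 4 - 6 * cos t ^ 2 * sin t ^ 2 + sin t ^ 4"
    "sin (4*t) = 4 * cos t ^ 3 * sin t - 4 * cos t * sin t ^ 3"
    "cos (3*t) = cos t ^ 3 - 3 * cos t * sin t ^ 2"
    "sin (3*t) = 3 * cos t ^ 2 * sin t - sin t ^ 3"
    unfolding e cos_add[of "2*t"] sin_add[of "2*t"] cos_double sin_double
    by (simp_all add: algebra_simps power2_eq_square power3_eq_cube power4_eq_xxxx)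
qed

lemma exists_angle_multiple:
  fixes x y r :: real
  assumes "r \<noteq> 0" "x^2 + y^2 = r^2" "m > 0"
  shows "\<exists>t. x = r * cos (m*t) \<and> y = r * sin (m*t)"
proof -
  have "(x/r)^2 + (y/r)^2 = (x^2+y^2)/r^2" unfolding power_divide add_divide_distrib by simp
  also have "\<dots> = 1" using assms by simp
  finally obtain \<theta> where t: "x/r = cos \<theta>" "y/r = sin \<theta>" using sincos_total_2pi by metis
  show ?thesis using assms t by (intro exI[of _ "\<theta>/m"]) (simp add: field_simps)
qed

context harmonic
begin

lemma quartic_binomial:
  "F (r *\<^sub>R f + e) (r *\<^sub>R f + e) (r *\<^sub>R f + e) (r *\<^sub>R f + e)
    = r ^ 4 * F f f f f + 4 * r ^ 3 * F f f f e + 6 * r\<^sup>2 * F f f e e + 4 * r * F f e e e + F e e e e"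
proof -
  have "F f f e f = F f f f e" "F f e f f = F f f f e" "F e f f f = F f f f e"
    "F f e f e = F f f e e" "F f e e f = F f f e e" "F e e f f = F f f e e" "F e f e f = F f f e e" "F e f f e =
        F f f e e"
    "F e f e e = F f e e e" "F e e f e = F f e e e" "F e e e f = F f e e e"
    by (simp_all only: sym12 sym23 sym34)
  then show ?thesis unfolding ml
    by (simp add: algebra_simps power2_eq_square power3_eq_cube power4_eq_xxxx)
qed

text \<open>The third axis maximizes \<open>|F x x x x|\<close> on the sphere. The critical points of a cubic form are the axes of order
  4, 3 and 2; the second and first order conditions together with the bound on the absolute value leave only order 4.\<close>

lemma max_frame_cubic:
  assumes D: "dten F = mat d" and uv: "hV F = - hU F"
    and bd: "\<And>x. \<bar>F x x x x\<bar> \<le> (- hQ F - hW F) * (x \<bullet> x)\<^sup>2"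
  shows "\<exists>t. cubic (rot4 (rotz t) F)"
proof -
  let ?m = "- hQ F - hW F"
  have e: "dten F$1$2 = 0" "dten F$1$3 = 0" "dten F$2$3 = 0" "dten F$1$1 = dten F$2$2" "dten F$2$2 = dten F$3$3"
    unfolding D by (simp_all add: mat3_entry)
  have ip: "ax i \<bullet> ax j = (if i = j then 1 else 0)" for i j by (simp add: inner_axis_axis)
  have q1: "- 4 * (hA F + hB F) = 0 \<and> 8 * hQ F + 2 * hW F \<le> 0"
  proof (rule quartic_nonpos_coeffs)
    fix s :: real
    let ?x = "ax 3 + s *\<^sub>R ax 1"
    have "F ?x ?x ?x ?x \<le> ?m * (?x \<bullet> ?x)\<^sup>2" using bd[of ?x] by linarith
    then show "- 4 * (hA F + hB F)* s + (8 * hQ F + 2 * hW F)* s^2 + (4*hA F)* s^3 + (- hP F - hQ F - ?m)* s^4 \<le> 0"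
      unfolding ml comps inner_add_left inner_add_right inner_scaleR_left inner_scaleR_right ip
      by (simp add: algebra_simps power2_eq_square power3_eq_cube power4_eq_xxxx)
  qed
  have q2: "- 4 * (hC F + hD F) = 0 \<and> 2 * hQ F + 8 * hW F \<le> 0"
  proof (rule quartic_nonpos_coeffs)
    fix s :: real
    let ?x = "ax 3 + s *\<^sub>R ax 2"
    have "F ?x ?x ?x ?x \<le> ?m * (?x \<bullet> ?x)\<^sup>2" using bd[of ?x] by linarith
    then show "- 4 * (hC F + hD F)* s + (2 * hQ F + 8 * hW F)* s^2 + (4*hD F)* s^3 + (- hP F - hW F - ?m)* s^4 \<le> 0"
      unfolding ml comps inner_add_left inner_add_right inner_scaleR_left inner_scaleR_right ip
      by (simp add: algebra_simps power2_eq_square power3_eq_cube power4_eq_xxxx)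
  qed
  have AB: "hB F = - hA F" "hD F = - hC F" using q1 q2 by auto
  have c: "hU F * (hW F - hQ F) = 0"
    "hA F * (2*hQ F - 4*hP F - 3*hW F) + 4*hC F*hU F = 0"
    "hC F * (4*hP F + 3*hQ F - 2*hW F) + 4*hA F*hU F = 0"
    "(hQ F - hW F) * (2*hP F + 4*hQ F + 4*hW F) = 0"
    "(hP F - hQ F) * (4*hP F + 4*hQ F + 2*hW F) + 4*(hU F)^2 + 2*((hA F)^2 + (hC F)^2) = 0"
    using e unfolding dten_entry uv AB by (simp_all add: algebra_simps power2_eq_square)
  \<comment> \<open>Otherwise \<open>axis3_rigid\<close> prescribes a negative ratio of Q and W, and
    the two second order inequalities allow this only for Q = W = 0.\<close>
  have qw: "hQ F = hW F"
  proof (rule ccontr)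
    assume ne: "hQ F \<noteq> hW F"
    have "(3*hQ F+2*hW F)*(4*hQ F+6*hW F) = 0" by (rule axis3_rigid(5)[OF ne c])
    then have "3*hQ F+2*hW F = 0 \<or> 4*hQ F+6*hW F = 0" by simp
    then have "hQ F = 0 \<and> hW F = 0" using q1 q2 by linarith
    then show False using ne by simp
  qed
  show ?thesis
  proof (cases "hA F = 0 \<and> hC F = 0")
    case True
    then have z: "hA F = 0" "hB F = 0" "hC F = 0" "hD F = 0" using AB by auto
    \<comment> \<open>A scalar \<open>d2\<close> fixes the length of the weight 4 vector (P + Q/4,
      U). Turning it to the direction of (5Q/4, 0) gives P = Q.\<close>
    have r: "(hP F + hQ F/4)^2 + (hU F)^2 = (5*hQ F/4)^2"
      using c(5) z qw by (simp add: field_simps power2_eq_square)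
    show ?thesis
    proof (cases "hQ F = 0")
      case True
      then have "hP F = 0" "hU F = 0" using r by (simp_all add: sum_power2_eq_zero_iff)
      then have "cubic (rot4 (rotz 0) F)" using True z qw uv unfolding rotz_0 rot4_one by (simp add: cubic_def)
      then show ?thesis by blast
    next
      case False
      then obtain t where t: "hP F + hQ F/4 = 5*hQ F/4 * cos (4*t)" "hU F = 5*hQ F/4 * sin (4*t)"
        using exists_angle_multiple[OF _ r, of 4] by auto
      let ?G = "rot4 (rotz t) F"
      have odd: "hA ?G = 0" "hB ?G = 0" "hC ?G = 0" "hD ?G = 0" unfolding rotz_params z by simp_all
      have Q: "hQ ?G = hQ F" "hW ?G = hQ F" unfolding rotz_params by (simp_all add: qw uv cos_squared_eq
          algebra_simps)
      have "hU ?G = hU F * cos (4*t) - (hP F + hQ F/4) * sin (4*t)"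
        unfolding rotz_params uv qw cos_sin_multiples by (simp add: field_simps)
      then have U: "hU ?G = 0" unfolding t by simp
      have V: "hV ?G = - hU ?G" unfolding rotz_params using uv qw by (simp add: algebra_simps)
      have "hP ?G + hQ F/4 * (cos t ^ 2 + sin t ^2)^2 = (hP F + hQ F/4) * cos (4*t) + hU F * sin (4*t)"
        unfolding rotz_params uv qw cos_sin_multiples by (simp add: field_simps power2_eq_square power4_eq_xxxx
            del: sin_cos_squared_add sin_cos_squared_add2 sin_cos_squared_add3)
      also have "\<dots> = 5*hQ F/4 * ((cos (4*t))^2 + (sin (4*t))^2)" unfolding t by (simp add: field_simps
          power2_eq_square del: sin_cos_squared_add sin_cos_squared_add2 sin_cos_squared_add3)
      finally have "hP ?G = hQ F" by simp
      then have "cubic ?G" using odd Q U V by (simp add: cubic_def)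
      then show ?thesis by blast
    qed
  next
    case False
    \<comment> \<open>Here the third axis is a threefold axis of a cubic form; the maximality of the
      absolute value has to exclude it.\<close>
    let ?s = "(hA F)^2 + (hC F)^2"
    have s: "?s \<noteq> 0" using False by (simp add: sum_power2_eq_zero_iff)
    have "?s * (4*hP F + hQ F) = 0" "?s * hU F = 0" using c(2,3) qw by algebra+
    then have pu: "hQ F = - 4 * hP F" "hU F = 0" using s by auto
    have s50: "?s = 50 * (hP F)^2" using c(5) unfolding qw[symmetric] pu by (simp add: algebra_simps power2_eq_square)
    have p: "hP F > 0" using q1 s50 s unfolding qw[symmetric] pu(1) by auto
    \<comment> \<open>The negative sign makes the half-plane through \<open>?f\<close> and the third
      axis contain a fourfold axis on the upper side.\<close>
    define r where "r = - (5 * sqrt 2 * hP F)"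
    have r: "r \<noteq> 0" "(hA F)^2 + (hC F)^2 = r^2" using s50 p by (simp_all add: r_def power_mult_distrib)
    obtain t where t: "hA F = r * cos (3*t)" "hC F = r * sin (3*t)"
      using exists_angle_multiple[OF r, of 3] by auto
    let ?f = "cos t *\<^sub>R ax 1 + sin t *\<^sub>R ax 2"
    have ff: "F ?f ?f ?f ?f = 3 * hP F * ((cos t)\<^sup>2 + (sin t)\<^sup>2)^2"
      "F ?f ?f ?f (ax 3) = hA F * cos (3*t) + hC F * sin (3*t)"
      "F ?f ?f (ax 3) (ax 3) = - 4 * hP F * ((cos t)\<^sup>2 + (sin t)\<^sup>2)"
      "F ?f (ax 3) (ax 3) (ax 3) = 0"
      unfolding ml comps AB pu uv qw[symmetric] cos_sin_multiples
      by (simp_all add: algebra_simps power2_eq_square power3_eq_cube power4_eq_xxxx del: sin_cos_squared_add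
          sin_cos_squared_add2 sin_cos_squared_add3)
    have f3: "F ?f ?f ?f (ax 3) = r * ((cos (3*t))^2 + (sin (3*t))^2)"
      unfolding ff t by (simp add: algebra_simps power2_eq_square del: sin_cos_squared_add sin_cos_squared_add2
          sin_cos_squared_add3)
    \<comment> \<open>This vector of length \<open>sqrt 3\<close> points along that fourfold axis.
      There the quartic has absolute value 12 P on the unit sphere, while the third axis gives only
      8 P.\<close>
    let ?x = "sqrt 2 *\<^sub>R ?f + ax 3"
    have "F ?x ?x ?x ?x = sqrt 2 ^4 * F ?f ?f ?f ?f + 4 * sqrt 2^3 * F ?f ?f ?f (ax 3) + 6 * sqrt 2^2 * F ?f ?f
        (ax 3) (ax 3)
       + 4 * sqrt 2 * F ?f (ax 3) (ax 3) (ax 3) + F (ax 3) (ax 3) (ax 3) (ax 3)"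
      by (rule quartic_binomial)
    also have "\<dots> = - 108 * hP F"
    proof -
      have "sqrt 2 ^ 4 = (4::real)" "sqrt 2 ^ 3 * sqrt 2 = (4::real)" "sqrt 2 ^ 2 = (2::real)"
        by (simp_all add: power4_eq_xxxx power3_eq_cube)
      then show ?thesis unfolding ff(1,3,4) f3 comps pu qw[symmetric] r_def by (simp add: algebra_simps)
    qed
    finally have "\<bar>F ?x ?x ?x ?x\<bar> = 108 * hP F" using p by simp
    moreover have "?x \<bullet> ?x = 2 * ((cos t)\<^sup>2 + (sin t)\<^sup>2) + 1"
      unfolding inner_add_left inner_add_right inner_scaleR_left inner_scaleR_right ip
      by (simp add: algebra_simps power2_eq_square del: sin_cos_squared_add sin_cos_squared_add2 sin_cos_squared_add3)
    then have "?x \<bullet> ?x = 3" by simp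
    ultimately have "108 * hP F \<le> 8 * hP F * 9" using bd[of ?x] unfolding qw[symmetric] pu by simp
    then show ?thesis using p by simp
  qed
qed

end

section \<open>Symmetry groups of forms, and the cubic frame of a form with isotropic
  \<open>dten\<close>\<close>

definition fsym :: "form4 \<Rightarrow> (real^3^3) set" where
  "fsym F = {g \<in> SO3. rot4 g F = F}"

lemma rot4_fix_conj:
  assumes "g \<in> SO3"
  shows "rot4 (cj g h) (rot4 g F) = rot4 g F \<longleftrightarrow> rot4 h F = F"
proof -
  have "rot4 (cj g h) (rot4 g F) = rot4 (g ** h ** (transpose g ** g)) F"
    by (simp add: rot4_rot4 cj_def matrix_mul_assoc)
  also have "\<dots> = rot4 g (rot4 h F)" using assms by (simp add: SO3_orth rot4_rot4)
  finally show ?thesis using assms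
    by (metis SO3_orth(1) rot4_one rot4_rot4)
qed

lemma fsym_rot4:
  assumes g: "g \<in> SO3"
  shows "fsym (rot4 g F) = cj g ` fsym F"
proof
  show "cj g ` fsym F \<subseteq> fsym (rot4 g F)"
    using g by (auto simp: fsym_def cj_SO3 rot4_fix_conj)
  show "fsym (rot4 g F) \<subseteq> cj g ` fsym F"
  proof
    fix h assume h: "h \<in> fsym (rot4 g F)"
    define k where "k = cj (transpose g) h"
    have hk: "h = cj g k" using g by (simp add: k_def cj_inv)
    have "k \<in> SO3" using h g by (simp add: k_def cj_SO3 SO3_transpose fsym_def)
    then have "k \<in> fsym F" using h g by (simp add: fsym_def hk rot4_fix_conj)
    then show "h \<in> cj g ` fsym F" using hk by auto
  qed
qed

lemma harmonic_uminus:
  assumes "harmonic F"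
  shows "harmonic (\<lambda>x y z w. - F x y z w)"
proof -
  interpret harmonic F by fact
  show ?thesis
  proof (rule harmonic.intro)
    fix x y z w
    show "linear (\<lambda>x'. - F x' y z w)" using lin1 by (simp add: linear_compose_neg)
    show "- F x y z w = - F y x z w" "- F x y z w = - F x z y w" "- F x y z w = - F x y w z"
      by (simp_all only: sym12 sym23 sym34)
    show "(\<Sum>k\<in>UNIV. - F (ax k) (ax k) z w) = 0" using tr12 by (simp add: sum_negf)
  qed
qed

lemma exists_frame:
  fixes n :: "real^3"
  assumes "norm n = 1"
  shows "\<exists>g\<in>SO3. g $ 3 = n"
proof -
  have "2 \<le> CARD(3)" by simp
  then obtain A where A: "rotation_matrix A" "A *v ax 3 = n"
    using rotation_matrix_exists_basis[OF _ assms, of 3] by blast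
  then have "transpose A \<in> SO3" using SO3_transpose[of A] by (simp add: SO3_def)
  moreover have "transpose A $ 3 = n" using A(2) transpose_ax[of "transpose A" 3] by simp
  ultimately show ?thesis by blast
qed

lemma SO3_inner: "g \<in> SO3 \<Longrightarrow> (transpose g *v x) \<bullet> (transpose g *v y) = x \<bullet> y"
  by (metis SO3_orth(2) dot_lmul_matrix matrix_vector_mul_assoc matrix_vector_mul_lid transpose_matrix_vector
      transpose_transpose)

text \<open>A maximizer of |F(x,x,x,x)| on the sphere is moved to the third axis, and a turn about
  this axis makes V = -U; these are the hypotheses of \<open>max_frame_cubic\<close>. A negative
  value at the maximizer is handled by passing to -F.\<close>

lemma cubic_frame:
  assumes "harmonic F" and D: "dten F = mat d"
  shows "\<exists>g\<in>SO3. cubic (rot4 g F)"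
proof -
  have main: "\<exists>g\<in>SO3. cubic (rot4 g F)"
    if "harmonic F" and D: "dten F = mat d" and n: "norm n = 1" and bd: "\<And>x. \<bar>F x x x x\<bar> \<le> F n n n n * (x \<bullet>
        x)\<^sup>2" for F n
  proof -
    interpret harmonic F by fact
    obtain g where g: "g \<in> SO3" "g $ 3 = n" using exists_frame[OF n] by blast
    interpret G: harmonic "rot4 g F" by (rule harmonic_rot4[OF harmonic_axioms g(1)])
    obtain t where t: "((cos t)\<^sup>2 - (sin t)\<^sup>2) * (hU (rot4 g F) + hV (rot4 g F))
         + cos t * sin t * (hW (rot4 g F) - hQ (rot4 g F)) = 0"
      using exists_angle_double by blast
    define k where "k = rotz t ** g"
    have k: "k \<in> SO3" using g rotz_SO3 by (simp add: k_def SO3_mult)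
    have kF: "rot4 k F = rot4 (rotz t) (rot4 g F)" by (simp add: k_def rot4_rot4)
    interpret K: harmonic "rot4 k F" by (rule harmonic_rot4[OF harmonic_axioms k])
    have "hU (rot4 k F) + hV (rot4 k F) = ((cos t)\<^sup>2 + (sin t)\<^sup>2) * (((cos t)\<^sup>2 - (sin t)\<^sup>2) * (hU (rot4 g F) +
        hV (rot4 g F))
         + cos t * sin t * (hW (rot4 g F) - hQ (rot4 g F)))"
      unfolding kF G.rotz_params by algebra
    then have uv: "hV (rot4 k F) = - hU (rot4 k F)" using t by simp
    have "k $ 3 = n" using g(2) by (simp add: k_def vec_eq_iff mm3 rotz_entry)
    \<comment> \<open>\<open>comps(81)\<close> is the component with all four indices equal to
      3.\<close>
    then have n3: "F n n n n = - hQ (rot4 k F) - hW (rot4 k F)"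
      using K.comps(81) by (simp add: rot4_def transpose_ax)
    have "\<exists>t. cubic (rot4 (rotz t) (rot4 k F))"
    proof (rule K.max_frame_cubic[OF _ uv])
      show "dten (rot4 k F) = mat d" using D k by (simp add: dten_rot4[OF harmonic_axioms] cj_mat)
      show "\<bar>rot4 k F x x x x\<bar> \<le> (- hQ (rot4 k F) - hW (rot4 k F)) * (x \<bullet> x)\<^sup>2" for x
        using bd[of "transpose k *v x"] k unfolding n3[symmetric] by (simp add: rot4_def SO3_inner)
    qed
    then show ?thesis by (metis rot4_rot4 SO3_mult rotz_SO3 k)
  qed
  interpret harmonic F by fact
  have cont: "continuous_on S (\<lambda>x. F x x x x)" for S
    by (subst expand) (intro continuous_intros)
  have "compact (sphere 0 1 :: (real^3) set)" "sphere 0 1 \<noteq> ({} :: (real^3) set)" by auto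
  then obtain n where n: "n \<in> sphere (0::real^3) 1" "\<And>x. x \<in> sphere 0 1 \<Longrightarrow> \<bar>F x x x x\<bar> \<le> \<bar>F n n n n\<bar>"
    using continuous_attains_sup[of "sphere (0::real^3) 1" "\<lambda>x. \<bar>F x x x x\<bar>"] cont continuous_on_rabs by blast
  have bd: "\<bar>F x x x x\<bar> \<le> \<bar>F n n n n\<bar> * (x \<bullet> x)\<^sup>2" for x
  proof (cases "x = 0")
    case True
    then show ?thesis using scl(1)[of 0 x] by simp
  next
    case False
    let ?y = "x /\<^sub>R norm x"
    have "\<bar>F ?y ?y ?y ?y\<bar> \<le> \<bar>F n n n n\<bar>" using False by (intro n(2)) simp
    moreover have "F ?y ?y ?y ?y = F x x x x / norm x ^ 4" unfolding scl
      using False by (simp add: field_simps power4_eq_xxxx)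
    moreover have "norm x ^ 4 = (x \<bullet> x)\<^sup>2" by (simp add: dot_square_norm flip: power_mult)
    ultimately have "\<bar>F x x x x / (x \<bullet> x)\<^sup>2\<bar> \<le> \<bar>F n n n n\<bar>" by simp
    moreover have "(x \<bullet> x)\<^sup>2 > 0" using False by simp
    ultimately show ?thesis by (simp add: abs_divide pos_divide_le_eq)
  qed
  show ?thesis
  proof (cases "F n n n n \<ge> 0")
    case True
    then show ?thesis using main[OF harmonic_axioms D, of n] n(1) bd by simp
  next
    case False
    have "dten (\<lambda>x y z w. - F x y z w) = mat d" using D by (simp add: dten_def)
    then obtain g where g: "g \<in> SO3" "cubic (rot4 g (\<lambda>x y z w. - F x y z w))"
      using main[OF harmonic_uminus[OF harmonic_axioms], of n] n(1) bd False by auto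
    have "rot4 g (\<lambda>x y z w. - F x y z w) = (\<lambda>x y z w. - rot4 g F x y z w)" by (simp add: rot4_def)
    then have "cubic (rot4 g F)" using g(2)
      by (simp add: cubic_def hP_def hQ_def hW_def hU_def hV_def hA_def hB_def hC_def hD_def)
    then show ?thesis using g(1) by blast
  qed
qed

lemma (in harmonic) cubic_form:
  assumes "cubic F"
  shows "F x y z w = hP F * ((x \<bullet> y) * (z \<bullet> w) + (x \<bullet> z) * (y \<bullet> w) + (x \<bullet> w) * (y \<bullet> z))
     - 5 * hP F * (\<Sum>i\<in>UNIV. x$i * y$i * z$i * w$i)"
  by (subst expand)
     (use assms in \<open>simp add: sum_3 comps cubic_def inner_vec_def algebra_simps\<close>)

lemma rows_inner: "g \<in> SO3 \<Longrightarrow> g $ i \<bullet> g $ j = (if i = j then 1 else 0)"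
  using SO3_inner[of g "ax i" "ax j"] by (simp add: transpose_ax inner_axis_axis)

text \<open>Evaluating the form on a row of a symmetry gives a sum of fourth powers equal to 1. The
  sum of squares is 1 as well, so every entry is 0 or has square 1. Conversely, products of
  different rows vanish entrywise for a signed permutation matrix, so the form is preserved.\<close>

lemma fsym_cubic:
  assumes "harmonic F" "cubic F" "hP F \<noteq> 0"
  shows "fsym F = Oct"
proof -
  interpret harmonic F by fact
  show ?thesis
  proof (intro set_eqI iffI)
    fix g assume "g \<in> fsym F"
    then have g: "g \<in> SO3" "rot4 g F = F" by (simp_all add: fsym_def)
    have "g $ k $ i \<in> {-1, 0, 1}" for k i
    proof -
      have "F (g $ k) (g $ k) (g $ k) (g $ k) = F (ax k) (ax k) (ax k) (ax k)"
      proof -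
        have "rot4 g F (ax k) (ax k) (ax k) (ax k) = F (ax k) (ax k) (ax k) (ax k)" by (simp only: g(2))
        then show ?thesis by (simp add: rot4_def transpose_ax)
      qed
      then have "(\<Sum>i\<in>UNIV. g$k$i * g$k$i * g$k$i * g$k$i) = (\<Sum>i\<in>UNIV. ax k$i * ax k$i * ax k$i * ax k$i)"
        using assms(3) rows_inner[OF g(1), of k k] cubic_form[OF assms(2), of "g $ k" "g $ k" "g $ k" "g $ k"]
          cubic_form[OF assms(2), of "ax k" "ax k" "ax k" "ax k"]
        by (simp add: inner_axis_axis)
      also have "\<dots> = 1" by (simp add: axis_def if_distrib if_distribR sum.delta cong: if_cong)
      finally have 4: "(\<Sum>i\<in>UNIV. g$k$i * g$k$i * g$k$i * g$k$i) = 1" .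
      have 2: "(\<Sum>i\<in>UNIV. g$k$i * g$k$i) = 1"
        using rows_inner[OF g(1), of k k] by (simp add: inner_vec_def)
      have le: "g$k$i * g$k$i \<le> 1" for i
        unfolding 2[symmetric] by (rule member_le_sum) auto
      have "(\<Sum>i\<in>UNIV. g$k$i * g$k$i * (1 - g$k$i * g$k$i)) = 0"
        using 2 4 by (simp add: algebra_simps sum_subtractf)
      then have "\<forall>i\<in>UNIV. g$k$i * g$k$i * (1 - g$k$i * g$k$i) = 0"
        by (subst (asm) sum_nonneg_eq_0_iff) (use le in auto)
      then have "g$k$i = 0 \<or> g$k$i * g$k$i = 1" by auto
      then show ?thesis by (auto simp: square_eq_1_iff)
    qed
    then show "g \<in> Oct" using g(1) by (simp add: Oct_def)
  next
    fix g assume "g \<in> Oct"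
    then have g: "g \<in> SO3" and e: "g $ i $ j \<in> {-1, 0, 1}" for i j by (auto simp: Oct_def)
    have o: "g $ a $ i * g $ b $ i = 0" if "a \<noteq> b" for a b i
    proof -
      have "(\<Sum>k\<in>UNIV. g $ k $ i * g $ k $ i) = 1" using SO3_columns[OF g, of i i] by simp
      then have s: "g$1$i * g$1$i + g$2$i * g$2$i + g$3$i * g$3$i = 1" by (simp add: sum_3)
      have v: "g $ k $ i * g $ k $ i = (if g $ k $ i = 0 then 0 else 1)" for k
        using e[of k i] by auto
      have "g$a$i = 0 \<or> g$b$i = 0" using s that exhaust_3[of a] exhaust_3[of b] unfolding v
        by (auto split: if_splits)
      then show ?thesis by auto
    qed
    note R = rows_inner[OF g]
    have z: "x \<noteq> y \<Longrightarrow> (\<Sum>i\<in>UNIV. g$x$i * g$y$i * g$z$i * g$w$i) = 0"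
      "y \<noteq> z \<Longrightarrow> (\<Sum>i\<in>UNIV. g$x$i * g$y$i * g$z$i * g$w$i) = 0"
      "z \<noteq> w \<Longrightarrow> (\<Sum>i\<in>UNIV. g$x$i * g$y$i * g$z$i * g$w$i) = 0" for x y z w
    proof -
      have a: "p * q * r * t = p * (q * r) * t" "p * q * r * t = p * q * (r * t)" for p q r t :: real by simp_all
      show "x \<noteq> y \<Longrightarrow> (\<Sum>i\<in>UNIV. g$x$i * g$y$i * g$z$i * g$w$i) = 0" by (simp add: o)
      show "y \<noteq> z \<Longrightarrow> (\<Sum>i\<in>UNIV. g$x$i * g$y$i * g$z$i * g$w$i) = 0" unfolding a(1) by (rule sum.neutral, rule
          ballI, subst o[of y z]) simp_all
      show "z \<noteq> w \<Longrightarrow> (\<Sum>i\<in>UNIV. g$x$i * g$y$i * g$z$i * g$w$i) = 0" unfolding a(2) by (rule sum.neutral, rule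
          ballI, subst o[of z w]) simp_all
    qed
    have val: "rot4 g F (ax i) (ax j) (ax k) (ax l) = hP F * ((if i = j then 1 else 0) * (if k = l then 1 else 0)
        + (if i = k then 1 else 0) * (if j = l then 1 else 0) + (if i = l then 1 else 0) * (if j = k then 1 else 0))
        - 5 * hP F * (\<Sum>m\<in>UNIV. g$i$m * g$j$m * g$k$m * g$l$m)" for i j k l
      using cubic_form[OF assms(2), of "g $ i" "g $ j" "g $ k" "g $ l"] by (simp only: rot4_def transpose_ax R)
    have "rot4 g F = F"
    proof (rule harmonic_eqI[OF harmonic_rot4[OF harmonic_axioms g] harmonic_axioms])
      have "hP (rot4 g F) = hP F" "hQ (rot4 g F) = hP F" "hW (rot4 g F) = hP F" "hU (rot4 g F) = 0" "hV (rot4 g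
          F) = 0"
       "hA (rot4 g F) = 0" "hB (rot4 g F) = 0" "hC (rot4 g F) = 0" "hD (rot4 g F) = 0"
        unfolding hP_def[of "rot4 _ _"] hQ_def[of "rot4 _ _"] hW_def[of "rot4 _ _"] hU_def[of "rot4 _ _"]
          hV_def[of "rot4 _ _"] hA_def[of "rot4 _ _"] hB_def[of "rot4 _ _"] hC_def[of "rot4 _ _"] hD_def[of
              "rot4 _ _"]
        by (simp_all add: val z)
      then show "hP (rot4 g F) = hP F" "hQ (rot4 g F) = hQ F" "hW (rot4 g F) = hW F" "hU (rot4 g F) = hU F" "hV
          (rot4 g F) = hV F"
       "hA (rot4 g F) = hA F" "hB (rot4 g F) = hB F" "hC (rot4 g F) = hC F" "hD (rot4 g F) = hD F"
        using assms(2) by (simp_all add: cubic_def)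
    qed
    then show "g \<in> fsym F" using g by (simp add: fsym_def)
  qed
qed

section \<open>Symmetry groups of families of symmetric matrices\<close>

lemma SO3_cols:
  assumes "g \<in> SO3"
  shows "g$1$1 * g$1$1 + g$2$1 * g$2$1 + g$3$1 * g$3$1 = 1" "g$1$2 * g$1$2 + g$2$2 * g$2$2 + g$3$2 * g$3$2 = 1"
    "g$1$3 * g$1$3 + g$2$3 * g$2$3 + g$3$3 * g$3$3 = 1" "g$1$1 * g$1$2 + g$2$1 * g$2$2 + g$3$1 * g$3$2 = 0"
  using SO3_columns[OF assms, of 1 1] SO3_columns[OF assms, of 2 2] SO3_columns[OF assms, of 3 3] SO3_columns[OF
      assms, of 1 2]
  by (simp_all add: sum_3)

lemma SO3_fix_ax3:
  assumes g: "g \<in> SO3" and 0: "g$1$3 = 0" "g$2$3 = 0" "g$3$3 = 1"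
  shows "\<exists>t. g = rotz t"
proof -
  have "g$3$1 * g$3$1 + g$3$2 * g$3$2 + g$3$3 * g$3$3 = 1"
    using rows_inner[OF g, of 3 3] by (simp add: inner_vec_def sum_3)
  then have r: "g$3$1 = 0" "g$3$2 = 0" using 0 by (simp_all add: sum_squares_eq_zero_iff)
  note c = SO3_cols[OF g]
  have d: "g$1$1 * g$2$2 - g$1$2 * g$2$1 = 1" using SO3_orth(3)[OF g] by (simp add: det_3 r 0)
  obtain t where t: "g$1$1 = cos t" "g$2$1 = sin t"
    using sincos_total_2pi[of "g$1$1" "g$2$1"] c(1) r by (auto simp: power2_eq_square)
  have "g$2$2 = g$1$1" "g$1$2 = - g$2$1" using c(1,2,4) d r by algebra+
  then show ?thesis using t r 0 by (intro exI[of _ t]) (simp add: mat3_eq_iff rotz_entry)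
qed

text \<open>Euler's theorem: in odd dimension det(g - 1) = det(1 - transpose g) = - det(g - 1), so a
  rotation fixes a nonzero vector, which is then taken as third axis.\<close>

lemma rotation_about_axis:
  assumes g: "g \<in> SO3"
  shows "\<exists>h\<in>SO3. \<exists>t. g = cj h (rotz t)"
proof -
  have "g ** (A - B) = g ** A - g ** B" for A B :: "real^3^3"
    by (simp add: vec_eq_iff mm3 algebra_simps)
  then have "g - mat 1 = g ** (mat 1 - transpose g)"
    using SO3_orth[OF g] by simp
  then have "det (g - mat 1) = det (mat 1 - transpose g)" using SO3_orth(3)[OF g] by (metis det_mul mult_1)
  also have "\<dots> = - det (g - mat 1)" by (simp add: det_3 mat3_entry transpose_entry algebra_simps)
  finally have "det (g - mat 1) = 0" by simp
  then obtain x where x: "x \<noteq> 0" "(g - mat 1) *v x = 0"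
    by (metis invertible_det_nz invertible_left_inverse matrix_left_invertible_ker)
  define n where "n = x /\<^sub>R norm x"
  have n: "norm n = 1" "g *v n = n"
    using x by (simp_all add: n_def matrix_vector_mult_diff_rdistrib matrix_vector_mult_scaleR)
  obtain k where k: "k \<in> SO3" "k $ 3 = n" using exists_frame[OF n(1)] by blast
  have kn: "transpose k *v ax 3 = n" using k(2) by (simp add: transpose_ax)
  have "cj k g *v ax 3 = ax 3"
  proof -
    have "cj k g *v ax 3 = k *v (g *v (transpose k *v ax 3))" by (simp add: cj_def matrix_vector_mul_assoc
        matrix_mul_assoc)
    also have "\<dots> = (k ** transpose k) *v ax 3" using n kn by (simp flip: matrix_vector_mul_assoc)
    finally show ?thesis using SO3_orth[OF k(1)] by simp
  qed
  then have "cj k g $ i $ 3 = ax 3 $ i" for i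
    using transpose_ax[of "transpose (cj k g)" 3] by (simp add: vec_eq_iff transpose_def)
  then have "cj k g $1$3 = 0" "cj k g $2$3 = 0" "cj k g $3$3 = 1" by (simp_all add: axis_def)
  then obtain t where "cj k g = rotz t" using SO3_fix_ax3[OF cj_SO3[OF k(1) g]] by blast
  then have "g = cj (transpose k) (rotz t)" using cj_inv(1)[OF k(1), of g] by simp
  then show ?thesis using SO3_transpose[OF k(1)] by blast
qed

lemma rxpi_rxpi: "rxpi ** rxpi = mat 1"
  by (simp add: m3)

lemma cj_rxpi_entry: "cj rxpi M $ i $ j = rxpi$i$i * rxpi$j$j * M$i$j"
  using exhaust_3[of i] exhaust_3[of j] by (auto simp: cj_entry sum_3 rxpi_entry)

lemma O2_SO3: "O2 \<subseteq> SO3"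
  by (auto simp: O2_def rotz_SO3 rxpi_SO3 SO3_mult)

lemma axis3_fixed_by_O2:
  assumes "diag3 M" "M$1$1 = M$2$2" "g \<in> O2"
  shows "cj g M = M"
proof -
  have z: "cj (rotz t) M = M" for t
    using assms(1,2) unfolding mat3_eq_iff cj_rotz_entry diag3_def
    by (simp add: cos_squared_eq algebra_simps)
  moreover have "cj rxpi M = M"
    using assms(1) unfolding mat3_eq_iff cj_rxpi_entry diag3_def by (simp add: rxpi_entry)
  ultimately show ?thesis using assms(3) by (auto simp: O2_def simp flip: cj_cj)
qed

text \<open>The rotation turns (M11 - M22, 2 M12) by the angle 2t and (M13, M23) by the angle t. For
  \<open>sin t \<noteq> 0\<close> neither turn fixes a nonzero vector.\<close>

lemma rotz_fixes_imp_axis3: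
  assumes "cj (rotz t) M = M" "sin t \<noteq> 0" and s: "transpose M = M"
  shows "diag3 M" "M$1$1 = M$2$2"
proof -
  have s: "M$2$1 = M$1$2" "M$3$1 = M$1$3" "M$3$2 = M$2$3"
    using s by (metis transpose_entry)+
  have "cj (rotz t) M$1$1 = M$1$1" "cj (rotz t) M$1$2 = M$1$2" "cj (rotz t) M$1$3 = M$1$3" "cj (rotz t) M$2$3 =
      M$2$3"
    using assms(1) by simp_all
  note e = this[unfolded cj_rotz_entry s]
  define x y where "x = M$1$1 - M$2$2" and "y = 2 * M$1$2"
  have "sin t * (cos t * y + sin t * x) = 0" "sin t * (cos t * x - sin t * y) = 0"
    using e(1,2)[unfolded cos_squared_eq] unfolding x_def y_def by (simp_all add: algebra_simps power2_eq_square)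
  then have xy: "cos t * y + sin t * x = 0" "cos t * x - sin t * y = 0" using assms(2) by simp_all
  have "(cos t * cos t + sin t * sin t) * x = cos t * (cos t * x - sin t * y) + sin t * (cos t * y + sin t * x)"
    "(cos t * cos t + sin t * sin t) * y = cos t * (cos t * y + sin t * x) - sin t * (cos t * x - sin t * y)"
    by (simp_all only: algebra_simps)
  then have 1: "x = 0" "y = 0" unfolding xy sc1 by simp_all
  have f: "sin t * M$2$3 = (cos t - 1) * M$1$3" "sin t * M$1$3 = (1 - cos t) * M$2$3"
    using e(3,4) by (simp_all add: algebra_simps)
  have "(sin t * sin t + (1 - cos t) * (1 - cos t)) * M$1$3 =
    sin t * (sin t * M$1$3 - (1 - cos t) * M$2$3) + (1 - cos t) * (sin t * M$2$3 - (cos t - 1) * M$1$3)"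
    "(sin t * sin t + (1 - cos t) * (1 - cos t)) * M$2$3 =
    sin t * (sin t * M$2$3 - (cos t - 1) * M$1$3) - (1 - cos t) * (sin t * M$1$3 - (1 - cos t) * M$2$3)"
    by (simp_all only: algebra_simps)
  then have 2: "M$1$3 = 0" "M$2$3 = 0" unfolding f using assms(2) by simp_all
  show "M$1$1 = M$2$2" using 1 by (simp add: x_def)
  show "diag3 M" using 1 2 s by (simp add: diag3_def y_def)
qed

lemma SO3_block_O2:
  assumes g: "g \<in> SO3" and 0: "g$1$3 = 0" "g$2$3 = 0" "g$3$3 = -1"
  shows "\<exists>t. g = rotz t ** rxpi"
proof -
  have "\<exists>t. g ** rxpi = rotz t"
    by (rule SO3_fix_ax3[OF SO3_mult[OF g rxpi_SO3]]) (simp_all add: mm3 rxpi_entry 0)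
  then obtain t where "g ** rxpi = rotz t" ..
  then have "g = rotz t ** rxpi" by (metis matrix_mul_assoc matrix_mul_rid rxpi_rxpi)
  then show ?thesis by blast
qed

text \<open>A matrix with simple third eigenvalue determines the third axis, so every rotation
  commuting with it preserves this axis up to sign.\<close>

lemma msym_O2:
  assumes "\<And>M. M \<in> \<F> \<Longrightarrow> diag3 M \<and> M$1$1 = M$2$2" and "M0 \<in> \<F>" "M0$1$1 \<noteq> M0$3$3"
  shows "msym \<F> = O2"
proof
  show "O2 \<subseteq> msym \<F>" using assms(1) axis3_fixed_by_O2 O2_SO3 by (auto simp: msym_def)
  show "msym \<F> \<subseteq> O2"
  proof
    fix g assume "g \<in> msym \<F>"
    then have g: "g \<in> SO3" "cj g M0 = M0" using assms(2) by (auto simp: msym_def)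
    then have c: "g ** M0 = M0 ** g" using msym_cj_commute by blast
    have M: "diag3 M0" "M0$1$1 = M0$2$2" using assms(1,2) by auto
    have "(g ** M0)$1$3 = (M0 ** g)$1$3" "(g ** M0)$2$3 = (M0 ** g)$2$3" using c by simp_all
    then have 0: "g$1$3 = 0" "g$2$3 = 0" using M assms(3) unfolding mm3 diag3_def by auto
    then have "g$3$3 * g$3$3 = 1" using SO3_cols(3)[OF g(1)] by simp
    then consider "g$3$3 = 1" | "g$3$3 = -1" using square_eq_1_iff by blast
    then show "g \<in> O2"
    proof cases
      case 1
      then show ?thesis using SO3_fix_ax3[OF g(1) 0] by (auto simp: O2_def)
    next
      case 2
      then show ?thesis using SO3_block_O2[OF g(1) 0] by (auto simp: O2_def)
    qed
  qed
qed

lemma msym_scalar: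
  assumes "\<And>M. M \<in> \<F> \<Longrightarrow> \<exists>c. M = mat c"
  shows "msym \<F> = SO3"
  using assms cj_mat unfolding msym_def by fastforce

text \<open>A cyclic permutation of the axes: it lies outside \<open>O2\<close> and gives an element
  of trace 0 in \<open>Oct\<close>.\<close>

lemma exists_cyclic: "\<exists>g\<in>SO3. g$1$3 = 1 \<and> g$1$1 = 0 \<and> g$2$2 = 0 \<and> g$3$3 = 0 \<and> (\<forall>i j. g$i$j \<in> {-1, 0, 1})"
proof -
  define g :: "real^3^3" where "g = vector [vector [0,0,1], vector [1,0,0], vector [0,1,0]]"
  have e: "g$1$1 = 0" "g$1$2 = 0" "g$1$3 = 1" "g$2$1 = 1" "g$2$2 = 0" "g$2$3 = 0" "g$3$1 = 0" "g$3$2 = 1" "g$3$3 = 0"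
    by (simp_all add: g_def)
  have "g \<in> SO3" by (rule SO3_I) (simp_all add: det_3 mat3_eq_iff mm3 mat3_entry transpose_entry e)
  then show ?thesis by (rule bexI[rotated]) (simp add: forall_3 e)
qed

lemma O2_neq_SO3: "O2 \<noteq> SO3"
proof -
  have "h$1$3 = 0" if "h \<in> O2" for h
    using that by (auto simp: O2_def mm3 rotz_entry rxpi_entry)
  then show ?thesis using exists_cyclic by force
qed

lemma in_class_O2_frame:
  assumes s: "\<And>M. M \<in> \<F> \<Longrightarrow> transpose M = M" and c: "in_class (msym \<F>) O2"
  shows "\<exists>g\<in>SO3. (\<forall>M\<in>\<F>. diag3 (cj g M) \<and> cj g M$1$1 = cj g M$2$2) \<and> (\<exists>M\<in>\<F>. cj g M$1$1 \<noteq> cj g M$3$3)"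
proof -
  obtain h where h: "h \<in> SO3" "msym \<F> = cj h ` O2" using c by (auto simp: in_class_cj_def)
  define g where "g = transpose h"
  have g: "g \<in> SO3" using h by (simp add: g_def SO3_transpose)
  have m: "msym (cj g ` \<F>) = O2"
    unfolding msym_image[OF g] h(2) using h(1) by (simp add: image_image g_def cj_inv)
  have d: "diag3 (cj g M) \<and> cj g M$1$1 = cj g M$2$2" if "M \<in> \<F>" for M
  proof -
    \<comment> \<open>The quarter turn lies in \<open>O2\<close> and has nonzero sine, so it already
      forces the third axis on every member.\<close>
    have "rotz (pi/2) \<in> msym (cj g ` \<F>)" unfolding m by (auto simp: O2_def)
    then have "cj (rotz (pi/2)) (cj g M) = cj g M" using that by (simp add: msym_def)
    then show ?thesis using rotz_fixes_imp_axis3[of "pi/2" "cj g M"] s[OF that] by (simp add: cj_transpose)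
  qed
  moreover have "\<exists>M\<in>\<F>. cj g M$1$1 \<noteq> cj g M$3$3"
  proof (rule ccontr)
    assume "\<not> ?thesis"
    then have "\<exists>c. M = mat c" if "M \<in> cj g ` \<F>" for M using that d mat_scalar_iff by auto
    then show False using msym_scalar[of "cj g ` \<F>"] m O2_neq_SO3 by blast
  qed
  ultimately show ?thesis using g by blast
qed

lemma coaxial_frame:
  assumes "coaxial \<F>"
  shows "\<exists>g\<in>SO3. \<forall>M\<in>\<F>. diag3 (cj g M) \<and> cj g M$1$1 = cj g M$2$2"
proof -
  obtain n where n: "n \<noteq> 0" "\<And>M. M \<in> \<F> \<Longrightarrow> axial n M" using assms by (auto simp: coaxial_def)
  obtain g where g: "g \<in> SO3" "g $ 3 = n /\<^sub>R norm n" using exists_frame[of "n /\<^sub>R norm n"] n by auto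
  have "n = norm n *\<^sub>R (transpose g *v ax 3)" using g(2) n(1) by (simp add: transpose_ax)
  then have "g *v n = norm n *\<^sub>R ((g ** transpose g) *v ax 3)"
    by (metis matrix_vector_mul_assoc matrix_vector_mult_scaleR)
  then have gn: "g *v n = norm n *\<^sub>R ax 3" using SO3_orth[OF g(1)] by simp
  have "diag3 (cj g M) \<and> cj g M$1$1 = cj g M$2$2" if "M \<in> \<F>" for M
    using axial_cj[OF g(1) n(2)[OF that]] unfolding gn axial_def
    by (auto simp: diag3_def outer_def mat3_entry axis_def)
  then show ?thesis using g(1) by blast
qed

lemma axis3_coaxial:
  assumes "g \<in> SO3" "\<And>M. M \<in> \<F> \<Longrightarrow> diag3 (cj g M) \<and> cj g M$1$1 = cj g M$2$2"
  shows "coaxial \<F>"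
proof -
  have "coaxial (cj g ` \<F>)" unfolding coaxial_def
    by (rule exI[of _ "ax 3"]) (use assms(2) axial_ax(3) in auto)
  then show ?thesis using assms(1) by (simp add: coaxial_cj_iff)
qed

section \<open>Symmetry groups made of half-turns\<close>

lemma rotz_pi_square: "rotz pi ** rotz pi = mat 1"
  by (simp add: m3)

text \<open>A rotation other than the identity and the half-turns, if it fixes the family, makes its
  own axis a common axis of all members.\<close>

lemma msym_half_turns:
  assumes s: "\<And>M. M \<in> \<F> \<Longrightarrow> transpose M = M" and nc: "\<not> coaxial \<F>" and g: "g \<in> msym \<F>"
  shows "g = mat 1 \<or> (\<exists>h\<in>SO3. g = cj h (rotz pi))"
proof -
  have gs: "g \<in> SO3" using g by (simp add: msym_def)
  obtain h t where h: "h \<in> SO3" "g = cj h (rotz t)" using rotation_about_axis[OF gs] by blast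
  have "sin t = 0"
  proof (rule ccontr)
    assume t: "sin t \<noteq> 0"
    have hT: "transpose h \<in> SO3" using h by (simp add: SO3_transpose)
    have "diag3 (cj (transpose h) M) \<and> cj (transpose h) M$1$1 = cj (transpose h) M$2$2" if "M \<in> \<F>" for M
    proof -
      have "cj (cj h (rotz t)) (cj h (cj (transpose h) M)) = cj h (cj (transpose h) M)"
        using g that h by (simp add: msym_def cj_inv)
      then have "cj (rotz t) (cj (transpose h) M) = cj (transpose h) M" using h(1) by (simp add: cj_fix_cj)
      then show ?thesis using rotz_fixes_imp_axis3[OF _ t] s[OF that] by (simp add: cj_transpose)
    qed
    then show False using nc axis3_coaxial[OF hT] by blast
  qed
  then have "cos t = 1 \<or> cos t = -1" by (metis sin_zero_abs_cos_one abs_eq_iff abs_one)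
  then have "rotz t = mat 1 \<or> rotz t = rotz pi" using \<open>sin t = 0\<close> by (simp add: mat3_eq_iff rotz_entry mat3_entry)
  then show ?thesis using h cj_mat[OF h(1)] by auto
qed

lemma in_class_refl: "in_class G G"
proof -
  have "cj (mat 1) = id" by (simp add: fun_eq_iff)
  then have "G = cj (mat 1) ` G" by simp
  then show ?thesis using SO3_one unfolding in_class_cj_def by blast
qed

lemma cj_rotz_rotz_rxpi: "cj (rotz a) (rotz t ** rxpi) = rotz (2 * a + t) ** rxpi"
proof -
  have "rxpi ** rotz (- a) = rotz a ** rxpi" by (simp add: m3)
  then have "cj (rotz a) (rotz t ** rxpi) = rotz a ** rotz t ** (rotz a ** rxpi)"
    by (simp add: cj_def transpose_rotz matrix_mul_assoc flip: matrix_mul_assoc[of _ rxpi])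
  also have "\<dots> = rotz (a + t + a) ** rxpi" by (simp add: matrix_mul_assoc rotz_add)
  finally show ?thesis by (simp add: algebra_simps)
qed

lemma cj_rotz_rotz: "cj (rotz a) (rotz t) = rotz t"
  by (simp add: cj_def transpose_rotz rotz_add)

lemma involution_commute:
  fixes g h :: "real^3^3"
  assumes "g ** g = mat 1" "h ** h = mat 1" "(g ** h) ** (g ** h) = mat 1"
  shows "g ** h = h ** g"
proof -
  have "h ** g = (g ** g) ** h ** g ** (h ** h)" using assms by simp
  also have "\<dots> = g ** ((g ** h) ** (g ** h)) ** h" by (simp only: matrix_mul_assoc)
  finally show ?thesis using assms(3) by simp
qed

lemma commute_rotz_pi_entries:
  assumes "g ** rotz pi = rotz pi ** g"
  shows "g$1$3 = 0" "g$2$3 = 0" "g$3$1 = 0" "g$3$2 = 0"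
proof -
  have "(g ** rotz pi)$i$j = (rotz pi ** g)$i$j" for i j using assms by simp
  note e = this[unfolded mm3 rotz_entry]
  show "g$1$3 = 0" "g$2$3 = 0" "g$3$1 = 0" "g$3$2 = 0"
    using e[of 1 3] e[of 2 3] e[of 3 1] e[of 3 2] by (simp_all add: rotz_entry)
qed

text \<open>All elements are involutions, so the group is abelian. Elements commuting with the
  half-turn about the third axis preserve that axis; any further element is a half-turn about a
  perpendicular axis, which can be turned onto the first axis. Commuting with both leaves diagonal
  matrices, that is, \<open>DD 2\<close>.\<close>

lemma msym_noncoaxial_class:
  assumes s: "\<And>M. M \<in> \<F> \<Longrightarrow> transpose M = M" and nc: "\<not> coaxial \<F>"
  shows "in_class (msym \<F>) (DD 2) \<or> in_class (msym \<F>) (ZZ 2) \<or> msym \<F> = trivgrp"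
proof (cases "msym \<F> \<subseteq> {mat 1}")
  case True
  then show ?thesis using msym_one[of \<F>] by (auto simp: trivgrp_def)
next
  case False
  then obtain g where g: "g \<in> msym \<F>" "g \<noteq> mat 1" by blast
  then obtain h where h: "h \<in> SO3" "g = cj h (rotz pi)" using msym_half_turns[OF s nc g(1)] by blast
  define k where "k = transpose h"
  have k: "k \<in> SO3" using h by (simp add: k_def SO3_transpose)
  define \<G> where "\<G> = cj k ` \<F>"
  have mG: "msym \<G> = cj k ` msym \<F>" using msym_image[OF k] by (simp add: \<G>_def)
  have R: "rotz pi \<in> msym \<G>"
  proof -
    have "rotz pi = cj k g" using h by (simp add: k_def cj_inv)
    then show ?thesis using g(1) mG by blast
  qed
  have sG: "transpose M = M" if "M \<in> \<G>" for M using that s by (auto simp: \<G>_def cj_transpose)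
  have nG: "\<not> coaxial \<G>" using nc k by (simp add: \<G>_def coaxial_cj_iff)
  have inv: "x ** x = mat 1" if "x \<in> msym \<G>" for x
  proof -
    from msym_half_turns[OF sG nG that] show ?thesis
    proof
      assume "\<exists>h\<in>SO3. x = cj h (rotz pi)"
      then obtain h where "h \<in> SO3" "x = cj h (rotz pi)" by blast
      then show ?thesis using cj_mult[of h "rotz pi" "rotz pi"] by (simp add: rotz_pi_square cj_mat)
    next
      assume "x = mat 1"
      then show ?thesis by (simp only: matrix_mul_lid)
    qed
  qed
  have "in_class (msym \<G>) (DD 2) \<or> in_class (msym \<G>) (ZZ 2)"
  proof (cases "msym \<G> \<subseteq> {mat 1, rotz pi}")
    case True
    then have "msym \<G> = ZZ 2" using R msym_one[of \<G>] by (auto simp: ZZ2)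
    then show ?thesis using in_class_refl by metis
  next
    case False
    then obtain r where r: "r \<in> msym \<G>" "r \<noteq> mat 1" "r \<noteq> rotz pi" by blast
    have rs: "r \<in> SO3" using r by (simp add: msym_def)
    have "r ** rotz pi = rotz pi ** r"
      by (rule involution_commute) (use inv r(1) R msym_mult in auto)
    note r0 = commute_rotz_pi_entries[OF this]
    have "r$3$3 * r$3$3 = 1" using SO3_cols(3)[OF rs] r0 by simp
    then have "r$3$3 = 1 \<or> r$3$3 = -1" using square_eq_1_iff by blast
    moreover have "r$3$3 \<noteq> 1"
    proof
      assume "r$3$3 = 1"
      then obtain t where t: "r = rotz t" using SO3_fix_ax3[OF rs r0(1,2)] by blast
      have "rotz (2 * t) = mat 1" using inv[OF r(1)] by (simp add: t rotz_add)
      then have "rotz (2 * t) $ 1 $ 1 = 1" by (simp add: mat3_entry)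
      then have "cos (2 * t) = 1" by (simp add: rotz_entry)
      then have "sin t = 0" by (simp add: cos_double_sin)
      then have "cos t = 1 \<or> cos t = -1" by (metis sin_zero_abs_cos_one abs_eq_iff abs_one)
      then show False using \<open>sin t = 0\<close> r(2,3) unfolding t by (simp add: mat3_eq_iff rotz_entry mat3_entry)
    qed
    ultimately obtain t where t: "r = rotz t ** rxpi" using SO3_block_O2[OF rs r0(1,2)] by blast
    \<comment> \<open>Conjugation by \<open>rotz a\<close> adds \<open>2 * a\<close> to the angle,
      by \<open>cj_rotz_rotz_rxpi\<close>.\<close>
    define a where "a = - t / 2"
    have ra: "cj (rotz a) r = rxpi" unfolding t cj_rotz_rotz_rxpi by (simp add: a_def rotz_0)
    have mH: "msym (cj (rotz a) ` \<G>) = cj (rotz a) ` msym \<G>" by (rule msym_image[OF rotz_SO3])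
    have X: "rxpi \<in> msym (cj (rotz a) ` \<G>)" unfolding mH ra[symmetric] using r(1) by blast
    have Z: "rotz pi \<in> msym (cj (rotz a) ` \<G>)"
      unfolding mH using R cj_rotz_rotz[of a pi] by (metis image_eqI)
    have inv': "x ** x = mat 1" if x: "x \<in> msym (cj (rotz a) ` \<G>)" for x
    proof -
      obtain y where "y \<in> msym \<G>" "x = cj (rotz a) y" using x unfolding mH by blast
      then show ?thesis using inv cj_mult[OF rotz_SO3, of a y y] by (simp add: cj_mat rotz_SO3)
    qed
    have "msym (cj (rotz a) ` \<G>) = DD 2"
    proof
      show "DD 2 \<subseteq> msym (cj (rotz a) ` \<G>)" using X Z msym_one msym_mult by (auto simp: DD2)
      show "msym (cj (rotz a) ` \<G>) \<subseteq> DD 2"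
      proof
        fix x assume x: "x \<in> msym (cj (rotz a) ` \<G>)"
        then have xs: "x \<in> SO3" by (simp add: msym_def)
        have "x ** rotz pi = rotz pi ** x"
          by (rule involution_commute) (use inv' x Z msym_mult in auto)
        note 0 = commute_rotz_pi_entries[OF this]
        have "x ** rxpi = rxpi ** x"
          by (rule involution_commute) (use inv' x X msym_mult in auto)
        then have "(x ** rxpi)$1$2 = (rxpi ** x)$1$2" "(x ** rxpi)$2$1 = (rxpi ** x)$2$1" by simp_all
        then have 1: "x$1$2 = 0" "x$2$1 = 0" by (simp_all add: mm3 rxpi_entry)
        note c = SO3_cols[OF xs]
        have "x$1$1 * x$1$1 = 1" "x$2$2 * x$2$2 = 1" using c 0 1 by simp_all
        then have "x$1$1 = 1 \<or> x$1$1 = -1" "x$2$2 = 1 \<or> x$2$2 = -1" using square_eq_1_iff by blast+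
        moreover have "x$1$1 * x$2$2 * x$3$3 = 1" using SO3_orth(3)[OF xs] by (simp add: det_3 0 1)
        ultimately show "x \<in> DD 2" using 0 1
          by (auto simp: DD2 mat3_eq_iff mat3_entry rotz_entry rxpi_entry mm3)
      qed
    qed
    then have "in_class (msym (cj (rotz a) ` \<G>)) (DD 2)" using in_class_refl by metis
    then show ?thesis unfolding mH in_class_cj_image[OF rotz_SO3] by blast
  qed
  then show ?thesis unfolding mG in_class_cj_image[OF k] by blast
qed

section \<open>The eight classes are distinct\<close>

lemma rotz_period: "rotz (t + 2 * pi * of_int m) = rotz t"
  by (simp add: mat3_eq_iff rotz_entry sin_add cos_add cos_int_2pin sin_int_2pin)

text \<open>The equation is the form in which \<open>rotz_fsym_iff\<close> yields cyclic groups and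
  in which traces can be computed.\<close>

lemma ZZ_cos:
  assumes "n > 0"
  shows "ZZ n = {rotz t | t. cos (real n * t) = 1}"
proof
  show "ZZ n \<subseteq> {rotz t | t. cos (real n * t) = 1}"
  proof
    fix x assume "x \<in> ZZ n"
    then obtain k where k: "x = rotz (2 * pi * real k / real n)" by (auto simp: ZZ_def)
    have "cos (real n * (2 * pi * real k / real n)) = 1"
      using assms cos_int_2pin[of "int k"] by simp
    then show "x \<in> {rotz t | t. cos (real n * t) = 1}" using k by blast
  qed
  show "{rotz t | t. cos (real n * t) = 1} \<subseteq> ZZ n"
  proof clarify
    fix t assume "cos (real n * t) = 1"
    then obtain m :: int where m: "real n * t = of_int m * 2 * pi" using cos_one_2pi_int by blast
    define k where "k = nat (m mod int n)"
    have k: "k < n" "int k = m mod int n" using assms by (simp_all add: k_def nat_less_iff)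
    have "m = int n * (m div int n) + int k" using k by simp
    then have "real_of_int m = real n * of_int (m div int n) + real k"
      by (metis of_int_add of_int_mult of_int_of_nat_eq)
    then have "t = 2 * pi * real k / real n + 2 * pi * of_int (m div int n)"
      using m assms by (simp add: field_simps)
    then have "rotz t = rotz (2 * pi * real k / real n)" by (simp only: rotz_period)
    then show "rotz t \<in> ZZ n" using k(1) unfolding ZZ_def by blast
  qed
qed

lemma trace3: "trace M = M$1$1 + M$2$2 + M$3$3" for M :: "real^3^3"
  by (simp add: trace_def sum_3)

lemma trace_rotz: "trace (rotz t) = 1 + 2 * cos t" "trace (rotz t ** rxpi) = - 1"
  by (simp_all add: trace3 mm3 rotz_entry rxpi_entry)

lemma in_class_trace: "in_class G K \<Longrightarrow> K \<subseteq> SO3 \<Longrightarrow> trace ` G = trace ` K"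
  by (auto simp: in_class_cj_def cj_trace image_image)

text \<open>Since a rotation has trace 1 + 2 cos of its angle, traces 0 and 1 detect rotations of
  order 3 and 4. The trace 1/2, of angle arccos(-1/4), occurs in none of the finite groups and
  separates them from \<open>O2\<close> and \<open>SO3\<close>.\<close>

lemma trace_classes:
  "trace ` trivgrp = {3}"
  "trace ` ZZ 2 = {3, -1}" "trace ` DD 2 = {3, -1}"
  "0 \<in> trace ` DD 3" "1 \<notin> trace ` DD 3" "1/2 \<notin> trace ` DD 3"
  "0 \<notin> trace ` DD 4" "1 \<in> trace ` DD 4" "1/2 \<notin> trace ` DD 4"
  "0 \<in> trace ` Oct" "1 \<in> trace ` Oct" "1/2 \<notin> trace ` Oct"
  "1/2 \<in> trace ` O2" "1/2 \<in> trace ` SO3"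
proof -
  show "trace ` trivgrp = {3}" by (simp add: trivgrp_def trace3 mat3_entry)
  show "trace ` ZZ 2 = {3, -1}" "trace ` DD 2 = {3, -1}"
    by (auto simp: ZZ2 DD2 trace3 mat3_entry rotz_entry rxpi_entry mm3)
  have DD: "x \<in> trace ` DD n \<longleftrightarrow> (\<exists>t. cos (real n * t) = 1 \<and> x = 1 + 2 * cos t) \<or> x = -1" if "n > 0" for n x
  proof -
    have D: "DD n = {rotz t |t. cos (real n * t) = 1} \<union> {rotz t ** rxpi |t. cos (real n * t) = 1}"
      unfolding DD_def ZZ_cos[OF that] by blast
    have "rotz 0 ** rxpi \<in> DD n" unfolding D by force
    then have "-1 \<in> trace ` DD n" using trace_rotz(2)[of 0] by (metis image_eqI)
    moreover have "1 + 2 * cos t \<in> trace ` DD n" if "cos (real n * t) = 1" for t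
    proof -
      have "rotz t \<in> DD n" unfolding D using that by blast
      then show ?thesis using trace_rotz(1)[of t] by (metis image_eqI)
    qed
    moreover have "(\<exists>t. cos (real n * t) = 1 \<and> trace g = 1 + 2 * cos t) \<or> trace g = -1" if "g \<in> DD n" for g
      using that trace_rotz unfolding D by blast
    ultimately show ?thesis by blast
  qed
  have c3: "cos (3 * t) = 4 * cos t ^ 3 - 3 * cos t" for t :: real by (rule cos_treble_cos)
  have c4: "cos (4 * t) = 2 * (2 * cos t ^ 2 - 1)^2 - 1" for t :: real
    using cos_double_cos[of "2 * t"] cos_double_cos[of t] by simp
  have "cos (3 * (2 * pi / 3)) = 1" by simp
  moreover have "cos (2 * pi / 3) = - 1/2" using cos_double_cos[of "pi/3"] by (simp add: cos_60 power2_eq_square)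
  ultimately show "0 \<in> trace ` DD 3" by (subst DD) (auto intro!: exI[of _ "2 * pi / 3"])
  show "1 \<notin> trace ` DD 3" "1/2 \<notin> trace ` DD 3"
  proof -
    have "cos t = 0 \<or> cos t = -1/4 \<Longrightarrow> cos (3 * t) \<noteq> 1" for t :: real by (auto simp: c3 power3_eq_cube)
    then show "1 \<notin> trace ` DD 3" "1/2 \<notin> trace ` DD 3" by (auto simp: DD field_simps)
  qed
  have "cos (4 * (pi / 2)) = 1" by simp
  then show "1 \<in> trace ` DD 4" by (subst DD) (auto intro!: exI[of _ "pi/2"])
  show "0 \<notin> trace ` DD 4" "1/2 \<notin> trace ` DD 4"
  proof -
    have "cos t = -1/2 \<or> cos t = -1/4 \<Longrightarrow> cos (4 * t) \<noteq> 1" for t :: real by (auto simp: c4 power2_eq_square)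
    then show "0 \<notin> trace ` DD 4" "1/2 \<notin> trace ` DD 4" by (auto simp: DD field_simps)
  qed
  obtain g where g: "g \<in> SO3" "g$1$1 = 0" "g$2$2 = 0" "g$3$3 = 0" "\<forall>i j. g$i$j \<in> {-1, 0, 1}"
    using exists_cyclic by blast
  then have "g \<in> Oct" "trace g = 0" by (simp_all add: Oct_def trace3)
  then show "0 \<in> trace ` Oct" by force
  have "rotz (pi/2) \<in> Oct" by (simp add: Oct_def rotz_SO3 forall_3 rotz_entry)
  moreover have "trace (rotz (pi/2)) = 1" by (simp add: trace_rotz)
  ultimately show "1 \<in> trace ` Oct" by force
  show "1/2 \<notin> trace ` Oct"
  proof
    assume "1/2 \<in> trace ` Oct"
    then obtain h where h: "1/2 = trace h" "h \<in> Oct" by blast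
    then have "h$1$1 \<in> {-1,0,1}" "h$2$2 \<in> {-1,0,1}" "h$3$3 \<in> {-1,0,1}" by (simp_all add: Oct_def)
    then show False using h(1) by (auto simp: trace3)
  qed
  have "trace (rotz (arccos (-1/4))) = 1/2" by (simp add: trace_rotz cos_arccos)
  moreover have "rotz (arccos (-1/4)) \<in> O2" by (auto simp: O2_def)
  ultimately show "1/2 \<in> trace ` O2" "1/2 \<in> trace ` SO3" using O2_SO3 by force+
qed

lemma classes_SO3: "trivgrp \<subseteq> SO3" "ZZ 2 \<subseteq> SO3" "DD n \<subseteq> SO3" "Oct \<subseteq> SO3"
  by (auto simp: trivgrp_def ZZ2 rotz_SO3 DD_def ZZ_def rxpi_SO3 SO3_mult Oct_def)

lemma in_class_card: "in_class G K \<Longrightarrow> card G = card K"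
  using cj_inject by (auto simp: in_class_cj_def inj_on_def intro!: card_image)

lemma in_class_SO3_O2: "\<not> (in_class G SO3 \<and> in_class G O2)"
proof
  assume a: "in_class G SO3 \<and> in_class G O2"
  obtain g where g: "g \<in> SO3" "G = cj g ` SO3" using a by (auto simp: in_class_cj_def)
  have "G = SO3"
  proof
    show "G \<subseteq> SO3" using g cj_SO3 by auto
    show "SO3 \<subseteq> G" using g cj_inv(2)[OF g(1)] cj_SO3 SO3_transpose by (metis image_eqI subsetI)
  qed
  moreover obtain h where h: "h \<in> SO3" "G = cj h ` O2" using a by (auto simp: in_class_cj_def)
  ultimately have e: "SO3 = cj h ` O2" by simp
  have "SO3 \<subseteq> O2"
  proof
    fix x assume "x \<in> SO3"
    then have "cj h x \<in> cj h ` O2" using h(1) cj_SO3 e by blast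
    then show "x \<in> O2" using h(1) cj_inject by auto
  qed
  then show False using O2_SO3 O2_neq_SO3 by blast
qed

lemma card_ZZ2_DD2: "card (ZZ 2) \<noteq> card (DD 2)"
proof -
  have "mat 1 \<noteq> rotz pi" "rxpi \<noteq> mat 1" "rxpi \<noteq> rotz pi" "rotz pi ** rxpi \<noteq> mat 1" "rotz pi ** rxpi \<noteq> rotz pi"
      "rotz pi ** rxpi \<noteq> rxpi"
    by (simp_all add: m3)
  then have "card (DD 2) = 4" "card (ZZ 2) = 2" unfolding DD2 ZZ2 by auto
  then show ?thesis by simp
qed

text \<open>The set of traces separates all pairs except \<open>SO3\<close> from \<open>O2\<close>
  and \<open>DD 2\<close> from \<open>ZZ 2\<close>. The first pair is separated because
  \<open>SO3\<close> is its own only conjugate, the second by cardinality.\<close>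

lemma classes_exclusive:
  assumes "i < 8" "j < 8" "in_class G ([SO3, Oct, O2, DD 4, DD 3, DD 2, ZZ 2, trivgrp] ! i)"
    "in_class G ([SO3, Oct, O2, DD 4, DD 3, DD 2, ZZ 2, trivgrp] ! j)"
  shows "i = j"
proof -
  have T: "in_class G SO3 \<Longrightarrow> trace ` G = trace ` SO3" "in_class G Oct \<Longrightarrow> trace ` G = trace ` Oct"
    "in_class G O2 \<Longrightarrow> trace ` G = trace ` O2" "in_class G (DD 4) \<Longrightarrow> trace ` G = trace ` DD 4"
    "in_class G (DD 3) \<Longrightarrow> trace ` G = trace ` DD 3" "in_class G (DD 2) \<Longrightarrow> trace ` G = {3,-1}"
    "in_class G (ZZ 2) \<Longrightarrow> trace ` G = {3,-1}" "in_class G trivgrp \<Longrightarrow> trace ` G = {3}"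
    using in_class_trace[of G] classes_SO3 O2_SO3 trace_classes(1-3) by auto
  define h z e m where "h = (1/2 \<in> trace ` G)" and "z = (0 \<in> trace ` G)" and "e = (1 \<in> trace ` G)"
    and "m = (-1 \<in> trace ` G)"
  have S: "in_class G SO3 \<longrightarrow> h" "in_class G O2 \<longrightarrow> h" "in_class G Oct \<longrightarrow> \<not> h \<and> z \<and> e"
    "in_class G (DD 4) \<longrightarrow> \<not> h \<and> \<not> z \<and> e" "in_class G (DD 3) \<longrightarrow> \<not> h \<and> z \<and> \<not> e"
    "in_class G (DD 2) \<longrightarrow> \<not> h \<and> \<not> z \<and> \<not> e \<and> m" "in_class G (ZZ 2) \<longrightarrow> \<not> h \<and> \<not> z \<and> \<not> e \<and> m"
    "in_class G trivgrp \<longrightarrow> \<not> h \<and> \<not> z \<and> \<not> e \<and> \<not> m"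
    using T trace_classes(4-14) unfolding h_def z_def e_def m_def by auto
  have i: "i = 0 \<or> i = 1 \<or> i = 2 \<or> i = 3 \<or> i = 4 \<or> i = 5 \<or> i = 6 \<or> i = 7" using assms(1) by auto
  have j: "j = 0 \<or> j = 1 \<or> j = 2 \<or> j = 3 \<or> j = 4 \<or> j = 5 \<or> j = 6 \<or> j = 7" using assms(2) by auto
  have Z: "\<not> (in_class G (ZZ 2) \<and> in_class G (DD 2))" using in_class_card card_ZZ2_DD2 by metis
  note Y = in_class_SO3_O2[of G]
  show ?thesis using i j assms(3,4)
    by (elim disjE; simp; use S Y Z in blast)
qed

section \<open>Transversely isotropic quadratic part\<close>

text \<open>Weights of the rotation action about the third axis: \<open>wt034\<close> says that only the weights 0, 3 and 4
  occur; the weight 4 part is \<open>(hP + hQ/4, hU)\<close> and the weight 3 part is \<open>(hA, hC)\<close>.\<close>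

definition wt034 :: "form4 \<Rightarrow> bool" where
  "wt034 F \<longleftrightarrow> hW F = hQ F \<and> hV F = - hU F \<and> hB F = - hA F \<and> hD F = - hC F"

definition wt3z :: "form4 \<Rightarrow> bool" where
  "wt3z F \<longleftrightarrow> hA F = 0 \<and> hC F = 0"

definition wt4z :: "form4 \<Rightarrow> bool" where
  "wt4z F \<longleftrightarrow> hU F = 0 \<and> hP F + hQ F / 4 = 0"

lemma rxpi_rows: "rxpi $ 1 = ax 1" "rxpi $ 2 = (-1) *\<^sub>R ax 2" "rxpi $ 3 = (-1) *\<^sub>R ax 3"
  by (simp_all add: vec_eq_iff forall_3 rxpi_entry axis_def)

context harmonic
begin

lemma rxpi_params:
  "hP (rot4 rxpi F) = hP F" "hQ (rot4 rxpi F) = hQ F" "hW (rot4 rxpi F) = hW F" "hU (rot4 rxpi F) = - hU F"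
  "hV (rot4 rxpi F) = - hV F" "hA (rot4 rxpi F) = - hA F" "hB (rot4 rxpi F) = - hB F" "hC (rot4 rxpi F) = hC F"
  "hD (rot4 rxpi F) = hD F"
  unfolding hP_def hQ_def hW_def hU_def hV_def hA_def hB_def hC_def hD_def
  unfolding rot4_def transpose_ax rxpi_rows ml by simp_all

lemma wt034_rotz:
  assumes "wt034 F"
  shows "hP (rot4 (rotz t) F) + hQ F / 4 = (hP F + hQ F / 4) * cos (4*t) + hU F * sin (4*t)"
    "hQ (rot4 (rotz t) F) = hQ F" "hW (rot4 (rotz t) F) = hQ F"
    "hU (rot4 (rotz t) F) = hU F * cos (4*t) - (hP F + hQ F / 4) * sin (4*t)"
    "hV (rot4 (rotz t) F) = - hU (rot4 (rotz t) F)"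
    "hA (rot4 (rotz t) F) = hA F * cos (3*t) - hC F * sin (3*t)"
    "hB (rot4 (rotz t) F) = - hA (rot4 (rotz t) F)"
    "hC (rot4 (rotz t) F) = hC F * cos (3*t) + hA F * sin (3*t)"
    "hD (rot4 (rotz t) F) = - hC (rot4 (rotz t) F)"
proof -
  have w: "hW F = hQ F" "hV F = - hU F" "hB F = - hA F" "hD F = - hC F" using assms by (simp_all add: wt034_def)
  note del = sin_cos_squared_add sin_cos_squared_add2 sin_cos_squared_add3
  have one: "hQ F / 4 = hQ F / 4 * ((cos t)\<^sup>2 + (sin t)\<^sup>2)\<^sup>2" by simp
  show "hP (rot4 (rotz t) F) + hQ F / 4 = (hP F + hQ F / 4) * cos (4*t) + hU F * sin (4*t)"
    by (subst one, unfold rotz_params w cos_sin_multiples) (simp add: field_simps power2_eq_square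
        power4_eq_xxxx del: del)
  show "hQ (rot4 (rotz t) F) = hQ F" "hW (rot4 (rotz t) F) = hQ F"
    unfolding rotz_params w by (simp_all add: cos_squared_eq algebra_simps)
  show "hU (rot4 (rotz t) F) = hU F * cos (4*t) - (hP F + hQ F / 4) * sin (4*t)"
    unfolding rotz_params w cos_sin_multiples by (simp add: field_simps)
  show "hV (rot4 (rotz t) F) = - hU (rot4 (rotz t) F)"
    unfolding rotz_params w by (simp add: algebra_simps)
  show "hA (rot4 (rotz t) F) = hA F * cos (3*t) - hC F * sin (3*t)"
     "hC (rot4 (rotz t) F) = hC F * cos (3*t) + hA F * sin (3*t)"
     "hB (rot4 (rotz t) F) = - hA (rot4 (rotz t) F)"
     "hD (rot4 (rotz t) F) = - hC (rot4 (rotz t) F)"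
    unfolding rotz_params w cos_sin_multiples by (simp_all add: algebra_simps)
qed

text \<open>As complex numbers, the conjugate of C + iA (weight 3) times (P + Q/4) + iU (weight 4)
  has weight 1, and its real and imaginary parts are the entries 13 and 23 of \<open>dten F\<close>
  up to constant factors. A vanishing product has a vanishing factor.\<close>

lemma wt034_split:
  assumes "wt034 F" "dten F$1$3 = 0" "dten F$2$3 = 0"
  shows "wt3z F \<or> wt4z F"
proof -
  have w: "hW F = hQ F" "hV F = - hU F" "hB F = - hA F" "hD F = - hC F" using assms by (simp_all add: wt034_def)
  let ?s = "(hA F)\<^sup>2 + (hC F)\<^sup>2" and ?e = "hP F + hQ F / 4"
  have "hC F * hU F = hA F * ?e" "hC F * ?e = - hA F * hU F"
    using assms(2,3) unfolding dten_entry w by (simp_all add: algebra_simps)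
  then have "?s * ?e = 0" "?s * hU F = 0" by algebra+
  then have "?s = 0 \<or> ?e = 0 \<and> hU F = 0" by auto
  then show ?thesis by (auto simp: wt3z_def wt4z_def sum_power2_eq_zero_iff)
qed

text \<open>The conditions on U and A normalize the phases of the weight vectors; with this choice
  \<open>rxpi\<close> is a symmetry as well (\<open>rxpi_fsym\<close>).\<close>

lemma rotz_fsym_iff:
  assumes w: "wt034 F" and "hU F = 0" "hA F = 0"
  shows "rotz t \<in> fsym F \<longleftrightarrow> (hP F + hQ F / 4 = 0 \<or> cos (4*t) = 1) \<and> (hC F = 0 \<or> cos (3*t) = 1)"
proof -
  note R = wt034_rotz[OF w, of t, unfolded assms(2,3)]
  have s: "cos x = 1 \<Longrightarrow> sin x = 0" for x :: real using sin_cos_squared_add[of x] by simp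
  have w': "hW F = hQ F" "hV F = - hU F" "hB F = - hA F" "hD F = - hC F" using w by (simp_all add: wt034_def)
  show ?thesis
  proof
    assume "rotz t \<in> fsym F"
    then have "rot4 (rotz t) F = F" by (simp add: fsym_def)
    then have "hP F + hQ F / 4 = (hP F + hQ F / 4) * cos (4*t)" "hC F = hC F * cos (3*t)"
      using R(1,8) by simp_all
    then show "(hP F + hQ F / 4 = 0 \<or> cos (4*t) = 1) \<and> (hC F = 0 \<or> cos (3*t) = 1)" by auto
  next
    assume c: "(hP F + hQ F / 4 = 0 \<or> cos (4*t) = 1) \<and> (hC F = 0 \<or> cos (3*t) = 1)"
    have e: "(hP F + hQ F / 4) * cos (4*t) = hP F + hQ F / 4" "(hP F + hQ F / 4) * sin (4*t) = 0"
      "hC F * cos (3*t) = hC F" "hC F * sin (3*t) = 0"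
      using c s[of "4*t"] s[of "3*t"] by (cases "hP F + hQ F / 4 = 0"; cases "hC F = 0"; simp)+
    have "rot4 (rotz t) F = F"
      by (rule harmonic_eqI[OF harmonic_rot4[OF harmonic_axioms rotz_SO3] harmonic_axioms])
         (use R e w' assms(2,3) in simp_all)
    then show "rotz t \<in> fsym F" by (simp add: fsym_def rotz_SO3)
  qed
qed

lemma rxpi_fsym:
  assumes w: "wt034 F" and "hU F = 0" "hA F = 0"
  shows "rxpi \<in> fsym F"
proof -
  have w': "hV F = - hU F" "hB F = - hA F" using w by (simp_all add: wt034_def)
  have "rot4 rxpi F = F"
    by (rule harmonic_eqI[OF harmonic_rot4[OF harmonic_axioms rxpi_SO3] harmonic_axioms])
       (use rxpi_params w' assms(2,3) in simp_all)
  then show ?thesis by (simp add: fsym_def rxpi_SO3)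
qed

end

lemma fsym_mult: "g \<in> fsym F \<Longrightarrow> h \<in> fsym F \<Longrightarrow> g ** h \<in> fsym F"
  by (auto simp: fsym_def SO3_mult simp flip: rot4_rot4)

lemma fsym_Int_O2:
  assumes "rxpi \<in> fsym F"
  shows "fsym F \<inter> O2 = {rotz t | t. rotz t \<in> fsym F} \<union> {r ** rxpi | r. r \<in> {rotz t | t. rotz t \<in> fsym F}}"
proof -
  have "rotz t \<in> fsym F" if "rotz t ** rxpi \<in> fsym F" for t
  proof -
    have "rotz t ** rxpi ** rxpi \<in> fsym F" using fsym_mult[OF that assms] .
    then show ?thesis by (simp add: rxpi_rxpi flip: matrix_mul_assoc)
  qed
  then show ?thesis using fsym_mult[OF _ assms] unfolding O2_def by blast
qed

lemma cj_rotz_O2: "cj (rotz a) ` O2 = O2"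
proof -
  have *: "cj (rotz a) ` O2 \<subseteq> O2" for a
    by (auto simp: O2_def cj_rotz_rotz cj_rotz_rotz_rxpi)
  have "x \<in> cj (rotz a) ` O2" if "x \<in> O2" for x
  proof -
    have "cj (rotz a) (cj (rotz (-a)) x) = x" by (simp add: cj_cj rotz_add rotz_0)
    then show ?thesis using *[of "-a"] that by (metis image_eqI image_subset_iff)
  qed
  then show ?thesis using * by blast
qed

lemma fsym_Int_O2_rotz:
  "in_class (fsym (rot4 (rotz a) F) \<inter> O2) K \<longleftrightarrow> in_class (fsym F \<inter> O2) K"
proof -
  have "inj (cj (rotz a))" using cj_inject[OF rotz_SO3] by (auto intro: injI)
  then have "cj (rotz a) ` (fsym F \<inter> O2) = fsym (rot4 (rotz a) F) \<inter> O2"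
    by (simp add: image_Int fsym_rot4[OF rotz_SO3] cj_rotz_O2)
  then show ?thesis using in_class_cj_image[OF rotz_SO3] by metis
qed

text \<open>A turn by \<open>t\<close> rotates the weight m vector by the angle m t, so the only
  surviving nonzero weight can be given the phase required by \<open>rotz_fsym_iff\<close>.\<close>

lemma axial_class:
  assumes "harmonic F" and w: "wt034 F"
  shows "wt3z F \<Longrightarrow> wt4z F \<Longrightarrow> in_class (fsym F \<inter> O2) O2"
    "wt3z F \<Longrightarrow> \<not> wt4z F \<Longrightarrow> in_class (fsym F \<inter> O2) (DD 4)"
    "\<not> wt3z F \<Longrightarrow> wt4z F \<Longrightarrow> in_class (fsym F \<inter> O2) (DD 3)"
proof -
  interpret harmonic F by fact
  { assume "wt3z F" "wt4z F"
    then have z: "hU F = 0" "hA F = 0" "hC F = 0" "hP F + hQ F / 4 = 0" by (simp_all add: wt3z_def wt4z_def)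
    have "rotz t \<in> fsym F" for t using rotz_fsym_iff[OF w z(1,2)] z by simp
    then have "O2 \<subseteq> fsym F" using fsym_mult[OF _ rxpi_fsym[OF w z(1,2)]] unfolding O2_def by blast
    then have "fsym F \<inter> O2 = O2" by blast
    then show "in_class (fsym F \<inter> O2) O2" using in_class_refl by metis }
  { assume a: "wt3z F" "\<not> wt4z F"
    define r where "r = sqrt ((hP F + hQ F / 4)\<^sup>2 + (hU F)\<^sup>2)"
    have r: "r \<noteq> 0" "(hP F + hQ F / 4)\<^sup>2 + (hU F)\<^sup>2 = r\<^sup>2"
      using a(2) unfolding r_def wt4z_def by (auto simp: sum_power2_eq_zero_iff)
    obtain t where t: "hP F + hQ F / 4 = r * cos (4*t)" "hU F = r * sin (4*t)"
      using exists_angle_multiple[OF r, of 4] by auto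
    let ?G = "rot4 (rotz t) F"
    interpret G: harmonic ?G by (rule harmonic_rot4[OF harmonic_axioms rotz_SO3])
    note R = wt034_rotz[OF w, of t]
    have wG: "wt034 ?G" using R by (simp add: wt034_def)
    have z: "hU ?G = 0" "hA ?G = 0" "hC ?G = 0" using R(4,6,8) a(1) unfolding t by (simp_all add: wt3z_def)
    have "hP ?G + hQ ?G / 4 = r * ((cos (4*t))\<^sup>2 + (sin (4*t))\<^sup>2)"
      using R(1,2) unfolding t by (simp add: algebra_simps power2_eq_square del: sin_cos_squared_add
          sin_cos_squared_add2 sin_cos_squared_add3)
    then have "hP ?G + hQ ?G / 4 \<noteq> 0" using r by simp
    then have "rotz s \<in> fsym ?G \<longleftrightarrow> cos (real 4 * s) = 1" for s
      using G.rotz_fsym_iff[OF wG z(1,2)] z(3) by simp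
    then have "fsym ?G \<inter> O2 = DD 4"
      unfolding fsym_Int_O2[OF G.rxpi_fsym[OF wG z(1,2)]] DD_def ZZ_cos[of 4, simplified] by simp
    then have "in_class (fsym ?G \<inter> O2) (DD 4)" using in_class_refl by metis
    then show "in_class (fsym F \<inter> O2) (DD 4)" by (simp only: fsym_Int_O2_rotz) }
  { assume a: "\<not> wt3z F" "wt4z F"
    define r where "r = sqrt ((hC F)\<^sup>2 + (hA F)\<^sup>2)"
    have r: "r \<noteq> 0" "(hC F)\<^sup>2 + (hA F)\<^sup>2 = r\<^sup>2"
      using a(1) unfolding r_def wt3z_def by (auto simp: sum_power2_eq_zero_iff)
    obtain t where t: "hC F = r * cos (3*t)" "hA F = r * sin (3*t)"
      using exists_angle_multiple[OF r, of 3] by auto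
    let ?G = "rot4 (rotz t) F"
    interpret G: harmonic ?G by (rule harmonic_rot4[OF harmonic_axioms rotz_SO3])
    note R = wt034_rotz[OF w, of t]
    have wG: "wt034 ?G" using R by (simp add: wt034_def)
    have z: "hU ?G = 0" "hA ?G = 0" "hP ?G + hQ ?G / 4 = 0" using R(1,2,4,6) a(2) unfolding t wt4z_def by simp_all
    have "hC ?G = r * ((cos (3*t))\<^sup>2 + (sin (3*t))\<^sup>2)"
      using R(8) unfolding t by (simp add: algebra_simps power2_eq_square del: sin_cos_squared_add
          sin_cos_squared_add2 sin_cos_squared_add3)
    then have "hC ?G \<noteq> 0" using r by simp
    then have "rotz s \<in> fsym ?G \<longleftrightarrow> cos (real 3 * s) = 1" for s
      using G.rotz_fsym_iff[OF wG z(1,2)] z(3) by simp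
    then have "fsym ?G \<inter> O2 = DD 3"
      unfolding fsym_Int_O2[OF G.rxpi_fsym[OF wG z(1,2)]] DD_def ZZ_cos[of 3, simplified] by simp
    then have "in_class (fsym ?G \<inter> O2) (DD 3)" using in_class_refl by metis
    then show "in_class (fsym F \<inter> O2) (DD 3)" by (simp only: fsym_Int_O2_rotz) }
qed

section \<open>Polynomials of symmetric tensors\<close>

text \<open>The homogeneous polynomial T(x,...,x).\<close>

fun mf :: "nat \<Rightarrow> tensor \<Rightarrow> real^3 \<Rightarrow> real" where
  "mf 0 T x = T []"
| "mf (Suc n) T x = (\<Sum>j\<in>UNIV. x $ j * mf n (\<lambda>xs. T (j # xs)) x)"

text \<open>Total symmetry by adjacent transpositions; unlike permutations, these survive the
  removal of the first index, which suits the recursion of \<open>mf\<close>.\<close>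

definition swapsym :: "nat \<Rightarrow> tensor \<Rightarrow> bool" where
  "swapsym n T \<longleftrightarrow> (\<forall>us i j vs. length us + length vs + 2 = n \<longrightarrow> T (us @ i # j # vs) = T (us @ j # i # vs))"

lemma swapsym_Cons: "swapsym (Suc n) T \<Longrightarrow> swapsym n (\<lambda>xs. T (i # xs))"
  unfolding swapsym_def by (metis (no_types, lifting) Cons_eq_appendI add_Suc length_Cons)

lemma swapsym_swap: "swapsym (Suc (Suc n)) T \<Longrightarrow> length vs = n \<Longrightarrow> T (i # j # vs) = T (j # i # vs)"
  unfolding swapsym_def by (metis add_2_eq_Suc' append_Nil list.size(3) plus_nat.add_0)

lemma mf_cong: "(\<And>xs. length xs = n \<Longrightarrow> S xs = T xs) \<Longrightarrow> mf n S x = mf n T x"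
proof (induction n arbitrary: S T)
  case (Suc n)
  have "mf n (\<lambda>xs. S (j # xs)) x = mf n (\<lambda>xs. T (j # xs)) x" for j
    by (rule Suc.IH) (simp add: Suc.prems)
  then show ?case by simp
qed simp

lemma mf_sum: "mf n (\<lambda>xs. \<Sum>j\<in>A. c j * T j xs) x = (\<Sum>j\<in>A. c j * mf n (T j) x)"
proof (induction n arbitrary: T)
  case (Suc n)
  have "mf (Suc n) (\<lambda>xs. \<Sum>j\<in>A. c j * T j xs) x = (\<Sum>i\<in>UNIV. x $ i * (\<Sum>j\<in>A. c j * mf n (\<lambda>xs. T j (i # xs)) x))"
    by (simp add: Suc.IH)
  also have "\<dots> = (\<Sum>j\<in>A. c j * mf (Suc n) (T j) x)"
    unfolding mf.simps sum_distrib_left by (subst sum.swap) (simp add: mult_ac)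
  finally show ?case .
qed simp

lemma mf_mult: "mf n (\<lambda>xs. c * T xs) x = c * mf n T x"
  using mf_sum[where n = n and A = "{()}" and c = "\<lambda>_. c" and T = "\<lambda>_. T"] by simp

lemma mf_deriv:
  assumes "swapsym n T"
  shows "((\<lambda>t. mf n T (x + t *\<^sub>R y)) has_real_derivative
     real n * mf (n - 1) (\<lambda>xs. \<Sum>j\<in>UNIV. y $ j * T (j # xs)) (x + t *\<^sub>R y)) (at t)"
  using assms
proof (induction n arbitrary: T)
  case 0
  then show ?case by simp
next
  case (Suc n)
  let ?z = "x + t *\<^sub>R y"
  have s: "swapsym n (\<lambda>xs. T (j # xs))" for j using Suc.prems by (rule swapsym_Cons)
  have "((\<lambda>t. mf (Suc n) T (x + t *\<^sub>R y)) has_real_derivative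
    (\<Sum>j\<in>UNIV. y $ j * mf n (\<lambda>xs. T (j # xs)) ?z + ?z $ j * (real n * mf (n - 1) (\<lambda>xs. \<Sum>k\<in>UNIV. y $ k * T (j # k
        # xs)) ?z))) (at t)"
    unfolding mf.simps
    by (rule DERIV_sum) (auto intro!: derivative_eq_intros Suc.IH[OF s])
  also have "(\<Sum>j\<in>UNIV. y $ j * mf n (\<lambda>xs. T (j # xs)) ?z + ?z $ j * (real n * mf (n - 1) (\<lambda>xs. \<Sum>k\<in>UNIV. y $ k *
      T (j # k # xs)) ?z))
     = real (Suc n) * mf (Suc n - 1) (\<lambda>xs. \<Sum>j\<in>UNIV. y $ j * T (j # xs)) ?z"
  proof (cases n)
    case 0
    then show ?thesis by (simp add: mf_sum)
  next
    case (Suc m)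
    have sw: "mf m (\<lambda>xs. T (j # k # xs)) ?z = mf m (\<lambda>xs. T (k # j # xs)) ?z" for j k
      by (rule mf_cong) (use swapsym_swap Suc.prems Suc in auto)
    have "(\<Sum>j\<in>UNIV. ?z $ j * (real n * mf (n - 1) (\<lambda>xs. \<Sum>k\<in>UNIV. y $ k * T (j # k # xs)) ?z))
      = real n * (\<Sum>j\<in>UNIV. \<Sum>k\<in>UNIV. ?z $ j * y $ k * mf m (\<lambda>xs. T (j # k # xs)) ?z)"
      by (simp add: Suc mf_sum sum_distrib_left mult_ac)
    also have "\<dots> = real n * (\<Sum>k\<in>UNIV. \<Sum>j\<in>UNIV. ?z $ j * y $ k * mf m (\<lambda>xs. T (j # k # xs)) ?z)"
      by (subst sum.swap) simp
    also have "\<dots> = real n * (\<Sum>k\<in>UNIV. y $ k * mf n (\<lambda>xs. T (k # xs)) ?z)"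
      by (simp add: Suc sw sum_distrib_left mult_ac)
    finally show ?thesis by (simp add: mf_sum sum.distrib algebra_simps)
  qed
  finally show ?case .
qed

text \<open>If the polynomial vanishes, so does its derivative along the j-th axis, which is n
  T(e_j,x,...,x); this lowers the order by one.\<close>

lemma polarization:
  assumes "swapsym n T" "\<And>x. mf n T x = 0" "length xs = n"
  shows "T xs = 0"
  using assms
proof (induction n arbitrary: T xs)
  case 0
  then show ?case by simp
next
  case (Suc n)
  obtain j ys where xs: "xs = j # ys" "length ys = n" using Suc.prems(3) by (cases xs) auto
  have "mf n (\<lambda>xs. T (j # xs)) x = 0" for x
  proof -
    have "((\<lambda>t. mf (Suc n) T (x + t *\<^sub>R ax j)) has_real_derivative
       real (Suc n) * mf n (\<lambda>xs. \<Sum>k\<in>UNIV. ax j $ k * T (k # xs)) x) (at 0)"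
      using mf_deriv[OF Suc.prems(1), of x "ax j" 0] by simp
    moreover have "((\<lambda>t. mf (Suc n) T (x + t *\<^sub>R ax j)) has_real_derivative 0) (at 0)"
      unfolding Suc.prems(2) by simp
    ultimately have "real (Suc n) * mf n (\<lambda>xs. \<Sum>k\<in>UNIV. ax j $ k * T (k # xs)) x = 0"
      by (rule DERIV_unique)
    moreover have "(\<Sum>k\<in>UNIV. ax j $ k * T (k # xs)) = T (j # xs)" for xs
      by (simp add: axis_def if_distrib if_distribR sum.delta cong: if_cong)
    ultimately show ?thesis by simp
  qed
  then show ?case using Suc.IH[OF swapsym_Cons[OF Suc.prems(1), of j] _ xs(2)] xs(1) by simp
qed

lemma tzero_iff_mf:
  assumes "swapsym n T"
  shows "tzero n T \<longleftrightarrow> (\<forall>x. mf n T x = 0)"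
proof
  assume "tzero n T"
  then have z: "T xs = 0" if "length xs = n" for xs using that by (simp add: tzero_def teq_def)
  have zero: "mf m (\<lambda>_. 0) x = 0" for m x by (induction m) simp_all
  have "mf n T x = mf n (\<lambda>_. 0) x" for x by (rule mf_cong) (rule z)
  then show "\<forall>x. mf n T x = 0" using zero by simp
next
  assume "\<forall>x. mf n T x = 0"
  then show "tzero n T" using polarization[OF assms] by (simp add: tzero_def teq_def)
qed

text \<open>The factor 20 = 5 * 4 comes from differentiating a quintic twice. Any orthonormal frame
  is allowed, so the Laplacian can be computed in the frame adapted to the common axis.\<close>

lemma mf_laplacian:
  assumes T: "swapsym 5 T" and g: "g \<in> SO3"
  shows "(\<Sum>k\<in>UNIV. deriv (deriv (\<lambda>t. mf 5 T (x + t *\<^sub>R g $ k))) 0) = 20 * mf 3 (ttr T) x"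
proof -
  define Q where "Q = (\<lambda>f h. \<Sum>i\<in>UNIV. f $ i * (\<Sum>j\<in>UNIV. h $ j * mf 3 (\<lambda>xs. T (i # j # xs)) x))"
  have "deriv (deriv (\<lambda>t. mf 5 T (x + t *\<^sub>R f))) 0 = 20 * Q f f" for f
  proof -
    have 1: "deriv (\<lambda>t. mf 5 T (x + t *\<^sub>R f)) = (\<lambda>t. 5 * mf 4 (\<lambda>xs. \<Sum>j\<in>UNIV. f $ j * T (j # xs)) (x + t *\<^sub>R f))"
      using mf_deriv[OF T, of x f] by (intro ext DERIV_imp_deriv) simp
    have s: "swapsym 4 (\<lambda>xs. \<Sum>j\<in>UNIV. f $ j * T (j # xs))"
    proof -
      have "swapsym 4 (\<lambda>xs. T (j # xs))" for j by (rule swapsym_Cons) (use T in simp)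
      then show ?thesis unfolding swapsym_def by (auto intro!: sum.cong)
    qed
    have "((\<lambda>t. 5 * mf 4 (\<lambda>xs. \<Sum>j\<in>UNIV. f $ j * T (j # xs)) (x + t *\<^sub>R f)) has_real_derivative
        5 * (4 * mf 3 (\<lambda>xs. \<Sum>i\<in>UNIV. f $ i * (\<Sum>j\<in>UNIV. f $ j * T (j # i # xs))) x)) (at 0)"
      using mf_deriv[OF s, of x f 0] by (intro DERIV_cmult) simp
    moreover have "mf 3 (\<lambda>xs. \<Sum>i\<in>UNIV. f $ i * (\<Sum>j\<in>UNIV. f $ j * T (j # i # xs))) x = Q f f"
    proof -
      have sw: "mf 3 (\<lambda>xs. T (j # i # xs)) x = mf 3 (\<lambda>xs. T (i # j # xs)) x" for i j
        by (rule mf_cong, rule swapsym_swap[of 3]) (use T in simp_all)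
      show ?thesis unfolding mf_sum Q_def by (simp add: sw)
    qed
    ultimately show ?thesis unfolding 1 by (auto intro: DERIV_imp_deriv)
  qed
  then have "(\<Sum>k\<in>UNIV. deriv (deriv (\<lambda>t. mf 5 T (x + t *\<^sub>R g $ k))) 0) = 20 * (\<Sum>k\<in>UNIV. Q (g $ k) (g $ k))"
    by (simp add: sum_distrib_left)
  also have "(\<Sum>k\<in>UNIV. Q (g $ k) (g $ k)) = (\<Sum>k\<in>UNIV. Q (ax k) (ax k))"
    by (rule orthonormal_contraction[OF g])
       (auto simp: Q_def linear_iff algebra_simps sum.distrib sum_distrib_left)
  also have "\<dots> = mf 3 (ttr T) x"
  proof -
    have "Q (ax k) (ax k) = mf 3 (\<lambda>xs. T (k # k # xs)) x" for k
      by (simp add: Q_def axis_def if_distrib if_distribR sum.delta cong: if_cong)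
    then show ?thesis using mf_sum[where n = 3 and A = UNIV and c = "\<lambda>_. 1" and T = "\<lambda>k xs. T (k # k # xs)"] by
        (simp add: ttr_def)
  qed
  finally show ?thesis .
qed

lemma swapsym_ttr: "swapsym 5 T \<Longrightarrow> swapsym 3 (ttr T)"
proof -
  assume T: "swapsym 5 T"
  have "swapsym 3 (\<lambda>xs. T (k # k # xs))" for k
    by (rule swapsym_Cons, rule swapsym_Cons) (use T in simp)
  then show ?thesis unfolding swapsym_def ttr_def by (auto intro!: sum.cong)
qed

subsection \<open>Symmetrization\<close>

lemma sum_lists_Suc:
  "(\<Sum>js\<in>{js::3 list. length js = Suc n}. f js) = (\<Sum>j\<in>UNIV. \<Sum>js\<in>{js. length js = n}. (f (j # js) :: real))"
proof -
  have "{js::3 list. length js = Suc n} = (\<lambda>(j, js). j # js) ` (UNIV \<times> {js. length js = n})"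
    by (auto simp: length_Suc_conv image_iff)
  moreover have "inj_on (\<lambda>(j, js). j # js) (UNIV \<times> {js::3 list. length js = n})" by (auto simp: inj_on_def)
  ultimately have "(\<Sum>js\<in>{js::3 list. length js = Suc n}. f js) = (\<Sum>(j, js)\<in>UNIV \<times> {js. length js = n}. f (j # js))"
    by (simp add: sum.reindex o_def case_prod_unfold)
  then show ?thesis by (simp add: sum.cartesian_product)
qed

lemma mf_lists: "mf n T x = (\<Sum>js\<in>{js. length js = n}. (\<Prod>k<n. x $ (js ! k)) * T js)"
proof (induction n arbitrary: T)
  case (Suc n)
  show ?case unfolding sum_lists_Suc mf.simps Suc.IH
    by (simp add: prod.lessThan_Suc_shift sum_distrib_left mult_ac del: prod.lessThan_Suc)
qed simp

lemma permute_list_length: "length (permute_list \<sigma> xs) = length xs"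
  by (simp add: permute_list_def)

lemma permute_list_compose:
  assumes "\<sigma> permutes {0..<length xs}"
  shows "permute_list \<sigma> (permute_list \<tau> xs) = permute_list (\<tau> \<circ> \<sigma>) xs"
  using permutes_in_image[OF assms] by (auto simp: permute_list_def)

lemma permute_list_id: "permute_list id xs = xs"
  by (simp add: permute_list_def map_nth)

lemma mf_permute:
  assumes s: "\<sigma> permutes {0..<n}"
  shows "mf n (\<lambda>xs. T (permute_list \<sigma> xs)) x = mf n T x"
proof -
  have iv: "inv \<sigma> permutes {0..<n}" using s by (rule permutes_inv)
  have o: "inv \<sigma> \<circ> \<sigma> = id" "\<sigma> \<circ> inv \<sigma> = id" using s permutes_inv_o by blast+
  have "bij_betw (permute_list \<sigma>) {js. length js = n} {js. length js = n}"
    by (rule bij_betw_byWitness[where f' = "permute_list (inv \<sigma>)"])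
       (use s iv o in \<open>auto simp: permute_list_length permute_list_compose permute_list_id\<close>)
  moreover have "(\<Prod>k<n. x $ (permute_list \<sigma> js ! k)) = (\<Prod>k<n. x $ (js ! k))" if "length js = n" for js
  proof -
    have "(\<Prod>k<n. x $ (permute_list \<sigma> js ! k)) = (\<Prod>k<n. x $ (js ! \<sigma> k))"
      using that by (auto simp: permute_list_def intro!: prod.cong)
    also have "\<dots> = (\<Prod>k<n. x $ (js ! k))"
      using s prod.permute[of \<sigma> "{..<n}" "\<lambda>k. x $ (js ! k)"] by (simp add: o_def lessThan_atLeast0)
    finally show ?thesis .
  qed
  ultimately show ?thesis unfolding mf_lists
    by (subst sum.reindex_bij_betw[symmetric, of "permute_list \<sigma>" "{js. length js = n}" "{js. length js = n}"]) auto
qed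

text \<open>The polynomial is insensitive to the order of the indices, so the cross product may be
  evaluated as if it were not symmetrized.\<close>

lemma mf_tsymmetrize: "mf n (tsymmetrize n T) x = mf n T x"
proof -
  let ?S = "{\<sigma>. \<sigma> permutes {0..<n}}"
  have "mf n (tsymmetrize n T) x = (\<Sum>\<sigma>\<in>?S. 1 / fact n * mf n (\<lambda>xs. T (permute_list \<sigma> xs)) x)"
    unfolding mf_sum[symmetric] tsymmetrize_def by (simp add: sum_divide_distrib)
  also have "\<dots> = (\<Sum>\<sigma>\<in>?S. 1 / fact n * mf n T x)"
    by (rule sum.cong) (auto simp: mf_permute)
  also have "\<dots> = mf n T x" using card_permutations[of "{0..<n}" n] by simp
  finally show ?thesis .
qed

lemma swapsym_tsymmetrize: "swapsym n (tsymmetrize n T)"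
  unfolding swapsym_def
proof (intro allI impI)
  fix us vs :: "3 list" and i j assume n: "length us + length vs + 2 = n"
  let ?S = "{\<sigma>. \<sigma> permutes {0..<n}}"
  let ?l = "length us" and ?xs = "us @ i # j # vs" and ?ys = "us @ j # i # vs"
  define \<tau> where "\<tau> = Transposition.transpose ?l (Suc ?l)"
  have t: "\<tau> permutes {0..<n}" unfolding \<tau>_def using n by (intro permutes_swap_id) auto
  have tt: "\<tau> \<circ> \<tau> = id" by (simp add: \<tau>_def)
  have len: "length ?xs = n" "length ?ys = n" using n by auto
  have ys: "?ys = permute_list \<tau> ?xs"
  proof (rule nth_equalityI)
    fix k assume "k < length ?ys"
    then have "permute_list \<tau> ?xs ! k = ?xs ! \<tau> k" by (simp add: permute_list_def del: upt_Suc)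
    then show "?ys ! k = permute_list \<tau> ?xs ! k"
      by (auto simp: \<tau>_def Transposition.transpose_def nth_append nth_Cons' split: if_splits)
  qed (simp add: permute_list_length)
  have "(\<Sum>\<sigma>\<in>?S. T (permute_list \<sigma> ?ys)) = (\<Sum>\<sigma>\<in>?S. T (permute_list (\<tau> \<circ> \<sigma>) ?xs))"
    by (rule sum.cong) (use len in \<open>auto simp: ys permute_list_compose\<close>)
  also have "\<dots> = (\<Sum>\<sigma>\<in>?S. T (permute_list \<sigma> ?xs))"
  proof (rule sum.reindex_bij_betw, rule bij_betw_byWitness[where f' = "\<lambda>\<sigma>. \<tau> \<circ> \<sigma>"])
    have "\<tau> \<circ> (\<tau> \<circ> a) = a" for a :: "nat \<Rightarrow> nat" using tt by (simp flip: comp_assoc)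
    then show "\<forall>a\<in>?S. \<tau> \<circ> (\<tau> \<circ> a) = a" "\<forall>a\<in>?S. \<tau> \<circ> (\<tau> \<circ> a) = a" by blast+
    show "(\<circ>) \<tau> ` ?S \<subseteq> ?S" "(\<circ>) \<tau> ` ?S \<subseteq> ?S" using t permutes_compose by blast+
  qed
  finally show "tsymmetrize n T ?xs = tsymmetrize n T ?ys" by (simp add: tsymmetrize_def)
qed

lemma mf_product: "mf (m + n) (\<lambda>r. A (take m r) * B (drop m r)) x = mf m A x * mf n B x"
proof (induction m arbitrary: A)
  case 0
  then show ?case by (simp add: mf_mult)
next
  case (Suc m)
  have "mf (m + n) (\<lambda>r. A (j # take m r) * B (drop m r)) x = mf m (\<lambda>r. A (j # r)) x * mf n B x" for j
    by (rule Suc.IH)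
  then show ?case by (simp add: sum_distrib_right mult.assoc)
qed

lemma eps_sum: "(\<Sum>i\<in>UNIV. \<Sum>j\<in>UNIV. \<Sum>k\<in>UNIV. eps i j k * x $ i * y $ j * z $ k) = cross3 x y \<bullet> z"
  by (simp add: eps_def cross3_def axis_def inner_vec_def sum_3 algebra_simps)

text \<open>The vectors next to \<open>x\<close> are, up to a factor, the gradients of the
  polynomials of \<open>S1\<close> and \<open>S2\<close>.\<close>

lemma mf_gcross:
  "mf (Suc (m + n)) (gcross (Suc m) S1 (Suc n) S2) x
   = cross3 x (\<chi> j. mf m (\<lambda>r. S1 (j # r)) x) \<bullet> (\<chi> k. mf n (\<lambda>r. S2 (k # r)) x)"
proof -
  have "mf (Suc (m + n)) (gcross (Suc m) S1 (Suc n) S2) x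
    = mf (Suc (m + n)) (\<lambda>xs. \<Sum>j\<in>UNIV. \<Sum>k\<in>UNIV. eps (xs!0) j k * S1 (j # take m (drop 1 xs)) * S2 (k # drop (Suc
        m) xs)) x"
    unfolding gcross_def using mf_tsymmetrize[of "Suc (m + n)"] by simp
  also have "\<dots> = (\<Sum>i\<in>UNIV. x $ i * mf (m + n) (\<lambda>r. \<Sum>j\<in>UNIV. 1 * (\<Sum>k\<in>UNIV. eps i j k * (S1 (j # take m r) * S2 (k
      # drop m r)))) x)"
    by (simp add: mult.assoc)
  also have "\<dots> = (\<Sum>i\<in>UNIV. \<Sum>j\<in>UNIV. \<Sum>k\<in>UNIV. eps i j k * x $ i * mf m (\<lambda>r. S1 (j # r)) x * mf n (\<lambda>r. S2 (k # r)) x)"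
    unfolding mf_sum mf_product[of m n "\<lambda>r. S1 (_ # r)" "\<lambda>r. S2 (_ # r)"] by (simp add: sum_distrib_left mult_ac)
  finally show ?thesis using eps_sum[of x "\<chi> j. mf m (\<lambda>r. S1 (j # r)) x" "\<chi> k. mf n (\<lambda>r. S2 (k # r)) x"] by simp
qed

section \<open>Cross products in the frame of a common axis\<close>

text \<open>A quarter of the gradient of the quartic F(x,x,x,x).\<close>

definition grad :: "form4 \<Rightarrow> real^3 \<Rightarrow> real^3" where
  "grad F x = (\<chi> j. F (ax j) x x x)"

text \<open>The polynomial of the cross product of a form and a matrix, see
  \<open>mf_gcross42\<close>; \<open>crossQ\<close> below is the one for two matrices.\<close>

definition crossP :: "form4 \<Rightarrow> real^3^3 \<Rightarrow> real^3 \<Rightarrow> real" where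
  "crossP F S x = cross3 x (grad F x) \<bullet> (S *v x)"

definition crossQ :: "real^3^3 \<Rightarrow> real^3^3 \<Rightarrow> real^3 \<Rightarrow> real" where
  "crossQ S L x = cross3 x (S *v x) \<bullet> (L *v x)"

lemma SO3_triple: "g \<in> SO3 \<Longrightarrow> cross3 (g *v x) (g *v y) \<bullet> (g *v z) = cross3 x y \<bullet> z"
  using SO3_inner[of "transpose g"] by (simp add: cross_rotation_matrix SO3_def SO3_transpose[unfolded SO3_def,
      simplified])

lemma SO3_back: "g \<in> SO3 \<Longrightarrow> g *v (transpose g *v x) = x"
  by (simp add: matrix_vector_mul_assoc SO3_orth)

lemma cj_vec: "g \<in> SO3 \<Longrightarrow> cj g S *v x = g *v (S *v (transpose g *v x))"
  by (simp add: cj_def matrix_vector_mul_assoc matrix_mul_assoc)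

lemma grad_rot4:
  assumes "harmonic F" "g \<in> SO3"
  shows "grad (rot4 g F) x = g *v grad F (transpose g *v x)"
proof -
  interpret harmonic F by fact
  have "F (g $ j) y y y = (g *v grad F y) $ j" for j y
    using linear_ax_expand[OF lin1[of y y y], of "g $ j"] by (simp add: grad_def matrix_vector_mult_def)
  then show ?thesis by (simp add: vec_eq_iff) (simp add: grad_def rot4_def transpose_ax)
qed

lemma crossP_rot4:
  assumes "harmonic F" "g \<in> SO3"
  shows "crossP (rot4 g F) (cj g S) x = crossP F S (transpose g *v x)"
proof -
  let ?y = "transpose g *v x"
  have "crossP (rot4 g F) (cj g S) x = cross3 (g *v ?y) (g *v grad F ?y) \<bullet> (g *v (S *v ?y))"
    using assms by (simp add: crossP_def grad_rot4 cj_vec SO3_back)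
  then show ?thesis using SO3_triple[OF assms(2)] by (simp add: crossP_def)
qed

lemma crossQ_cj:
  assumes "g \<in> SO3"
  shows "crossQ (cj g S) (cj g L) x = crossQ S L (transpose g *v x)"
proof -
  let ?y = "transpose g *v x"
  have "crossQ (cj g S) (cj g L) x = cross3 (g *v ?y) (g *v (S *v ?y)) \<bullet> (g *v (L *v ?y))"
    using assms by (simp add: crossQ_def cj_vec SO3_back)
  then show ?thesis using SO3_triple[OF assms] by (simp add: crossQ_def)
qed

lemma vec3_expand: "x = x$1 *\<^sub>R ax 1 + x$2 *\<^sub>R ax 2 + x$3 *\<^sub>R ax 3" for x :: "real^3"
  by (simp add: vec_eq_iff forall_3 axis_def)

lemma deriv2_quintic:
  "deriv (deriv (\<lambda>t::real. k0 + k1*t + k2*t^2 + k3*t^3 + k4*t^4 + k5*t^5)) 0 = 2 * k2"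
proof -
  have "deriv (\<lambda>t::real. k0 + k1*t + k2*t^2 + k3*t^3 + k4*t^4 + k5*t^5)
     = (\<lambda>t. k1 + 2*k2*t + 3*k3*t^2 + 4*k4*t^3 + 5*k5*t^4)"
    by (intro ext DERIV_imp_deriv) (auto intro!: derivative_eq_intros simp: algebra_simps)
  moreover have "deriv (\<lambda>t. k1 + 2*k2*t + 3*k3*t^2 + 4*k4*t^3 + 5*k5*t^4) 0 = 2 * k2"
    by (intro DERIV_imp_deriv) (auto intro!: derivative_eq_intros)
  ultimately show ?thesis by simp
qed

lemma diag3_vec: "diag3 S \<Longrightarrow> (S *v x)$i = S$i$i * x$i"
  using exhaust_3[of i] by (auto simp: matrix_vector_mult_def sum_3 diag3_def)

context harmonic
begin

lemma grad_entry:
  "grad F x $ 1 = (- hP F - hQ F) * (x$1)^3 + (3 * hU F) * (x$1)^2 * x$2 + (3 * hA F) * (x$1)^2 * x$3 + (3 * hP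
      F) * x$1 * (x$2)^2 + (6 * hC F) * x$1 * x$2 * x$3 + (3 * hQ F) * x$1 * (x$3)^2 + (hV F) * (x$2)^3 + (3 *
      hB F) * (x$2)^2 * x$3 + (- 3 * hU F - 3 * hV F) * x$2 * (x$3)^2 + (- hA F - hB F) * (x$3)^3"
  "grad F x $ 2 = (hU F) * (x$1)^3 + (3 * hP F) * (x$1)^2 * x$2 + (3 * hC F) * (x$1)^2 * x$3 + (3 * hV F) * x$1
      * (x$2)^2 + (6 * hB F) * x$1 * x$2 * x$3 + (- 3 * hU F - 3 * hV F) * x$1 * (x$3)^2 + (- hP F - hW F) *
      (x$2)^3 + (3 * hD F) * (x$2)^2 * x$3 + (3 * hW F) * x$2 * (x$3)^2 + (- hC F - hD F) * (x$3)^3"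
proof -
  have c: "F (x$1 *\<^sub>R ax 1 + x$2 *\<^sub>R ax 2 + x$3 *\<^sub>R ax 3) y z w = x$1 * F (ax 1) y z w + x$2 * F (ax 2) y z w +
      x$3 * F (ax 3) y z w" for y z w
    by (simp add: ml)
  have e: "F (ax j) x x x = F (ax j) (x$1 *\<^sub>R ax 1 + x$2 *\<^sub>R ax 2 + x$3 *\<^sub>R ax 3) (x$1 *\<^sub>R ax 1 + x$2 *\<^sub>R ax 2 +
      x$3 *\<^sub>R ax 3)
     (x$1 *\<^sub>R ax 1 + x$2 *\<^sub>R ax 2 + x$3 *\<^sub>R ax 3)" for j
    using vec3_expand[of x] by simp
  show "grad F x $ 1 = (- hP F - hQ F) * (x$1)^3 + (3 * hU F) * (x$1)^2 * x$2 + (3 * hA F) * (x$1)^2 * x$3 + (3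
      * hP F) * x$1 * (x$2)^2 + (6 * hC F) * x$1 * x$2 * x$3 + (3 * hQ F) * x$1 * (x$3)^2 + (hV F) * (x$2)^3 +
      (3 * hB F) * (x$2)^2 * x$3 + (- 3 * hU F - 3 * hV F) * x$2 * (x$3)^2 + (- hA F - hB F) * (x$3)^3"
    unfolding grad_def vec_lambda_beta e ml comps by (simp add: algebra_simps power2_eq_square power3_eq_cube)
  show "grad F x $ 2 = (hU F) * (x$1)^3 + (3 * hP F) * (x$1)^2 * x$2 + (3 * hC F) * (x$1)^2 * x$3 + (3 * hV F) *
      x$1 * (x$2)^2 + (6 * hB F) * x$1 * x$2 * x$3 + (- 3 * hU F - 3 * hV F) * x$1 * (x$3)^2 + (- hP F - hW F) *
      (x$2)^3 + (3 * hD F) * (x$2)^2 * x$3 + (3 * hW F) * x$2 * (x$3)^2 + (- hC F - hD F) * (x$3)^3"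
    unfolding grad_def vec_lambda_beta e ml comps by (simp add: algebra_simps power2_eq_square power3_eq_cube)
qed

text \<open>A quarter of the derivative of F(x,x,x,x) along the rotations about the third axis, by
  \<open>theta_eq\<close>.\<close>

definition theta :: "real^3 \<Rightarrow> real" where
  "theta x = (hU F) * (x$1)^4 + (4 * hP F + hQ F) * (x$1)^3 * x$2 + (3 * hC F) * (x$1)^3 * x$3 + (- 3 * hU F + 3
      * hV F) * (x$1)^2 * (x$2)^2 + (- 3 * hA F + 6 * hB F) * (x$1)^2 * x$2 * x$3 + (- 3 * hU F - 3 * hV F) *
      (x$1)^2 * (x$3)^2 + (- 4 * hP F - hW F) * x$1 * (x$2)^3 + (- 6 * hC F + 3 * hD F) * x$1 * (x$2)^2 * x$3 +
      (- 3 * hQ F + 3 * hW F) * x$1 * x$2 * (x$3)^2 + (- hC F - hD F) * x$1 * (x$3)^3 + (- hV F) * (x$2)^4 + (-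
      3 * hB F) * (x$2)^3 * x$3 + (3 * hU F + 3 * hV F) * (x$2)^2 * (x$3)^2 + (hA F + hB F) * x$2 * (x$3)^3"

lemma theta_eq: "x$1 * grad F x $ 2 - x$2 * grad F x $ 1 = theta x"
  unfolding grad_entry theta_def by (simp add: algebra_simps power2_eq_square power3_eq_cube power4_eq_xxxx)

text \<open>The vector \<open>S *v x\<close> is a multiple of \<open>x\<close> plus
  \<open>(S$3$3 - S$1$1) * x$3\<close> times the third axis, and the triple product kills the first
  part.\<close>

lemma crossP_axis3:
  assumes "diag3 S" "S$1$1 = S$2$2"
  shows "crossP F S x = (S$3$3 - S$1$1) * (x$3 * theta x)"
  unfolding theta_eq[symmetric] crossP_def using assms
  by (simp add: cross3_def inner_vec_def sum_3 diag3_vec algebra_simps)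

lemma crossP_axis3_zero:
  assumes "diag3 S" "S$1$1 = S$2$2" "S$1$1 \<noteq> S$3$3"
  shows "(\<forall>x. crossP F S x = 0) \<longleftrightarrow> wt034 F \<and> wt3z F \<and> wt4z F"
proof
  assume a: "\<forall>x. crossP F S x = 0"
  \<comment> \<open>The coordinate 1 makes the factor \<open>x$3\<close> harmless; finitely many
    values of \<open>theta\<close> then give a linear system for the nine coordinates.\<close>
  have z: "theta (vector [a, b, 1]) = 0" for a b
    using a[rule_format, of "vector [a, b, 1]"] assms by (simp add: crossP_axis3)
  note Z = z[unfolded theta_def vector_3]
  show "wt034 F \<and> wt3z F \<and> wt4z F"
    using Z[of 1 0] Z[of "-1" 0] Z[of 2 0] Z[of "-2" 0] Z[of 0 1] Z[of 0 "-1"] Z[of 0 2] Z[of 0 "-2"]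
      Z[of 1 1] Z[of 1 "-1"] Z[of "-1" 1] Z[of 2 1] Z[of 1 2] Z[of 2 "-1"]
    unfolding wt034_def wt3z_def wt4z_def by simp
next
  assume "wt034 F \<and> wt3z F \<and> wt4z F"
  then have w: "hW F = hQ F" "hV F = 0" "hU F = 0" "hA F = 0" "hB F = 0" "hC F = 0" "hD F = 0" "hQ F = - 4 * hP F"
    by (auto simp: wt034_def wt3z_def wt4z_def)
  have "theta x = 0" for x unfolding theta_def w by (simp add: algebra_simps)
  then show "\<forall>x. crossP F S x = 0" using assms by (simp add: crossP_axis3)
qed

text \<open>Because \<open>theta\<close> is harmonic, the Laplacian of \<open>x$3 * theta x\<close>
  is twice the derivative of \<open>theta\<close> in the third direction; the long bracket is this
  derivative. The proof reads off the coefficients of \<open>t^2\<close>.\<close>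

lemma crossP_axis3_laplacian:
  assumes "diag3 S" "S$1$1 = S$2$2"
  shows "(\<Sum>k\<in>UNIV. deriv (deriv (\<lambda>t. crossP F S (x + t *\<^sub>R ax k))) 0) = 2 * (S$3$3 - S$1$1) * ((3 * hC F) *
      (x$1)^3 + (- 3 * hA F + 6 * hB F) * (x$1)^2 * x$2 + (- 6 * hU F - 6 * hV F) * (x$1)^2 * x$3 + (- 6 * hC F
      + 3 * hD F) * x$1 * (x$2)^2 + (- 6 * hQ F + 6 * hW F) * x$1 * x$2 * x$3 + (- 3 * hC F - 3 * hD F) * x$1 *
      (x$3)^2 + (- 3 * hB F) * (x$2)^3 + (6 * hU F + 6 * hV F) * (x$2)^2 * x$3 + (3 * hA F + 3 * hB F) * x$2 *
      (x$3)^2)"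
proof -
  let ?k = "S$3$3 - S$1$1"
  have e1: "crossP F S (x + t *\<^sub>R ax 1) = ?k * ((hU F) * (x$1)^4 * x$3 + (4 * hP F + hQ F) * (x$1)^3 * x$2 * x$3
      + (3 * hC F) * (x$1)^3 * (x$3)^2 + (- 3 * hU F + 3 * hV F) * (x$1)^2 * (x$2)^2 * x$3 + (- 3 * hA F + 6 *
      hB F) * (x$1)^2 * x$2 * (x$3)^2 + (- 3 * hU F - 3 * hV F) * (x$1)^2 * (x$3)^3 + (- 4 * hP F - hW F) * x$1
      * (x$2)^3 * x$3 + (- 6 * hC F + 3 * hD F) * x$1 * (x$2)^2 * (x$3)^2 + (- 3 * hQ F + 3 * hW F) * x$1 * x$2
      * (x$3)^3 + (- hC F - hD F) * x$1 * (x$3)^4 + (- hV F) * (x$2)^4 * x$3 + (- 3 * hB F) * (x$2)^3 * (x$3)^2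
      + (3 * hU F + 3 * hV F) * (x$2)^2 * (x$3)^3 + (hA F + hB F) * x$2 * (x$3)^4) + ?k * ((4 * hU F) * (x$1)^3
      * x$3 + (12 * hP F + 3 * hQ F) * (x$1)^2 * x$2 * x$3 + (9 * hC F) * (x$1)^2 * (x$3)^2 + (- 6 * hU F + 6 *
      hV F) * x$1 * (x$2)^2 * x$3 + (- 6 * hA F + 12 * hB F) * x$1 * x$2 * (x$3)^2 + (- 6 * hU F - 6 * hV F) *
      x$1 * (x$3)^3 + (- 4 * hP F - hW F) * (x$2)^3 * x$3 + (- 6 * hC F + 3 * hD F) * (x$2)^2 * (x$3)^2 + (- 3 *
      hQ F + 3 * hW F) * x$2 * (x$3)^3 + (- hC F - hD F) * (x$3)^4) * t + ?k * ((6 * hU F) * (x$1)^2 * x$3 + (12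
      * hP F + 3 * hQ F) * x$1 * x$2 * x$3 + (9 * hC F) * x$1 * (x$3)^2 + (- 3 * hU F + 3 * hV F) * (x$2)^2 *
      x$3 + (- 3 * hA F + 6 * hB F) * x$2 * (x$3)^2 + (- 3 * hU F - 3 * hV F) * (x$3)^3) * t^2 + ?k * ((4 * hU
      F) * x$1 * x$3 + (4 * hP F + hQ F) * x$2 * x$3 + (3 * hC F) * (x$3)^2) * t^3 + ?k * ((hU F) * x$3) * t^4 +
      ?k * (0) * t^5" for t
    unfolding crossP_axis3[OF assms] theta_def
    by (simp add: axis_def algebra_simps power2_eq_square power3_eq_cube power4_eq_xxxx)
  have e2: "crossP F S (x + t *\<^sub>R ax 2) = ?k * ((hU F) * (x$1)^4 * x$3 + (4 * hP F + hQ F) * (x$1)^3 * x$2 * x$3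
      + (3 * hC F) * (x$1)^3 * (x$3)^2 + (- 3 * hU F + 3 * hV F) * (x$1)^2 * (x$2)^2 * x$3 + (- 3 * hA F + 6 *
      hB F) * (x$1)^2 * x$2 * (x$3)^2 + (- 3 * hU F - 3 * hV F) * (x$1)^2 * (x$3)^3 + (- 4 * hP F - hW F) * x$1
      * (x$2)^3 * x$3 + (- 6 * hC F + 3 * hD F) * x$1 * (x$2)^2 * (x$3)^2 + (- 3 * hQ F + 3 * hW F) * x$1 * x$2
      * (x$3)^3 + (- hC F - hD F) * x$1 * (x$3)^4 + (- hV F) * (x$2)^4 * x$3 + (- 3 * hB F) * (x$2)^3 * (x$3)^2
      + (3 * hU F + 3 * hV F) * (x$2)^2 * (x$3)^3 + (hA F + hB F) * x$2 * (x$3)^4) + ?k * ((4 * hP F + hQ F) *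
      (x$1)^3 * x$3 + (- 6 * hU F + 6 * hV F) * (x$1)^2 * x$2 * x$3 + (- 3 * hA F + 6 * hB F) * (x$1)^2 *
      (x$3)^2 + (- 12 * hP F - 3 * hW F) * x$1 * (x$2)^2 * x$3 + (- 12 * hC F + 6 * hD F) * x$1 * x$2 * (x$3)^2
      + (- 3 * hQ F + 3 * hW F) * x$1 * (x$3)^3 + (- 4 * hV F) * (x$2)^3 * x$3 + (- 9 * hB F) * (x$2)^2 *
      (x$3)^2 + (6 * hU F + 6 * hV F) * x$2 * (x$3)^3 + (hA F + hB F) * (x$3)^4) * t + ?k * ((- 3 * hU F + 3 *
      hV F) * (x$1)^2 * x$3 + (- 12 * hP F - 3 * hW F) * x$1 * x$2 * x$3 + (- 6 * hC F + 3 * hD F) * x$1 *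
      (x$3)^2 + (- 6 * hV F) * (x$2)^2 * x$3 + (- 9 * hB F) * x$2 * (x$3)^2 + (3 * hU F + 3 * hV F) * (x$3)^3) *
      t^2 + ?k * ((- 4 * hP F - hW F) * x$1 * x$3 + (- 4 * hV F) * x$2 * x$3 + (- 3 * hB F) * (x$3)^2) * t^3 +
      ?k * ((- hV F) * x$3) * t^4 + ?k * (0) * t^5" for t
    unfolding crossP_axis3[OF assms] theta_def
    by (simp add: axis_def algebra_simps power2_eq_square power3_eq_cube power4_eq_xxxx)
  have e3: "crossP F S (x + t *\<^sub>R ax 3) = ?k * ((hU F) * (x$1)^4 * x$3 + (4 * hP F + hQ F) * (x$1)^3 * x$2 * x$3
      + (3 * hC F) * (x$1)^3 * (x$3)^2 + (- 3 * hU F + 3 * hV F) * (x$1)^2 * (x$2)^2 * x$3 + (- 3 * hA F + 6 *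
      hB F) * (x$1)^2 * x$2 * (x$3)^2 + (- 3 * hU F - 3 * hV F) * (x$1)^2 * (x$3)^3 + (- 4 * hP F - hW F) * x$1
      * (x$2)^3 * x$3 + (- 6 * hC F + 3 * hD F) * x$1 * (x$2)^2 * (x$3)^2 + (- 3 * hQ F + 3 * hW F) * x$1 * x$2
      * (x$3)^3 + (- hC F - hD F) * x$1 * (x$3)^4 + (- hV F) * (x$2)^4 * x$3 + (- 3 * hB F) * (x$2)^3 * (x$3)^2
      + (3 * hU F + 3 * hV F) * (x$2)^2 * (x$3)^3 + (hA F + hB F) * x$2 * (x$3)^4) + ?k * ((hU F) * (x$1)^4 + (4
      * hP F + hQ F) * (x$1)^3 * x$2 + (6 * hC F) * (x$1)^3 * x$3 + (- 3 * hU F + 3 * hV F) * (x$1)^2 * (x$2)^2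
      + (- 6 * hA F + 12 * hB F) * (x$1)^2 * x$2 * x$3 + (- 9 * hU F - 9 * hV F) * (x$1)^2 * (x$3)^2 + (- 4 * hP
      F - hW F) * x$1 * (x$2)^3 + (- 12 * hC F + 6 * hD F) * x$1 * (x$2)^2 * x$3 + (- 9 * hQ F + 9 * hW F) * x$1
      * x$2 * (x$3)^2 + (- 4 * hC F - 4 * hD F) * x$1 * (x$3)^3 + (- hV F) * (x$2)^4 + (- 6 * hB F) * (x$2)^3 *
      x$3 + (9 * hU F + 9 * hV F) * (x$2)^2 * (x$3)^2 + (4 * hA F + 4 * hB F) * x$2 * (x$3)^3) * t + ?k * ((3 *
      hC F) * (x$1)^3 + (- 3 * hA F + 6 * hB F) * (x$1)^2 * x$2 + (- 9 * hU F - 9 * hV F) * (x$1)^2 * x$3 + (- 6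
      * hC F + 3 * hD F) * x$1 * (x$2)^2 + (- 9 * hQ F + 9 * hW F) * x$1 * x$2 * x$3 + (- 6 * hC F - 6 * hD F) *
      x$1 * (x$3)^2 + (- 3 * hB F) * (x$2)^3 + (9 * hU F + 9 * hV F) * (x$2)^2 * x$3 + (6 * hA F + 6 * hB F) *
      x$2 * (x$3)^2) * t^2 + ?k * ((- 3 * hU F - 3 * hV F) * (x$1)^2 + (- 3 * hQ F + 3 * hW F) * x$1 * x$2 + (-
      4 * hC F - 4 * hD F) * x$1 * x$3 + (3 * hU F + 3 * hV F) * (x$2)^2 + (4 * hA F + 4 * hB F) * x$2 * x$3) *
      t^3 + ?k * ((- hC F - hD F) * x$1 + (hA F + hB F) * x$2) * t^4 + ?k * (0) * t^5" for t
    unfolding crossP_axis3[OF assms] theta_def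
    by (simp add: axis_def algebra_simps power2_eq_square power3_eq_cube power4_eq_xxxx)
  show ?thesis unfolding sum_3 e1 e2 e3 deriv2_quintic by (simp add: algebra_simps)
qed

text \<open>The derivative vanishes iff \<open>theta\<close> does not involve the third coordinate.
  This removes the weights 1, 2, 3 of the form and leaves weight 4 free.\<close>

lemma crossP_axis3_laplacian_zero:
  assumes "diag3 S" "S$1$1 = S$2$2" "S$1$1 \<noteq> S$3$3"
  shows "(\<forall>x. (\<Sum>k\<in>UNIV. deriv (deriv (\<lambda>t. crossP F S (x + t *\<^sub>R ax k))) 0) = 0) \<longleftrightarrow> wt034 F \<and> wt3z F"
proof
  assume "\<forall>x. (\<Sum>k\<in>UNIV. deriv (deriv (\<lambda>t. crossP F S (x + t *\<^sub>R ax k))) 0) = 0"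
  then have Z: "(3 * hC F) * (x$1)^3 + (- 3 * hA F + 6 * hB F) * (x$1)^2 * x$2 + (- 6 * hU F - 6 * hV F) *
      (x$1)^2 * x$3 + (- 6 * hC F + 3 * hD F) * x$1 * (x$2)^2 + (- 6 * hQ F + 6 * hW F) * x$1 * x$2 * x$3 + (- 3
      * hC F - 3 * hD F) * x$1 * (x$3)^2 + (- 3 * hB F) * (x$2)^3 + (6 * hU F + 6 * hV F) * (x$2)^2 * x$3 + (3 *
      hA F + 3 * hB F) * x$2 * (x$3)^2 = 0" for x :: "real^3"
    using crossP_axis3_laplacian[OF assms(1,2), of x] assms(3) by simp
  note Z' = Z[of "vector [_, _, _]", unfolded vector_3]
  show "wt034 F \<and> wt3z F"
    using Z'[of 1 0 1] Z'[of "-1" 0 1] Z'[of 0 1 1] Z'[of 0 "-1" 1] Z'[of 1 1 1] Z'[of 1 "-1" 1] Z'[of "-1" 1 1]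
        Z'[of 2 1 1] Z'[of 1 2 1]
      Z'[of 1 0 0] Z'[of 0 1 0] Z'[of 1 1 0] Z'[of 1 "-1" 0] Z'[of 1 0 2] Z'[of 0 1 2] Z'[of 2 1 0]
    unfolding wt034_def wt3z_def by simp
next
  assume "wt034 F \<and> wt3z F"
  then have w: "hW F = hQ F" "hV F = - hU F" "hA F = 0" "hB F = 0" "hC F = 0" "hD F = 0"
    by (auto simp: wt034_def wt3z_def)
  show "\<forall>x. (\<Sum>k\<in>UNIV. deriv (deriv (\<lambda>t. crossP F S (x + t *\<^sub>R ax k))) 0) = 0"
    unfolding crossP_axis3_laplacian[OF assms(1,2)] w by (simp add: algebra_simps)
qed

text \<open>Up to a nonzero factor the image is the matrix F(.,.,e3,e3). Its deviation from being
  axial consists of the weight 1 components A + B, C + D and the weight 2 components Q - W, U +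
  V.\<close>

lemma lmap_axis3_wt034:
  assumes "diag3 S" "S$1$1 = S$2$2" "S$1$1 \<noteq> S$3$3"
  shows "diag3 (lmap F S) \<and> lmap F S$1$1 = lmap F S$2$2 \<longleftrightarrow> wt034 F"
proof -
  let ?k = "S$3$3 - S$1$1"
  have k: "?k \<noteq> 0" using assms(3) by simp
  have e: "lmap F S$1$1 - lmap F S$2$2 = ?k * (hQ F - hW F)" "lmap F S$1$2 = ?k * (- hU F - hV F)" "lmap F S$2$1
      = ?k * (- hU F - hV F)"
    "lmap F S$1$3 = ?k * (- hA F - hB F)" "lmap F S$3$1 = ?k * (- hA F - hB F)"
    "lmap F S$2$3 = ?k * (- hC F - hD F)" "lmap F S$3$2 = ?k * (- hC F - hD F)"
    using assms(1,2) unfolding lmap_entry diag3_def by (simp_all add: algebra_simps)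
  have "lmap F S$1$1 = lmap F S$2$2 \<longleftrightarrow> ?k * (hQ F - hW F) = 0" using e(1) by auto
  then show ?thesis using k unfolding diag3_def e(2-) wt034_def by auto
qed

lemma crossQ_axis3_zero:
  assumes "diag3 S" "S$1$1 = S$2$2" "S$1$1 \<noteq> S$3$3"
  shows "(\<forall>x. crossQ S (lmap F S) x = 0) \<longleftrightarrow> wt034 F"
proof -
  let ?k = "S$3$3 - S$1$1" and ?L = "lmap F S"
  have k: "?k \<noteq> 0" using assms(3) by simp
  have s: "?L$2$1 = ?L$1$2" "?L$3$1 = ?L$1$3" "?L$3$2 = ?L$2$3" by (simp_all add: lmap_entry)
  have f: "crossQ S ?L x = ?k * x$3 * (x$2 * (?L *v x)$1 - x$1 * (?L *v x)$2)" for x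
    unfolding crossQ_def using assms(2)
    by (simp add: cross3_def inner_vec_def sum_3 diag3_vec[OF assms(1)] algebra_simps)
  have "(\<forall>x. crossQ S ?L x = 0) \<longleftrightarrow> diag3 ?L \<and> ?L$1$1 = ?L$2$2"
  proof
    assume a: "\<forall>x. crossQ S ?L x = 0"
    have z: "b * (?L *v (vector [a, b, 1]))$1 - a * (?L *v (vector [a, b, 1]))$2 = 0" for a b
      using a[rule_format, of "vector [a, b, 1]"] k unfolding f by simp
    note Z = z[unfolded matrix_vector_mult_def, simplified, unfolded sum_3, simplified]
    show "diag3 ?L \<and> ?L$1$1 = ?L$2$2"
      using Z[of 1 0] Z[of "-1" 0] Z[of 0 1] Z[of 0 "-1"] Z[of 1 1] unfolding diag3_def s by simp
  next
    assume "diag3 ?L \<and> ?L$1$1 = ?L$2$2"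
    then show "\<forall>x. crossQ S ?L x = 0" unfolding f by (simp add: diag3_vec)
  qed
  then show ?thesis using lmap_axis3_wt034[OF assms] by simp
qed

end

lemma scalar_vec: "(mat c :: real^3^3) *v x = c *\<^sub>R x"
  by (simp add: vec_eq_iff matrix_vector_mult_def mat_def if_distrib if_distribR sum.delta cong: if_cong)

lemma crossP_scalar: "crossP F (mat c) x = 0"
  by (simp add: crossP_def scalar_vec dot_cross_self inner_commute)

lemma crossQ_scalar: "crossQ (mat c) L x = 0"
  by (simp add: crossQ_def scalar_vec cross_mult_right)

section \<open>From index tensors to forms and matrices\<close>

text \<open>The sums are nested so as to match the recursion \<open>tact_Suc\<close> of the action
  on tensors.\<close>

definition tform :: "tensor \<Rightarrow> form4" where
  "tform H x y z w = (\<Sum>i\<in>UNIV. x$i * (\<Sum>j\<in>UNIV. y$j * (\<Sum>k\<in>UNIV. z$k * (\<Sum>l\<in>UNIV. w$l * H [i,j,k,l]))))"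

definition tmat :: "tensor \<Rightarrow> real^3^3" where
  "tmat a = (\<chi> i j. a [i, j])"

lemma sum_axis: "(\<Sum>i\<in>UNIV. ax j $ i * f i) = (f j :: real)"
  by (simp add: axis_def if_distrib if_distribR sum.delta cong: if_cong)

lemma tform_ax: "tform H (ax i) (ax j) (ax k) (ax l) = H [i, j, k, l]"
  by (simp add: tform_def sum_axis)

lemma sum_bilinear_swap:
  fixes f :: "3 \<Rightarrow> 3 \<Rightarrow> real"
  assumes "\<And>i j. f i j = f j i"
  shows "(\<Sum>i\<in>UNIV. x i * (\<Sum>j\<in>UNIV. y j * f i j)) = (\<Sum>i\<in>UNIV. y i * (\<Sum>j\<in>UNIV. x j * f i j))"
proof -
  have "(\<Sum>i\<in>UNIV. x i * (\<Sum>j\<in>UNIV. y j * f i j)) = (\<Sum>j\<in>UNIV. \<Sum>i\<in>UNIV. x i * (y j * f i j))"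
    unfolding sum_distrib_left by (rule sum.swap)
  also have "\<dots> = (\<Sum>j\<in>UNIV. \<Sum>i\<in>UNIV. y j * (x i * f j i))"
    using assms by (simp add: mult_ac)
  finally show ?thesis by (simp add: sum_distrib_left)
qed

lemma totsym4:
  assumes "totsym 4 H"
  shows "H [i,j,k,l] = H [j,i,k,l]" "H [i,j,k,l] = H [i,k,j,l]" "H [i,j,k,l] = H [i,j,l,k]"
proof -
  have u: "[0..<4] = [0, 1, 2, 3 :: nat]" by (simp add: upt_rec)
  have p: "Transposition.transpose m n permutes {0..<4}" if "m < 4" "n < 4" for m n :: nat
    using that by (intro permutes_swap_id) auto
  have e: "H (permute_list \<sigma> [i,j,k,l]) = H [i,j,k,l]" if "\<sigma> permutes {0..<4}" for \<sigma>
    using assms that by (simp add: totsym_def)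
  show "H [i,j,k,l] = H [j,i,k,l]"
    using e[OF p[of 0 1]] by (simp add: permute_list_def u Transposition.transpose_def)
  show "H [i,j,k,l] = H [i,k,j,l]"
    using e[OF p[of 1 2]] by (simp add: permute_list_def u Transposition.transpose_def)
  show "H [i,j,k,l] = H [i,j,l,k]"
    using e[OF p[of 2 3]] by (simp add: permute_list_def u Transposition.transpose_def)
qed

lemma harmonic_tform:
  assumes "harm4 H"
  shows "harmonic (tform H)"
proof -
  have s: "totsym 4 H" and t: "tzero 2 (ttr H)" using assms by (simp_all add: harm4_def)
  note S = totsym4[OF s]
  have tr: "(\<Sum>m\<in>UNIV. H [m,m,k,l]) = 0" for k l
    using t by (simp add: tzero_def teq_def ttr_def)
  show ?thesis
  proof (rule harmonic.intro)
    fix x y z w :: "real^3"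
    show "linear (\<lambda>x'. tform H x' y z w)"
      by (simp add: linear_iff tform_def algebra_simps sum.distrib sum_distrib_left)
    show "tform H x y z w = tform H y x z w"
      unfolding tform_def by (rule sum_bilinear_swap) (simp only: S(1))
    show "tform H x y z w = tform H x z y w"
      unfolding tform_def by (rule sum.cong[OF refl], rule arg_cong, rule sum_bilinear_swap) (simp only: S(2))
    show "tform H x y z w = tform H x y w z"
      unfolding tform_def by (rule sum.cong[OF refl], rule arg_cong, rule sum.cong[OF refl], rule arg_cong, rule
          sum_bilinear_swap) (rule S(3))
    have "(\<Sum>m\<in>UNIV. tform H (ax m) (ax m) z w) = (\<Sum>k\<in>UNIV. z$k * (\<Sum>l\<in>UNIV. w$l * (\<Sum>m\<in>UNIV. H [m,m,k,l])))"
      unfolding tform_def sum_axis unfolding sum_3 by (simp only: algebra_simps)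
    then show "(\<Sum>m\<in>UNIV. tform H (ax m) (ax m) z w) = 0" by (simp add: tr)
  qed
qed

lemma dten_tform:
  assumes "harm4 H"
  shows "dten (tform H) = tmat (d2 H)"
proof -
  have s: "totsym 4 H" using assms by (simp add: harm4_def)
  note S = totsym4[OF s]
  have a: "H [k,i,m,n] = H [i,k,m,n]" "H [m,n,k,j] = H [j,k,m,n]" for i j k m n
    by (rule S(1)) (metis S)
  have "d2 H [i, j] = (\<Sum>k\<in>UNIV. \<Sum>m\<in>UNIV. \<Sum>n\<in>UNIV. H [i,k,m,n] * H [j,k,m,n])" for i j
    unfolding d2_def tr13_def ddot44_def by simp (intro sum.cong refl arg_cong2[of _ _ _ _ "(*)"] a)
  then show ?thesis by (simp add: dten_def tmat_def tform_ax vec_eq_iff)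
qed

lemma lmap_tform:
  assumes "harm4 H"
  shows "lmap (tform H) (tmat a) = tmat (ddot42 H a)"
  by (simp add: vec_eq_iff lmap_entry_sum[OF harmonic_tform[OF assms]] tform_ax) (simp add: tmat_def ddot42_def)

lemma tmat_mprod: "tmat (mprod a b) = tmat a ** tmat b"
  by (simp add: tmat_def mprod_def vec_eq_iff matrix_matrix_mult_def)

lemma tmat_symprod: "tmat (symprod a b) = (1/2) *\<^sub>R (tmat a ** tmat b + tmat b ** tmat a)"
  unfolding tmat_mprod[symmetric] by (simp add: tmat_def symprod_def vec_eq_iff)

lemma sym_tl_tmat: "sym_traceless2 a \<Longrightarrow> sym_tl (tmat a)"
  by (simp add: sym_traceless2_def sym_tl_def tmat_def trace_def trace2_def vec_eq_iff
      Finite_Cartesian_Product.transpose_def)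

lemma length2: "length xs = 2 \<longleftrightarrow> (\<exists>i j. xs = [i, j])"
  by (auto simp: length_Suc_conv numeral_eq_Suc)

lemma length4: "length xs = 4 \<longleftrightarrow> (\<exists>i j k l. xs = [i, j, k, l])"
  by (auto simp: length_Suc_conv numeral_eq_Suc)

lemma teq2: "teq 2 S T \<longleftrightarrow> (\<forall>i j. S [i, j] = T [i, j])"
  by (auto simp: teq_def length2)

lemma teq4: "teq 4 S T \<longleftrightarrow> (\<forall>i j k l. S [i, j, k, l] = T [i, j, k, l])"
  by (auto simp: teq_def length4)

lemma tzero2: "tzero 2 a \<longleftrightarrow> tmat a = 0"
  by (simp add: tzero_def teq2 tmat_def vec_eq_iff)

lemma tzero2_dev: "tzero 2 (dev a) \<longleftrightarrow> (\<exists>c. tmat a = mat c)"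
proof -
  have "tzero 2 (dev a) \<longleftrightarrow> tmat a = mat (trace2 a / 3)"
    by (auto simp: tzero_def teq2 tmat_def dev_def vec_eq_iff mat_def kd_def)
  moreover have "trace2 a / 3 = c" if "tmat a = mat c" for c
  proof -
    have "a [k, k] = tmat a $ k $ k" for k by (simp add: tmat_def)
    then show ?thesis unfolding that trace2_def sum_3 by (simp add: mat_def)
  qed
  ultimately show ?thesis by metis
qed

lemma tact_Suc: "tact g (Suc n) T (i # xs) = (\<Sum>j\<in>UNIV. g$i$j * tact g n (\<lambda>js. T (j # js)) xs)"
  unfolding tact_def sum_lists_Suc
  by (simp add: prod.lessThan_Suc_shift sum_distrib_left mult_ac del: prod.lessThan_Suc)

lemma tact_0: "tact g 0 T xs = T []"
  by (simp add: tact_def)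

lemma tact2: "tact g 2 T [i, j] = cj g (tmat T) $ i $ j"
  by (simp add: numeral_2_eq_2 tact_Suc tact_0 cj_entry tmat_def sum_distrib_left mult_ac)

lemma tact4: "tact g 4 T [i, j, k, l] = tform T (g$i) (g$j) (g$k) (g$l)"
  by (simp add: numeral_eq_Suc tact_Suc tact_0 tform_def)

lemma symgroup2: "symgroup 2 a = msym {tmat a}"
  by (auto simp: symgroup_def msym_def teq2 tact2 vec_eq_iff) (simp_all add: tmat_def)

lemma fam_symgroup2: "fam_symgroup (map (Pair 2) L) = msym (tmat ` set L)"
  by (auto simp: fam_symgroup_def symgroup2 msym_def)

subsection \<open>The symmetry group of an elasticity tensor\<close>

definition bil :: "(3 \<Rightarrow> 3 \<Rightarrow> real) \<Rightarrow> real^3 \<Rightarrow> real^3 \<Rightarrow> real" where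
  "bil U x y = (\<Sum>i\<in>UNIV. x$i * (\<Sum>j\<in>UNIV. y$j * U i j))"

lemma tform_pair:
  "(\<Sum>i\<in>UNIV. x$i * (\<Sum>j\<in>UNIV. y$j * (\<Sum>k\<in>UNIV. z$k * (\<Sum>l\<in>UNIV. w$l * (U i j * V k l))))) = bil U x y * bil V z w"
  "(\<Sum>i\<in>UNIV. x$i * (\<Sum>j\<in>UNIV. y$j * (\<Sum>k\<in>UNIV. z$k * (\<Sum>l\<in>UNIV. w$l * (U i k * V j l))))) = bil U x z * bil V y w"
  "(\<Sum>i\<in>UNIV. x$i * (\<Sum>j\<in>UNIV. y$j * (\<Sum>k\<in>UNIV. z$k * (\<Sum>l\<in>UNIV. w$l * (U i l * V j k))))) = bil U x w * bil V y z"
  unfolding bil_def sum_3 by (simp_all only: algebra_simps)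

lemma bil_kd: "g \<in> SO3 \<Longrightarrow> bil kd (g$i) (g$j) = kd i j"
  using rows_inner[of g i j]
  by (simp add: bil_def kd_def if_distrib if_distribR sum.delta inner_vec_def cong: if_cong)

lemma bil_tmat: "bil (\<lambda>p q. a [p, q]) (g$i) (g$j) = cj g (tmat a) $ i $ j"
  by (simp add: bil_def cj_entry tmat_def sum_distrib_left mult_ac)

definition elast :: "real \<Rightarrow> real \<Rightarrow> (3 \<Rightarrow> 3 \<Rightarrow> real) \<Rightarrow> (3 \<Rightarrow> 3 \<Rightarrow> real) \<Rightarrow> 3 \<Rightarrow> 3 \<Rightarrow> 3 \<Rightarrow> 3 \<Rightarrow> real" where
  "elast lam mu A B i j k l = lam * kd i j * kd k l + mu * (kd i k * kd j l + kd i l * kd j k)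
        + kd i j * A k l + kd k l * A i j
        + kd i k * B j l + kd j l * B i k + kd i l * B j k + kd j k * B i l"

lemma tform_elast:
  assumes g: "g \<in> SO3" and E: "\<And>i j k l. E [i,j,k,l] = elast lam mu (\<lambda>p q. a [p,q]) (\<lambda>p q. b [p,q]) i j k l + H
      [i,j,k,l]"
  shows "tform E (g$i) (g$j) (g$k) (g$l)
    = elast lam mu (\<lambda>p q. cj g (tmat a) $ p $ q) (\<lambda>p q. cj g (tmat b) $ p $ q) i j k l + tform H (g$i) (g$j)
        (g$k) (g$l)"
proof -
  let ?a = "\<lambda>p q. a [p, q]" and ?b = "\<lambda>p q. b [p, q]"
  let ?S = "\<lambda>f. (\<Sum>p\<in>UNIV. g$i$p * (\<Sum>q\<in>UNIV. g$j$q * (\<Sum>r\<in>UNIV. g$k$r * (\<Sum>s\<in>UNIV. g$l$s * f p q r s))))"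
  have "tform E (g$i) (g$j) (g$k) (g$l) = ?S (\<lambda>p q r s. lam * (kd p q * kd r s) + mu * (kd p r * kd q s) + mu *
      (kd p s * kd q r)
     + kd p q * ?a r s + ?a p q * kd r s + kd p r * ?b q s + ?b p r * kd q s + kd p s * ?b q r + ?b p s * kd q r
         + H [p,q,r,s])"
    unfolding tform_def E elast_def by (simp add: algebra_simps)
  also have "\<dots> = lam * ?S (\<lambda>p q r s. kd p q * kd r s) + mu * ?S (\<lambda>p q r s. kd p r * kd q s) + mu * ?S (\<lambda>p q r s.
      kd p s * kd q r)
     + ?S (\<lambda>p q r s. kd p q * ?a r s) + ?S (\<lambda>p q r s. ?a p q * kd r s) + ?S (\<lambda>p q r s. kd p r * ?b q s) + ?S (\<lambda>p
         q r s. ?b p r * kd q s)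
     + ?S (\<lambda>p q r s. kd p s * ?b q r) + ?S (\<lambda>p q r s. ?b p s * kd q r) + ?S (\<lambda>p q r s. H [p,q,r,s])"
    by (simp add: distrib_left sum.distrib sum_distrib_left mult.left_commute)
  also have "?S (\<lambda>p q r s. H [p,q,r,s]) = tform H (g$i) (g$j) (g$k) (g$l)" by (simp add: tform_def)
  finally show ?thesis
    unfolding tform_pair[where U = kd and V = kd] tform_pair[where U = kd and V = ?a] tform_pair[where U = ?a
        and V = kd]
      tform_pair[where U = kd and V = ?b] tform_pair[where U = ?b and V = kd] bil_kd[OF g] bil_tmat elast_def
    by (simp add: algebra_simps)
qed

text \<open>Both contractions annihilate \<open>h\<close> and leave 3a + 4b and 2a + 5b besides
  isotropic terms; the determinant 3 * 5 - 4 * 2 = 7 is nonzero.\<close>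

lemma elast_injective:
  fixes a b a' b' :: "real^3^3" and h h' :: "3 \<Rightarrow> 3 \<Rightarrow> 3 \<Rightarrow> 3 \<Rightarrow> real"
  assumes e: "\<And>i j k l. elast lam mu (\<lambda>p q. a $ p $ q) (\<lambda>p q. b $ p $ q) i j k l + h i j k l
       = elast lam mu (\<lambda>p q. a' $ p $ q) (\<lambda>p q. b' $ p $ q) i j k l + h' i j k l"
    and t: "sym_tl a" "sym_tl b" "sym_tl a'" "sym_tl b'"
    and h: "\<And>k l. (\<Sum>i\<in>UNIV. h i i k l) = 0" "\<And>k l. (\<Sum>i\<in>UNIV. h i k i l) = 0"
    and h': "\<And>k l. (\<Sum>i\<in>UNIV. h' i i k l) = 0" "\<And>k l. (\<Sum>i\<in>UNIV. h' i k i l) = 0"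
  shows "a = a' \<and> b = b'"
proof -
  have tr: "M$1$1 + M$2$2 + M$3$3 = 0" if "sym_tl M" for M using sym_tl_entry(4)[OF that] by simp
  have c1: "(\<Sum>i\<in>UNIV. elast lam mu (\<lambda>p q. M $ p $ q) (\<lambda>p q. N $ p $ q) i i k l)
     = (3 * lam + 2 * mu) * kd k l + 3 * M$k$l + 2 * N$k$l + 2 * N$l$k" if "sym_tl M" for M N k l
    using tr[OF that] exhaust_3[of k] exhaust_3[of l] by (auto simp: elast_def sum_3 kd_def algebra_simps)
  have c2: "(\<Sum>i\<in>UNIV. elast lam mu (\<lambda>p q. M $ p $ q) (\<lambda>p q. N $ p $ q) i k i l)
     = (lam + 4 * mu) * kd k l + M$k$l + M$l$k + 5 * N$k$l" if "sym_tl M" "sym_tl N" for M N k l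
    using tr[OF that(1)] tr[OF that(2)] exhaust_3[of k] exhaust_3[of l]
    by (auto simp: elast_def sum_3 kd_def algebra_simps)
  have s: "M$l$k = M$k$l" if "sym_tl M" for M k l
    using that by (metis sym_tl_def transpose_entry)
  have 1: "3 * a$k$l + 4 * b$k$l = 3 * a'$k$l + 4 * b'$k$l" for k l
  proof -
    have "(\<Sum>i\<in>UNIV. elast lam mu (\<lambda>p q. a $ p $ q) (\<lambda>p q. b $ p $ q) i i k l + h i i k l)
      = (\<Sum>i\<in>UNIV. elast lam mu (\<lambda>p q. a' $ p $ q) (\<lambda>p q. b' $ p $ q) i i k l + h' i i k l)" by (simp only: e)
    then show ?thesis using s[OF t(2), of l k] s[OF t(4), of l k] unfolding sum.distrib h h' c1[OF t(1)] c1[OF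
        t(3)] by simp
  qed
  have 2: "2 * a$k$l + 5 * b$k$l = 2 * a'$k$l + 5 * b'$k$l" for k l
  proof -
    have "(\<Sum>i\<in>UNIV. elast lam mu (\<lambda>p q. a $ p $ q) (\<lambda>p q. b $ p $ q) i k i l + h i k i l)
      = (\<Sum>i\<in>UNIV. elast lam mu (\<lambda>p q. a' $ p $ q) (\<lambda>p q. b' $ p $ q) i k i l + h' i k i l)" by (simp only: e)
    then show ?thesis using s[OF t(1), of l k] s[OF t(2), of l k] s[OF t(3), of l k] s[OF t(4), of l k]
      unfolding sum.distrib h h' c2[OF t(1,2)] c2[OF t(3,4)] by simp
  qed
  have "a$k$l = a'$k$l \<and> b$k$l = b'$k$l" for k l using 1[of k l] 2[of k l] by linarith
  then show ?thesis by (simp add: vec_eq_iff)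
qed

lemma symgroup_elast:
  assumes a: "sym_traceless2 a" and b: "sym_traceless2 b" and H: "harm4 H"
    and E: "\<And>i j k l. E [i,j,k,l] = elast lam mu (\<lambda>p q. a [p,q]) (\<lambda>p q. b [p,q]) i j k l + H [i,j,k,l]"
  shows "symgroup 4 E = fsym (tform H) \<inter> msym {tmat a, tmat b}"
proof -
  interpret harmonic "tform H" by (rule harmonic_tform[OF H])
  have Em: "E [i,j,k,l] = elast lam mu (\<lambda>p q. tmat a $ p $ q) (\<lambda>p q. tmat b $ p $ q) i j k l + tform H (ax i)
      (ax j) (ax k) (ax l)" for i j k l
    using E by (simp add: tform_ax tmat_def)
  have tr: "(\<Sum>i\<in>UNIV. F (ax i) (ax i) (ax k) (ax l)) = 0" "(\<Sum>i\<in>UNIV. F (ax i) (ax k) (ax i) (ax l)) = 0"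
    if "harmonic F" for F k l
  proof -
    interpret F: harmonic F by fact
    show "(\<Sum>i\<in>UNIV. F (ax i) (ax i) (ax k) (ax l)) = 0" by (rule F.tr12)
    then show "(\<Sum>i\<in>UNIV. F (ax i) (ax k) (ax i) (ax l)) = 0" by (subst F.sym23)
  qed
  have "g \<in> symgroup 4 E \<longleftrightarrow> g \<in> fsym (tform H) \<inter> msym {tmat a, tmat b}" for g
  proof (cases "g \<in> SO3")
    case True
    let ?G = "rot4 g (tform H)"
    have G: "harmonic ?G" by (rule harmonic_rot4[OF harmonic_axioms True])
    have r: "tform H (g$i) (g$j) (g$k) (g$l) = ?G (ax i) (ax j) (ax k) (ax l)" for i j k l
      by (simp add: rot4_def transpose_ax)
    have "g \<in> symgroup 4 E \<longleftrightarrow> (\<forall>i j k l. elast lam mu (\<lambda>p q. cj g (tmat a) $ p $ q) (\<lambda>p q. cj g (tmat b) $ p $ q)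
        i j k l + ?G (ax i) (ax j) (ax k) (ax l)
       = elast lam mu (\<lambda>p q. tmat a $ p $ q) (\<lambda>p q. tmat b $ p $ q) i j k l + tform H (ax i) (ax j) (ax k) (ax l))"
      using True by (simp add: symgroup_def teq4 tact4 tform_elast[OF True E] r Em)
    also have "\<dots> \<longleftrightarrow> cj g (tmat a) = tmat a \<and> cj g (tmat b) = tmat b \<and> ?G = tform H" (is "?L \<longleftrightarrow> ?R")
    proof
      assume L: ?L
      have ab: "cj g (tmat a) = tmat a \<and> cj g (tmat b) = tmat b"
        by (rule elast_injective[OF L[rule_format]]) (use a b sym_tl_tmat sym_tl_cj[OF True] tr G
            harmonic_axioms in auto)
      then have e: "?G (ax i) (ax j) (ax k) (ax l) = tform H (ax i) (ax j) (ax k) (ax l)" for i j k l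
        using L by simp
      have "?G = tform H"
        by (rule harmonic_eqI[OF G harmonic_axioms]) (simp_all only: hP_def hQ_def hW_def hU_def hV_def hA_def
            hB_def hC_def hD_def e)
      then show ?R using ab by simp
    next
      assume ?R then show ?L by simp
    qed
    finally show ?thesis using True by (auto simp: fsym_def msym_def)
  next
    case False
    then show ?thesis by (simp add: symgroup_def fsym_def)
  qed
  then show ?thesis by blast
qed

section \<open>Cross products of tensors as polynomials\<close>

lemma mf_grad: "(\<chi> j. mf 3 (\<lambda>r. H (j # r)) x) = grad (tform H) x"
  by (simp add: vec_eq_iff grad_def tform_def sum_axis numeral_3_eq_3)

lemma mf_tmat: "(\<chi> k. mf 1 (\<lambda>r. a (k # r)) x) = tmat a *v x"
  by (simp add: vec_eq_iff tmat_def matrix_vector_mult_def mult.commute)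

lemma mf_gcross42: "mf 5 (gcross 4 H 2 a) x = crossP (tform H) (tmat a) x"
  using mf_gcross[of 3 1 H a x] unfolding mf_grad mf_tmat crossP_def by (simp add: numeral_2_eq_2)

lemma swapsym_gcross42: "swapsym 5 (gcross 4 H 2 a)"
  unfolding gcross_def using swapsym_tsymmetrize[of 5] by simp

lemma tzero_gcross42: "tzero 5 (gcross 4 H 2 a) \<longleftrightarrow> (\<forall>x. crossP (tform H) (tmat a) x = 0)"
  unfolding tzero_iff_mf[OF swapsym_gcross42] mf_gcross42 ..

lemma all_rotated_iff:
  assumes "g \<in> SO3"
  shows "(\<forall>x. P (transpose g *v x)) \<longleftrightarrow> (\<forall>x. P x)"
proof
  assume a: "\<forall>x. P (transpose g *v x)"
  have "transpose g *v (g *v x) = x" for x using assms by (simp add: matrix_vector_mul_assoc SO3_orth)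
  then show "\<forall>x. P x" using a by metis
qed simp

lemma tzero_ttr_gcross42:
  assumes "harm4 H" "g \<in> SO3"
  shows "tzero 3 (ttr (gcross 4 H 2 a)) \<longleftrightarrow>
    (\<forall>x. (\<Sum>k\<in>UNIV. deriv (deriv (\<lambda>t. crossP (rot4 g (tform H)) (cj g (tmat a)) (x + t *\<^sub>R ax k))) 0) = 0)"
proof -
  note h = harmonic_tform[OF assms(1)]
  have "(\<Sum>k\<in>UNIV. deriv (deriv (\<lambda>t. crossP (rot4 g (tform H)) (cj g (tmat a)) (x + t *\<^sub>R ax k))) 0)
     = 20 * mf 3 (ttr (gcross 4 H 2 a)) (transpose g *v x)" for x
    unfolding crossP_rot4[OF h assms(2)] matrix_vector_right_distrib matrix_vector_mult_scaleR transpose_ax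
        mf_gcross42[symmetric]
    by (rule mf_laplacian[OF swapsym_gcross42 assms(2)])
  then show ?thesis using all_rotated_iff[OF assms(2), of "\<lambda>x. mf 3 (ttr (gcross 4 H 2 a)) x = 0"]
    unfolding tzero_iff_mf[OF swapsym_ttr[OF swapsym_gcross42]] by simp
qed

lemma tzero_gcross22: "tzero 3 (gcross 2 a 2 c) \<longleftrightarrow> (\<forall>x. crossQ (tmat a) (tmat c) x = 0)"
proof -
  have "swapsym 3 (gcross 2 a 2 c)" unfolding gcross_def using swapsym_tsymmetrize[of 3] by simp
  moreover have "mf 3 (gcross 2 a 2 c) x = crossQ (tmat a) (tmat c) x" for x
    using mf_gcross[of 1 1 a c x] unfolding mf_tmat crossQ_def by (simp add: numeral_2_eq_2 numeral_3_eq_3)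
  ultimately show ?thesis using tzero_iff_mf by simp
qed

section \<open>Reduction to second-order covariants\<close>

lemma fsym_fixes_dten:
  assumes "harmonic F" "g \<in> fsym F"
  shows "cj g (dten F) = dten F"
  using dten_rot4[OF assms(1), of g] assms(2) by (simp add: fsym_def)

lemma fsym_lmap:
  assumes "harmonic F" "g \<in> fsym F" "cj g A = A"
  shows "cj g (lmap F A) = lmap F A"
  using lmap_rot4[OF assms(1), of g A] assms(2,3) by (simp add: fsym_def)

definition famM :: "form4 \<Rightarrow> real^3^3 \<Rightarrow> real^3^3 \<Rightarrow> (real^3^3) set" where
  "famM F A B = famO F A B \<union> {lmap F ((1/2) *\<^sub>R (A ** B + B ** A)), lmap F ((1/2) *\<^sub>R (A ** dten F + dten F ** A)),
     lmap F ((1/2) *\<^sub>R (B ** dten F + dten F ** B))}"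

lemma group_subset_famM:
  assumes "harmonic F"
  shows "fsym F \<inter> msym {A, B} \<subseteq> msym (famM F A B)"
proof
  fix g assume a: "g \<in> fsym F \<inter> msym {A, B}"
  then have g: "g \<in> SO3" "cj g A = A" "cj g B = B" by (auto simp: msym_def)
  have D: "cj g (dten F) = dten F" using fsym_fixes_dten[OF assms] a by blast
  have L: "cj g (lmap F M) = lmap F M" if "cj g M = M" for M using fsym_lmap[OF assms _ that] a by blast
  have P: "cj g (M ** N) = M ** N" if "cj g M = M" "cj g N = N" for M N using that g by (simp add: cj_mult)
  have "cj g M = M" if "M \<in> famM F A B" for M
    using that D g unfolding famM_def famO_def by (auto intro!: L P simp: cj_scaleR cj_add P)
  then show "g \<in> msym (famM F A B)" using g(1) by (simp add: msym_def)
qed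

lemma famO_subset_famM: "famO F A B \<subseteq> famM F A B"
  by (auto simp: famM_def)

lemma famO_symmetric:
  assumes "harmonic F" "sym_tl A" "sym_tl B" "M \<in> famO F A B"
  shows "transpose M = M"
proof -
  interpret harmonic F by fact
  have "transpose (lmap F N) = lmap F N" for N
    by (simp add: mat3_eq_iff transpose_entry lmap_entry)
  moreover have "transpose (dten F) = dten F" by (simp add: mat3_eq_iff transpose_entry dten_entry)
  ultimately show ?thesis using assms(2-4) by (auto simp: famO_def sym_tl_def)
qed

lemma rotz_pi_fixes:
  assumes "harmonic F"
  shows "hA F = 0 \<and> hB F = 0 \<and> hC F = 0 \<and> hD F = 0 \<Longrightarrow> rot4 (rotz pi) F = F"
proof -
  interpret harmonic F by fact
  assume "hA F = 0 \<and> hB F = 0 \<and> hC F = 0 \<and> hD F = 0"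
  then show ?thesis
    by (intro harmonic_eqI[OF harmonic_rot4[OF harmonic_axioms rotz_SO3] harmonic_axioms]) (simp_all add: rotz_params)
qed

lemma noncoaxial_msym_subset:
  assumes h: "harmonic F" and st: "sym_tl A" "sym_tl B" and nc: "\<not> coaxial (famO F A B)"
  shows "msym (famO F A B) \<subseteq> fsym F"
proof
  fix g assume g: "g \<in> msym (famO F A B)"
  from msym_half_turns[OF famO_symmetric[OF h st] nc g]
  show "g \<in> fsym F"
  proof
    assume "\<exists>k\<in>SO3. g = cj k (rotz pi)"
    then obtain k where k: "k \<in> SO3" "g = cj k (rotz pi)" by blast
    define r where "r = transpose k"
    have r: "r \<in> SO3" using k by (simp add: r_def SO3_transpose)
    let ?G = "rot4 r F"
    interpret G: harmonic ?G by (rule harmonic_rot4[OF h r])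
    note im = famO_rot4[OF h r, of A B]
    have gr: "rotz pi = cj r g" using k by (simp add: r_def cj_inv)
    \<comment> \<open>Being fixed by the half-turn about the third axis is block form, which is the
      hypothesis of \<open>common_eigenvector_odd_zero\<close> in this frame.\<close>
    have bl: "block M" if M: "M \<in> famO ?G (cj r A) (cj r B)" for M
    proof -
      obtain N where N: "N \<in> famO F A B" "M = cj r N" using M unfolding im by blast
      then have "cj g N = N" using g by (simp add: msym_def)
      then have "cj (rotz pi) M = M" using r N(2) by (simp add: gr cj_fix_cj)
      then have "cj (rotz pi) M $ i $ j = M $ i $ j" for i j by simp
      from this[of 1 3] this[of 2 3] this[of 3 1] this[of 3 2] show ?thesis
        by (simp add: cj_rotz_entry block_def)
    qed
    have "\<not> coaxial (famO ?G (cj r A) (cj r B))" using nc r by (simp add: im coaxial_cj_iff)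
    then have "rot4 (rotz pi) ?G = ?G"
      using G.common_eigenvector_odd_zero[OF sym_tl_cj[OF r st(1)] sym_tl_cj[OF r st(2)] bl] rotz_pi_fixes[OF
          G.harmonic_axioms]
      by blast
    then have "rot4 g F = F" using r by (simp add: gr rot4_fix_conj)
    then show ?thesis using g by (simp add: fsym_def msym_def)
  next
    assume "g = mat 1"
    moreover have "mat 1 \<in> fsym F" by (simp add: fsym_def)
    ultimately show ?thesis by (simp only:)
  qed
qed

lemma noncoaxial_group:
  assumes h: "harmonic F" and st: "sym_tl A" "sym_tl B" and nc: "\<not> coaxial (famO F A B)"
  shows "fsym F \<inter> msym {A, B} = msym (famO F A B)" "fsym F \<inter> msym {A, B} = msym (famM F A B)"
proof -
  have "{A, B} \<subseteq> famO F A B" by (auto simp: famO_def)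
  then have "msym (famO F A B) \<subseteq> fsym F \<inter> msym {A, B}"
    using noncoaxial_msym_subset[OF assms] msym_mono by blast
  then show "fsym F \<inter> msym {A, B} = msym (famO F A B)" "fsym F \<inter> msym {A, B} = msym (famM F A B)"
    using group_subset_famM[OF h, of A B] msym_mono[OF famO_subset_famM[of F A B]] by blast+
qed

text \<open>The group contains a conjugate of \<open>O2\<close>, hence a rotation of trace 1/2; this
  rules out the classes of \<open>DD 2\<close> and \<open>ZZ 2\<close>.\<close>

lemma coaxial_trace:
  assumes "coaxial \<F>"
  shows "1/2 \<in> trace ` msym \<F>"
proof -
  obtain g where g: "g \<in> SO3" "\<And>M. M \<in> \<F> \<Longrightarrow> diag3 (cj g M) \<and> cj g M$1$1 = cj g M$2$2"
    using coaxial_frame[OF assms] by blast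
  have "O2 \<subseteq> msym (cj g ` \<F>)" using g(2) axis3_fixed_by_O2 O2_SO3 by (auto simp: msym_def)
  then have "trace ` O2 \<subseteq> trace ` cj g ` msym \<F>" unfolding msym_image[OF g(1)] by blast
  then have "1/2 \<in> trace ` cj g ` msym \<F>" using trace_classes(13) by blast
  then show ?thesis using g(1) by (simp add: image_image cj_trace)
qed

lemma axis3_products:
  assumes "diag3 M" "M$1$1 = M$2$2" "diag3 N" "N$1$1 = N$2$2"
  shows "diag3 ((1/2) *\<^sub>R (M ** N + N ** M)) \<and> ((1/2) *\<^sub>R (M ** N + N ** M))$1$1 = ((1/2) *\<^sub>R (M ** N + N ** M))$2$2"
  using assms by (simp add: diag3_def mm3)

text \<open>For scalar factors the symmetrized product is scalar and \<open>lmap\<close> kills it.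
  If one factor is nonscalar, its image under \<open>lmap\<close> is already axial, which gives
  \<open>wt034\<close>, and then \<open>lmap\<close> preserves the common axis.\<close>

lemma famO_coaxial_famM:
  assumes h: "harmonic F" and c: "coaxial (famO F A B)"
  shows "coaxial (famM F A B)"
proof -
  obtain g where g: "g \<in> SO3" "\<And>M. M \<in> famO F A B \<Longrightarrow> diag3 (cj g M) \<and> cj g M$1$1 = cj g M$2$2"
    using coaxial_frame[OF c] by blast
  let ?G = "rot4 g F" and ?A = "cj g A" and ?B = "cj g B"
  let ?P = "\<lambda>M. diag3 M \<and> M$1$1 = M$2$2"
  interpret G: harmonic ?G by (rule harmonic_rot4[OF h g(1)])
  have im: "famO ?G ?A ?B = cj g ` famO F A B" by (rule famO_rot4[OF h g(1)])
  have P: "?P M" if "M \<in> famO ?G ?A ?B" for M using that g(2) unfolding im by blast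
  have b: "?P (dten ?G)" "?P ?A" "?P ?B" "?P (lmap ?G (dten ?G))" "?P (lmap ?G ?A)" "?P (lmap ?G ?B)"
    by (rule P, simp add: famO_def)+
  have L: "?P (lmap ?G ((1/2) *\<^sub>R (M ** N + N ** M)))" if MN: "M \<in> {dten ?G, ?A, ?B}" "N \<in> {dten ?G, ?A, ?B}" for M N
  proof -
    let ?S = "(1/2) *\<^sub>R (M ** N + N ** M)"
    have p: "?P M" "?P N" "?P (lmap ?G M)" "?P (lmap ?G N)" using MN b by auto
    then have S: "?P ?S" using axis3_products by blast
    show ?thesis
    proof (cases "M$1$1 = M$3$3 \<and> N$1$1 = N$3$3")
      case True
      then have "?S$1$1 = ?S$3$3" using p by (simp add: diag3_def mm3)
      then have "\<exists>c. ?S = mat c" using S by (subst mat_scalar_iff) simp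
      then obtain c where "?S = mat c" ..
      then show ?thesis using G.lmap_mat by (simp add: diag3_def)
    next
      case False
      then have w: "wt034 ?G" using G.lmap_axis3_wt034 p by blast
      show ?thesis
      proof (cases "?S$1$1 = ?S$3$3")
        case True
        then have "\<exists>c. ?S = mat c" using S by (subst mat_scalar_iff) simp
        then obtain c where "?S = mat c" ..
        then show ?thesis using G.lmap_mat by (simp add: diag3_def)
      next
        case False
        then show ?thesis using G.lmap_axis3_wt034 S w by blast
      qed
    qed
  qed
  have imM: "famM ?G ?A ?B = cj g ` famM F A B"
    by (simp add: famM_def image_Un im dten_rot4[OF h g(1)] cj_mult[OF g(1), symmetric] cj_add[symmetric]
        cj_scaleR[symmetric] lmap_rot4[OF h g(1)])
  have "?P M" if "M \<in> famM ?G ?A ?B" for M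
    using that P L by (auto simp: famM_def)
  then have "coaxial (famM ?G ?A ?B)" unfolding coaxial_def
    by (intro exI[of _ "ax 3"]) (use axial_ax(3) in auto)
  then show ?thesis using g(1) by (simp add: imM coaxial_cj_iff)
qed

section \<open>The isotropic and the cubic class\<close>

lemma zero_form: "harmonic (\<lambda>_ _ _ _. 0)"
  by (rule harmonic.intro) (simp_all add: linear_iff)

lemma params_zero:
  assumes "harmonic F" "hP F = 0" "hQ F = 0" "hW F = 0" "hU F = 0" "hV F = 0" "hA F = 0" "hB F = 0" "hC F = 0"
      "hD F = 0"
  shows "F = (\<lambda>_ _ _ _. 0)"
  by (rule harmonic_eqI[OF assms(1) zero_form])
     (simp_all add: assms, simp_all add: hP_def hQ_def hW_def hU_def hV_def hA_def hB_def hC_def hD_def)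

lemma dten_zero:
  assumes "harmonic F" "dten F = 0"
  shows "F = (\<lambda>_ _ _ _. 0)"
proof -
  have "F (ax i) (ax p) (ax q) (ax r) = 0" for i p q r
  proof -
    have "dten F $ i $ i = 0" using assms(2) by simp
    then have s: "(\<Sum>p\<in>UNIV. \<Sum>q\<in>UNIV. \<Sum>r\<in>UNIV. F (ax i) (ax p) (ax q) (ax r) * F (ax i) (ax p) (ax q) (ax r)) = 0"
      by (simp add: dten_def)
    have "(\<Sum>q\<in>UNIV. \<Sum>r\<in>UNIV. F (ax i) (ax p) (ax q) (ax r) * F (ax i) (ax p) (ax q) (ax r)) = 0"
      using s by (subst (asm) sum_nonneg_eq_0_iff) (auto intro!: sum_nonneg)
    then have "(\<Sum>r\<in>UNIV. F (ax i) (ax p) (ax q) (ax r) * F (ax i) (ax p) (ax q) (ax r)) = 0"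
      by (subst (asm) sum_nonneg_eq_0_iff) (auto intro!: sum_nonneg)
    then show ?thesis by (subst (asm) sum_nonneg_eq_0_iff) auto
  qed
  then show ?thesis
    by (intro params_zero[OF assms(1)]) (simp_all add: hP_def hQ_def hW_def hU_def hV_def hA_def hB_def hC_def hD_def)
qed

lemma dten_of_zero: "dten (\<lambda>_ _ _ _. 0) = 0"
  by (simp add: dten_def vec_eq_iff)

lemma isotropic_class:
  assumes "harmonic F" "dten F = 0"
  shows "fsym F \<inter> msym {0, 0} = SO3"
  using dten_zero[OF assms] by (auto simp: fsym_def msym_def rot4_def cj_def)

lemma cubic_class:
  assumes h: "harmonic F" and D: "dten F = mat c" "dten F \<noteq> 0"
  shows "in_class (fsym F \<inter> msym {0, 0}) Oct"
proof -
  obtain g where g: "g \<in> SO3" "cubic (rot4 g F)" using cubic_frame[OF h D(1)] by blast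
  have hg: "harmonic (rot4 g F)" by (rule harmonic_rot4[OF h g(1)])
  have "hP (rot4 g F) \<noteq> 0"
  proof
    assume "hP (rot4 g F) = 0"
    then have "rot4 g F = (\<lambda>_ _ _ _. 0)" using g(2) by (intro params_zero[OF hg]) (simp_all add: cubic_def)
    then have "cj g (dten F) = 0" using dten_rot4[OF h g(1)] dten_of_zero by simp
    then have "cj g (dten F) = cj g 0" by (simp add: cj_def)
    then show False using D(2) cj_inject[OF g(1)] by blast
  qed
  then have "fsym (rot4 g F) = Oct" using fsym_cubic[OF hg g(2)] by blast
  then have "in_class (cj g ` fsym F) Oct" using in_class_refl fsym_rot4[OF g(1)] by metis
  then have "in_class (fsym F) Oct" using in_class_cj_image[OF g(1)] by blast
  moreover have "fsym F \<inter> msym {0, 0} = fsym F" by (auto simp: fsym_def msym_def cj_def)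
  ultimately show ?thesis by simp
qed

section \<open>Assembling the classification\<close>

text \<open>A member that is scalar satisfies all three kinds of equations trivially. Every
  nonscalar member yields the same condition on the weights of \<open>G\<close>, and at least one
  exists.\<close>

lemma axial_frame_conditions:
  fixes H a b :: tensor
  assumes H: "harm4 H" and g: "g \<in> SO3"
    and P: "\<forall>s\<in>{d2 H, a, b}. diag3 (cj g (tmat s)) \<and> cj g (tmat s)$1$1 = cj g (tmat s)$2$2"
    and N: "\<exists>s\<in>{d2 H, a, b}. cj g (tmat s)$1$1 \<noteq> cj g (tmat s)$3$3"
  defines "F \<equiv> tform H"
  defines "G \<equiv> rot4 g F"
  shows "(\<forall>s\<in>{d2 H, a, b}. tzero 5 (gcross 4 H 2 s)) \<longleftrightarrow> wt034 G \<and> wt3z G \<and> wt4z G"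
    "(\<forall>s\<in>{d2 H, a, b}. tzero 3 (ttr (gcross 4 H 2 s))) \<longleftrightarrow> wt034 G \<and> wt3z G"
    "(\<forall>s\<in>{d2 H, a, b}. tzero 3 (gcross 2 s 2 (ddot42 H s))) \<longleftrightarrow> wt034 G"
    "in_class (fsym F \<inter> msym {tmat a, tmat b}) K \<longleftrightarrow> in_class (fsym G \<inter> O2) K"
    "wt034 G \<Longrightarrow> wt3z G \<or> wt4z G"
proof -
  have h: "harmonic F" unfolding F_def by (rule harmonic_tform[OF H])
  interpret G: harmonic G unfolding G_def by (rule harmonic_rot4[OF h g])
  have sc: "\<exists>c. cj g (tmat s) = mat c" if "s \<in> {d2 H, a, b}" "cj g (tmat s)$1$1 = cj g (tmat s)$3$3" for s
    using bspec[OF P that(1)] that(2) by (subst mat_scalar_iff) simp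
  have c5: "tzero 5 (gcross 4 H 2 s) \<longleftrightarrow> (\<forall>x. crossP G (cj g (tmat s)) x = 0)" for s
    unfolding tzero_gcross42 G_def crossP_rot4[OF h g] F_def[symmetric] by (rule all_rotated_iff[OF g, symmetric])
  have c3: "tzero 3 (ttr (gcross 4 H 2 s)) \<longleftrightarrow>
     (\<forall>x. (\<Sum>k\<in>UNIV. deriv (deriv (\<lambda>t. crossP G (cj g (tmat s)) (x + t *\<^sub>R ax k))) 0) = 0)" for s
    unfolding G_def F_def by (rule tzero_ttr_gcross42[OF H g])
  have c2: "tzero 3 (gcross 2 s 2 (ddot42 H s)) \<longleftrightarrow> (\<forall>x. crossQ (cj g (tmat s)) (lmap G (cj g (tmat s))) x = 0)" for s
    unfolding tzero_gcross22 G_def lmap_rot4[OF h g] crossQ_cj[OF g] lmap_tform[OF H, symmetric] F_def[symmetric]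
    by (rule all_rotated_iff[OF g, symmetric])
  have "tzero 5 (gcross 4 H 2 s) \<and> tzero 3 (ttr (gcross 4 H 2 s)) \<and> tzero 3 (gcross 2 s 2 (ddot42 H s))"
    if s: "s \<in> {d2 H, a, b}" "cj g (tmat s)$1$1 = cj g (tmat s)$3$3" for s
  proof -
    obtain c where "cj g (tmat s) = mat c" using sc[OF s] by blast
    then show ?thesis unfolding c5 c3 c2 by (simp add: crossP_scalar crossQ_scalar)
  qed
  note trivial = this
  have n5: "tzero 5 (gcross 4 H 2 s) \<longleftrightarrow> wt034 G \<and> wt3z G \<and> wt4z G"
    and n3: "tzero 3 (ttr (gcross 4 H 2 s)) \<longleftrightarrow> wt034 G \<and> wt3z G"
    and n2: "tzero 3 (gcross 2 s 2 (ddot42 H s)) \<longleftrightarrow> wt034 G"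
    if "s \<in> {d2 H, a, b}" "cj g (tmat s)$1$1 \<noteq> cj g (tmat s)$3$3" for s
    using bspec[OF P that(1)] that(2) unfolding c5 c3 c2
    by (simp_all add: G.crossP_axis3_zero G.crossP_axis3_laplacian_zero G.crossQ_axis3_zero)
  show "(\<forall>s\<in>{d2 H, a, b}. tzero 5 (gcross 4 H 2 s)) \<longleftrightarrow> wt034 G \<and> wt3z G \<and> wt4z G"
    using N n5 trivial by blast
  show "(\<forall>s\<in>{d2 H, a, b}. tzero 3 (ttr (gcross 4 H 2 s))) \<longleftrightarrow> wt034 G \<and> wt3z G"
    using N n3 trivial by blast
  show "(\<forall>s\<in>{d2 H, a, b}. tzero 3 (gcross 2 s 2 (ddot42 H s))) \<longleftrightarrow> wt034 G"
    using N n2 trivial by blast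
  have D: "dten F = tmat (d2 H)" unfolding F_def by (rule dten_tform[OF H])
  have m: "msym (cj g ` {tmat (d2 H), tmat a, tmat b}) = O2"
  proof -
    obtain s where s: "s \<in> {d2 H, a, b}" "cj g (tmat s)$1$1 \<noteq> cj g (tmat s)$3$3" using N by blast
    show ?thesis by (rule msym_O2[of _ "cj g (tmat s)"]) (use P s in auto)
  qed
  have "fsym F \<inter> msym {tmat a, tmat b} = fsym F \<inter> msym {tmat (d2 H), tmat a, tmat b}"
    using fsym_fixes_dten[OF h] unfolding D by (auto simp: msym_def)
  then have "cj g ` (fsym F \<inter> msym {tmat a, tmat b}) = cj g ` fsym F \<inter> cj g ` msym {tmat (d2 H), tmat a, tmat b}"
    using cj_inject[OF g] by (simp add: image_Int inj_def)
  also have "\<dots> = fsym G \<inter> O2" unfolding G_def fsym_rot4[OF g] msym_image[OF g, symmetric] m ..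
  finally show "in_class (fsym F \<inter> msym {tmat a, tmat b}) K \<longleftrightarrow> in_class (fsym G \<inter> O2) K"
    using in_class_cj_image[OF g] by metis
  have "dten G = cj g (tmat (d2 H))" unfolding G_def dten_rot4[OF h g] D ..
  then show "wt034 G \<Longrightarrow> wt3z G \<or> wt4z G" using G.wt034_split bspec[OF P, of "d2 H"] by (simp add: diag3_def)
qed

text \<open>Since the eight classes are pairwise disjoint, it suffices to prove that each condition forces its class
  and that a tensor satisfying none of the conditions has trivial symmetry group.\<close>

theorem theorem10p2:
  fixes E H a b :: tensor and lam mu :: real
  assumes elas: "elasticity E"
    and a_st: "sym_traceless2 a" and b_st: "sym_traceless2 b"
    and H_harm: "harm4 H"
    and decomp: "\<And>i j k l. E [i,j,k,l] =
        lam * kd i j * kd k l + mu * (kd i k * kd j l + kd i l * kd j k)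
        + kd i j * a [k,l] + kd k l * a [i,j]
        + kd i k * b [j,l] + kd j l * b [i,k] + kd i l * b [j,k] + kd j k * b [i,l]
        + H [i,j,k,l]"
  defines "D \<equiv> d2 H"
  defines "TI \<equiv> in_class (fam_symgroup [(2, D), (2, a), (2, b)]) O2"
    and "FO \<equiv> [(2, D), (2, a), (2, b), (2, c3 H), (2, c4 H), (2, ddot42 H a), (2, ddot42 H b),
               (2, ddot42 H (mprod a a)), (2, ddot42 H (mprod b b))]"
  defines "FM \<equiv> FO @ [(2, ddot42 H (symprod a b)), (2, ddot42 H (symprod a D)),
                      (2, ddot42 H (symprod b D))]"
  defines "C1 \<equiv> tzero 2 a \<and> tzero 2 b \<and> tzero 2 D"
    and "C2 \<equiv> tzero 2 a \<and> tzero 2 b \<and> tzero 2 (dev D) \<and> \<not> tzero 2 D"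
    and "C3 \<equiv> TI \<and> tzero 5 (gcross 4 H 2 D) \<and> tzero 5 (gcross 4 H 2 a) \<and> tzero 5 (gcross 4 H 2 b)"
    and "C4 \<equiv> TI \<and> tzero 3 (ttr (gcross 4 H 2 D)) \<and> tzero 3 (ttr (gcross 4 H 2 a))
              \<and> tzero 3 (ttr (gcross 4 H 2 b))
              \<and> (\<not> tzero 5 (gcross 4 H 2 D) \<or> \<not> tzero 5 (gcross 4 H 2 a) \<or> \<not> tzero 5 (gcross 4 H 2 b))"
    and "C5 \<equiv> TI \<and> tzero 3 (gcross 2 D 2 (ddot42 H D)) \<and> tzero 3 (gcross 2 a 2 (ddot42 H a))
              \<and> tzero 3 (gcross 2 b 2 (ddot42 H b))
              \<and> (\<not> tzero 3 (ttr (gcross 4 H 2 D)) \<or> \<not> tzero 3 (ttr (gcross 4 H 2 a))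
                 \<or> \<not> tzero 3 (ttr (gcross 4 H 2 b)))"
  defines "C6 \<equiv> in_class (fam_symgroup FO) (DD 2)"
    and "C7 \<equiv> in_class (fam_symgroup FM) (ZZ 2)"
  shows "(in_class (symgroup 4 E) SO3 \<longleftrightarrow> C1)
       \<and> (in_class (symgroup 4 E) Oct \<longleftrightarrow> C2)
       \<and> (in_class (symgroup 4 E) O2 \<longleftrightarrow> C3)
       \<and> (in_class (symgroup 4 E) (DD 4) \<longleftrightarrow> C4)
       \<and> (in_class (symgroup 4 E) (DD 3) \<longleftrightarrow> C5)
       \<and> (in_class (symgroup 4 E) (DD 2) \<longleftrightarrow> C6)
       \<and> (in_class (symgroup 4 E) (ZZ 2) \<longleftrightarrow> C7)
       \<and> (in_class (symgroup 4 E) trivgrp \<longleftrightarrow> \<not> (C1 \<or> C2 \<or> C3 \<or> C4 \<or> C5 \<or> C6 \<or> C7))"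
proof -
  define F A B where "F = tform H" and "A = tmat a" and "B = tmat b"
  define X where "X = fsym F \<inter> msym {A, B}"
  have h: "harmonic F" unfolding F_def by (rule harmonic_tform[OF H_harm])
  have D: "tmat D = dten F" unfolding D_def F_def using dten_tform[OF H_harm] by simp
  have st: "sym_tl A" "sym_tl B" using a_st b_st by (simp_all add: A_def B_def sym_tl_tmat)
  have X: "symgroup 4 E = X"
    unfolding X_def F_def A_def B_def
    by (rule symgroup_elast[OF a_st b_st H_harm, of E lam mu]) (simp only: decomp elast_def)
  have L: "tmat (ddot42 H s) = lmap F (tmat s)" for s unfolding F_def using lmap_tform[OF H_harm] by simp
  have mF: "fam_symgroup [(2, D), (2, a), (2, b)] = msym {tmat D, A, B}"
    using fam_symgroup2[of "[D, a, b]"] by (simp add: A_def B_def)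
  have mO: "fam_symgroup FO = msym (famO F A B)"
    using fam_symgroup2[of "[D, a, b, c3 H, c4 H, ddot42 H a, ddot42 H b, ddot42 H (mprod a a), ddot42 H (mprod
        b b)]"]
    unfolding FO_def by (simp add: c3_def c4_def L D D_def[symmetric] tmat_mprod famO_def A_def[symmetric]
        B_def[symmetric])
  have mM: "fam_symgroup FM = msym (famM F A B)"
  proof -
    have "tmat ` set [D, a, b, c3 H, c4 H, ddot42 H a, ddot42 H b, ddot42 H (mprod a a), ddot42 H (mprod b b),
        ddot42 H (symprod a b), ddot42 H (symprod a D), ddot42 H (symprod b D)] = famM F A B"
      by (simp add: c3_def c4_def L D D_def[symmetric] tmat_mprod tmat_symprod famM_def famO_def
          A_def[symmetric] B_def[symmetric] Un_insert_left insert_commute)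
    then show ?thesis
      using fam_symgroup2[of "[D, a, b, c3 H, c4 H, ddot42 H a, ddot42 H b, ddot42 H (mprod a a), ddot42 H
          (mprod b b),
        ddot42 H (symprod a b), ddot42 H (symprod a D), ddot42 H (symprod b D)]"]
      unfolding FM_def FO_def by simp
  qed
  have TI: "TI \<longleftrightarrow> in_class (msym {tmat D, A, B}) O2" unfolding TI_def mF ..
  have sy: "transpose M = M" if "M \<in> {tmat D, A, B}" for M
    using that famO_symmetric[OF h st, of M] by (auto simp: famO_def D)
  define P where "P = (\<lambda>g s. diag3 (cj g (tmat s)) \<and> cj g (tmat s)$1$1 = cj g (tmat s)$2$2)"
  have frame: "\<exists>g\<in>SO3. (\<forall>s\<in>{d2 H, a, b}. P g s) \<and> (\<exists>s\<in>{d2 H, a, b}. cj g (tmat s)$1$1 \<noteq> cj g (tmat s)$3$3)" if TI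
  proof -
    have im: "{tmat D, A, B} = tmat ` {d2 H, a, b}" by (simp add: A_def B_def D_def)
    show ?thesis using in_class_O2_frame[of "{tmat D, A, B}", OF sy] that
      unfolding TI im P_def by (simp only: ball_simps bex_simps)
  qed
  define Z5 Z3 Y where "Z5 \<longleftrightarrow> (\<forall>s\<in>{d2 H, a, b}. tzero 5 (gcross 4 H 2 s))"
    and "Z3 \<longleftrightarrow> (\<forall>s\<in>{d2 H, a, b}. tzero 3 (ttr (gcross 4 H 2 s)))"
    and "Y \<longleftrightarrow> (\<forall>s\<in>{d2 H, a, b}. tzero 3 (gcross 2 s 2 (ddot42 H s)))"
  have C3: "C3 \<longleftrightarrow> TI \<and> Z5" and C4: "C4 \<longleftrightarrow> TI \<and> Z3 \<and> \<not> Z5" and C5: "C5 \<longleftrightarrow> TI \<and> Y \<and> \<not> Z3"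
    unfolding C3_def C4_def C5_def Z5_def Z3_def Y_def D_def by auto
  have C1: "C1 \<longleftrightarrow> A = 0 \<and> B = 0 \<and> dten F = 0"
    unfolding C1_def tzero2 D by (simp add: A_def B_def)
  have C2: "C2 \<longleftrightarrow> A = 0 \<and> B = 0 \<and> (\<exists>c. dten F = mat c) \<and> dten F \<noteq> 0"
    unfolding C2_def tzero2_dev unfolding tzero2 D A_def B_def by blast
  have C6: "C6 \<longleftrightarrow> in_class (msym (famO F A B)) (DD 2)" unfolding C6_def mO ..
  have C7: "C7 \<longleftrightarrow> in_class (msym (famM F A B)) (ZZ 2)" unfolding C7_def mM ..

  have i1: "in_class X SO3" if C1
    using that isotropic_class[OF h] in_class_refl[of SO3] unfolding C1 X_def by simp
  have i2: "in_class X Oct" if C2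
    using that cubic_class[OF h] unfolding C2 X_def by auto
  have fc: "(C3 \<longrightarrow> in_class X O2) \<and> (C4 \<longrightarrow> in_class X (DD 4)) \<and> (C5 \<longrightarrow> in_class X (DD 3))" if t: TI
  proof -
    obtain g where g: "g \<in> SO3" "\<forall>s\<in>{d2 H, a, b}. P g s"
      "\<exists>s\<in>{d2 H, a, b}. cj g (tmat s)$1$1 \<noteq> cj g (tmat s)$3$3"
      using frame[OF t] by blast
    note f = axial_frame_conditions[OF H_harm g(1) g(2)[unfolded P_def] g(3), folded Z5_def Z3_def Y_def F_def
        A_def B_def, folded X_def]
    note ax = axial_class[OF harmonic_rot4[OF h g(1)]]
    show ?thesis unfolding C3 C4 C5 f(1-4) using f(5) ax by blast
  qed
  have i3: "C3 \<Longrightarrow> in_class X O2" and i4: "C4 \<Longrightarrow> in_class X (DD 4)" and i5: "C5 \<Longrightarrow> in_class X (DD 3)"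
    using fc C3 C4 C5 by blast+
  have half: "1/2 \<notin> {3, -1::real}" by simp
  \<comment> \<open>The traces of the class of \<open>DD 2\<close> exclude a coaxial family, so the
    group of the family is the group of the tensor; the next step argues likewise.\<close>
  have i6: "in_class X (DD 2)" if C6
  proof -
    have "trace ` msym (famO F A B) = {3, -1}" using that in_class_trace classes_SO3 trace_classes(3) unfolding
        C6 by metis
    then have "\<not> coaxial (famO F A B)" using coaxial_trace half by metis
    then show ?thesis using that noncoaxial_group(1)[OF h st] unfolding C6 X_def by simp
  qed
  have i7: "in_class X (ZZ 2)" if C7
  proof -
    have "trace ` msym (famM F A B) = {3, -1}" using that in_class_trace classes_SO3 trace_classes(2) unfolding
        C7 by metis
    then have "\<not> coaxial (famM F A B)" using coaxial_trace half by metis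
    then have "\<not> coaxial (famO F A B)" using famO_coaxial_famM[OF h] by blast
    then show ?thesis using that noncoaxial_group(2)[OF h st] unfolding C7 X_def by simp
  qed
  have i8: "in_class X trivgrp" if n: "\<not> (C1 \<or> C2 \<or> C3 \<or> C4 \<or> C5 \<or> C6 \<or> C7)"
  proof (cases "coaxial (famO F A B)")
    case False
    note g = noncoaxial_group[OF h st False, folded X_def]
    have "in_class (msym (famO F A B)) (DD 2) \<or> in_class (msym (famO F A B)) (ZZ 2) \<or> msym (famO F A B) = trivgrp"
      by (rule msym_noncoaxial_class[OF famO_symmetric[OF h st] False])
    then have "in_class X (DD 2) \<or> in_class X (ZZ 2) \<or> X = trivgrp" unfolding g(1) .
    moreover have "\<not> in_class X (DD 2)" using n unfolding C6 g(1)[symmetric] by blast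
    moreover have "\<not> in_class X (ZZ 2)" using n unfolding C7 g(2)[symmetric] by blast
    ultimately show ?thesis using in_class_refl by metis
  next
    case True
    then obtain g where g: "g \<in> SO3" "\<And>M. M \<in> famO F A B \<Longrightarrow> diag3 (cj g M) \<and> cj g M$1$1 = cj g M$2$2"
      using coaxial_frame by blast
    have P: "\<forall>s\<in>{d2 H, a, b}. P g s"
    proof
      fix s assume that: "s \<in> {d2 H, a, b}"
      have "tmat s \<in> famO F A B" using that D by (auto simp: famO_def A_def B_def D_def)
      then show "P g s" using g(2) unfolding P_def by blast
    qed
    have False
    proof (cases "\<exists>s\<in>{d2 H, a, b}. cj g (tmat s)$1$1 \<noteq> cj g (tmat s)$3$3")
      \<comment> \<open>A nonscalar member gives \<open>TI\<close>, and its image under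
        \<open>lmap\<close> gives \<open>wt034\<close>, hence \<open>Y\<close>. Then
        \<open>C3\<close>, \<open>C4\<close> or \<open>C5\<close> holds according to whether
        \<open>Z5\<close> and \<open>Z3\<close> do.\<close>
      case True
      then obtain s where s: "s \<in> {d2 H, a, b}" "cj g (tmat s)$1$1 \<noteq> cj g (tmat s)$3$3" by blast
      interpret G: harmonic "rot4 g F" by (rule harmonic_rot4[OF h g(1)])
      have "msym (cj g ` {tmat D, A, B}) = O2"
        by (rule msym_O2[of _ "cj g (tmat s)"]) (use P s in \<open>auto simp: P_def A_def B_def D_def\<close>)
      then have "in_class (cj g ` msym {tmat D, A, B}) O2" using in_class_refl msym_image[OF g(1)] by metis
      then have t: TI unfolding TI in_class_cj_image[OF g(1)] .
      note f = axial_frame_conditions[OF H_harm g(1) P[unfolded P_def] True, folded Z5_def Z3_def Y_def F_def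
          A_def B_def, folded X_def]
      have "lmap F (tmat s) \<in> famO F A B" using s(1) D by (auto simp: famO_def A_def B_def D_def)
      then have "diag3 (cj g (lmap F (tmat s))) \<and> cj g (lmap F (tmat s))$1$1 = cj g (lmap F (tmat s))$2$2" by
          (rule g(2))
      then have "wt034 (rot4 g F)"
        using G.lmap_axis3_wt034[of "cj g (tmat s)"] bspec[OF P s(1)] s(2) unfolding P_def lmap_rot4[OF h g(1)]
            by blast
      then show False using n t unfolding C3 C4 C5 f(1-3) by blast
    next
      \<comment> \<open>All three are scalar, so \<open>a\<close> and \<open>b\<close> vanish by
        tracelessness and \<open>C1\<close> or \<open>C2\<close> holds.\<close>
      case False
      have sc': "\<exists>c. tmat s = mat c" if s: "s \<in> {d2 H, a, b}" for s
      proof -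
        have "\<exists>c. cj g (tmat s) = mat c" using bspec[OF P s] False s unfolding P_def by (subst mat_scalar_iff) auto
        then show ?thesis by (metis cj_inv(1) cj_mat g(1) SO3_transpose)
      qed
      have sc: "\<exists>c. dten F = mat c" "\<exists>c. A = mat c" "\<exists>c. B = mat c"
        using sc'[of "d2 H"] sc'[of a] sc'[of b] D by (simp_all add: A_def B_def D_def)
      have z: "M = 0" if ex: "\<exists>c. M = mat c" and tl: "sym_tl M" for M
      proof -
        obtain c where "M = mat c" using ex by blast
        then show ?thesis using sym_tl_entry(4)[OF tl] by (simp add: mat3_eq_iff mat3_entry)
      qed
      have "A = 0" "B = 0" using z sc st by blast+
      then show False using n sc(1) unfolding C1 C2 by blast
    qed
    then show ?thesis ..
  qed
  let ?K = "[SO3, Oct, O2, DD 4, DD 3, DD 2, ZZ 2, trivgrp]"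
  have ex: "i = j" if "i < 8" "j < 8" "in_class X (?K ! i)" "in_class X (?K ! j)" for i j
    by (rule classes_exclusive[OF that])
  have n8: "?K ! 0 = SO3" "?K ! 1 = Oct" "?K ! 2 = O2" "?K ! 3 = DD 4" "?K ! 4 = DD 3" "?K ! 5 = DD 2" "?K ! 6 =
      ZZ 2" "?K ! 7 = trivgrp"
    by simp_all
  \<comment> \<open>With numbered propositions the rest is propositional: 28 exclusions, seven
    implications and one default case.\<close>
  define Q where "Q = (\<lambda>i. in_class X (?K ! i))"
  have Q: "in_class X SO3 = Q 0" "in_class X Oct = Q 1" "in_class X O2 = Q 2" "in_class X (DD 4) = Q 3"
    "in_class X (DD 3) = Q 4" "in_class X (DD 2) = Q 5" "in_class X (ZZ 2) = Q 6" "in_class X trivgrp = Q 7"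
    unfolding Q_def n8 by simp_all
  have e: "\<not> (Q i \<and> Q j)" if "i < j" "j < 8" for i j :: nat
    using ex[of i j] that unfolding Q_def by auto
  have E: "\<not> (Q 0 \<and> Q 1)" "\<not> (Q 0 \<and> Q 2)" "\<not> (Q 0 \<and> Q 3)" "\<not> (Q 0 \<and> Q 4)" "\<not> (Q 0 \<and> Q 5)" "\<not> (Q 0 \<and> Q 6)" "\<not> (Q
      0 \<and> Q 7)"
    "\<not> (Q 1 \<and> Q 2)" "\<not> (Q 1 \<and> Q 3)" "\<not> (Q 1 \<and> Q 4)" "\<not> (Q 1 \<and> Q 5)" "\<not> (Q 1 \<and> Q 6)" "\<not> (Q 1 \<and> Q 7)"
    "\<not> (Q 2 \<and> Q 3)" "\<not> (Q 2 \<and> Q 4)" "\<not> (Q 2 \<and> Q 5)" "\<not> (Q 2 \<and> Q 6)" "\<not> (Q 2 \<and> Q 7)"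
    "\<not> (Q 3 \<and> Q 4)" "\<not> (Q 3 \<and> Q 5)" "\<not> (Q 3 \<and> Q 6)" "\<not> (Q 3 \<and> Q 7)"
    "\<not> (Q 4 \<and> Q 5)" "\<not> (Q 4 \<and> Q 6)" "\<not> (Q 4 \<and> Q 7)" "\<not> (Q 5 \<and> Q 6)" "\<not> (Q 5 \<and> Q 7)" "\<not> (Q 6 \<and> Q 7)"
    by (rule e; simp)+
  have I: "C1 \<longrightarrow> Q 0" "C2 \<longrightarrow> Q 1" "C3 \<longrightarrow> Q 2" "C4 \<longrightarrow> Q 3" "C5 \<longrightarrow> Q 4" "C6 \<longrightarrow> Q 5" "C7 \<longrightarrow> Q 6"
    using i1 i2 i3 i4 i5 i6 i7 unfolding Q by simp_all
  have J: "\<not> C1 \<longrightarrow> \<not> C2 \<longrightarrow> \<not> C3 \<longrightarrow> \<not> C4 \<longrightarrow> \<not> C5 \<longrightarrow> \<not> C6 \<longrightarrow> \<not> C7 \<longrightarrow> Q 7"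
    using i8 unfolding Q by simp
  show ?thesis unfolding X Q using E I J by argo
qed

end
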